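(* Let $d\ge 1$ be an integer and let $\beta>0$, $s>0$ be real parameters. Let $D(N)$ be the diameter of the long range percolation graph $G(N)$ on $\{0,1,\ldots,N\}^d$ with parameters $\beta,s$. There exist constants $C_1,C_2,C_s>0$, $\delta>1$, $0<\eta_1<\eta_2<1$, which in general depend on $s$, $\beta$ and the dimension $d$ (but not on $N$), such that: \begin{enumerate} \item If $s>2d$, then for any $\psi<\frac{s-2d}{s-d-1}$, $\lim_{N\to\infty}\mathrm{Prob}\{D(N)\ge N^{\psi}\}=1$. \item If $s=2d$, then $\lim_{N\to\infty}\mathrm{Prob}\{D(N)\le N^{\eta_2}\}=1$; and if $d=1$, $s=2$, $\beta<1$, then $\lim_{N\to\infty}\mathrm{Prob}\{D(N)\ge N^{\eta_1}\}=1$. \item If $d<s<2d$, then $\lim_{N\to\infty}\mathrm{Prob}\{C_s\log N\le D(N)\le (\log N)^{\delta}\}=1$. \item If $s=d$, then $\lim_{N\to\infty}\mathrm{Prob}\left\{\frac{C_1\log N}{\log\log N}\le D(N)\le \frac{C_2\log N}{\log\log N}\right\}=1$. \end{enumerate}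
   Context: For $\mathbf{x}\in\mathbb{Z}^d$ let $\|\mathbf{x}\|=\sum_{i=1}^d|x_i|$ be the $L_1$ norm. The long range percolation graph $G(N)$ with parameters $\beta,s>0$ is the random undirected graph with node set $\{0,1,\ldots,N\}^d$ in which distinct nodes $\mathbf{x},\mathbf{y}$ are joined by an edge with probability $1$ if $\|\mathbf{x}-\mathbf{y}\|=1$, and with probability $1-\exp(-\beta/\|\mathbf{x}-\mathbf{y}\|^s)$ otherwise, independently for different pairs. $D(N)$ denotes the (random) graph diameter of $G(N)$, i.e. the maximum over pairs of nodes of the length (number of edges) of a shortest path between them. Logarithms are to base $e$. *)

theory Defs
  imports "HOL-Probability.Probability" "HOL-Library.Extended_Nat"
begin

section \<open>Distances in undirected graphs\<close>

text \<open>
  A simple undirected graph is given by its vertex set \<open>V\<close> and its set \<open>E\<close> of edges, each edge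
  being a two-element subset of \<open>V\<close>.  Distances take values in \<^typ>\<open>enat\<close>, so that they are
  \<open>\<infinity>\<close> between vertices that no path joins.
\<close>

definition is_path :: "'a set \<Rightarrow> 'a set set \<Rightarrow> 'a \<Rightarrow> 'a list \<Rightarrow> 'a \<Rightarrow> bool" where
  "is_path V E x p y \<longleftrightarrow>
     p \<noteq> [] \<and> hd p = x \<and> last p = y \<and> set p \<subseteq> V \<and> distinct p \<and>
     successively (\<lambda>u v. {u, v} \<in> E) p"

definition path_length :: "'a list \<Rightarrow> nat" where
  "path_length p = length p - 1"

definition graph_dist :: "'a set \<Rightarrow> 'a set set \<Rightarrow> 'a \<Rightarrow> 'a \<Rightarrow> enat" where
  "graph_dist V E x y = (INF p\<in>{p. is_path V E x p y}. enat (path_length p))"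

definition graph_diameter :: "'a set \<Rightarrow> 'a set set \<Rightarrow> enat" where
  "graph_diameter V E = (SUP x\<in>V. SUP y\<in>V. graph_dist V E x y)"


section \<open>Long range percolation\<close>

text \<open>
  A point of the \<open>d\<close>-dimensional integer lattice is a function on \<open>nat\<close>, of which only the
  coordinates \<open>i < d\<close> matter; the nodes below are extensional functions, so distinct nodes
  differ in one of these coordinates.
\<close>

definition l1_norm :: "nat \<Rightarrow> (nat \<Rightarrow> int) \<Rightarrow> int" where
  "l1_norm d x = (\<Sum>i<d. \<bar>x i\<bar>)"

definition lrp_nodes :: "nat \<Rightarrow> nat \<Rightarrow> (nat \<Rightarrow> int) set" where
  "lrp_nodes d N = (\<Pi>\<^sub>E i\<in>{..<d}. {0..int N})"

definition lrp_pairs :: "nat \<Rightarrow> nat \<Rightarrow> (nat \<Rightarrow> int) set set" where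
  "lrp_pairs d N = {{x, y} |x y. x \<in> lrp_nodes d N \<and> y \<in> lrp_nodes d N \<and> x \<noteq> y}"

text \<open>
  The length of an unordered pair \<open>e = {x, y}\<close> is the norm of \<open>x - y\<close>; the maximum over all
  \<open>u, v \<in> e\<close> makes this independent of a choice of order (see \<open>pair_length_doubleton\<close>).
\<close>

definition pair_length :: "nat \<Rightarrow> (nat \<Rightarrow> int) set \<Rightarrow> int" where
  "pair_length d e = Max ((\<lambda>(u, v). l1_norm d (\<lambda>i. u i - v i)) ` (e \<times> e))"

lemma pair_length_doubleton:
  "pair_length d {x, y} = l1_norm d (\<lambda>i. x i - y i)"
proof -
  have "l1_norm d (\<lambda>i. y i - x i) = l1_norm d (\<lambda>i. x i - y i)"
    unfolding l1_norm_def by (intro sum.cong) auto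
  moreover have "l1_norm d (\<lambda>i. x i - y i) \<ge> 0"
    unfolding l1_norm_def by (intro sum_nonneg) auto
  moreover have "l1_norm d (\<lambda>i. 0) = 0"
    unfolding l1_norm_def by simp
  ultimately show ?thesis
    unfolding pair_length_def by (simp add: insert_Times_insert max_def)
qed

definition lrp_edge_prob :: "real \<Rightarrow> real \<Rightarrow> int \<Rightarrow> real" where
  "lrp_edge_prob \<beta> s r = (if r = 1 then 1 else 1 - exp (- \<beta> / real_of_int r powr s))"

definition lrp_graph :: "nat \<Rightarrow> real \<Rightarrow> real \<Rightarrow> nat \<Rightarrow> (nat \<Rightarrow> int) set set pmf" where
  "lrp_graph d \<beta> s N =
     map_pmf (\<lambda>\<omega>. {e \<in> lrp_pairs d N. \<omega> e})
       (Pi_pmf (lrp_pairs d N) False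
         (\<lambda>e. bernoulli_pmf (lrp_edge_prob \<beta> s (pair_length d e))))"

lemma finite_lrp_pairs: "finite (lrp_pairs d N)"
proof (rule finite_subset)
  show "lrp_pairs d N \<subseteq> Pow (lrp_nodes d N)"
    by (auto simp: lrp_pairs_def)
  show "finite (Pow (lrp_nodes d N))"
    by (simp add: lrp_nodes_def finite_PiE)
qed

lemma prob_lrp_graph_edge:
  assumes "\<beta> > 0" "x \<in> lrp_nodes d N" "y \<in> lrp_nodes d N" "x \<noteq> y"
  shows "measure_pmf.prob (lrp_graph d \<beta> s N) {E. {x, y} \<in> E} =
         lrp_edge_prob \<beta> s (l1_norm d (\<lambda>i. x i - y i))"
proof -
  let ?p = "\<lambda>e. lrp_edge_prob \<beta> s (pair_length d e)"
  have e: "{x, y} \<in> lrp_pairs d N"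
    using assms by (auto simp: lrp_pairs_def)
  have "measure_pmf.prob (lrp_graph d \<beta> s N) {E. {x, y} \<in> E} =
        measure_pmf.prob (Pi_pmf (lrp_pairs d N) False (\<lambda>e. bernoulli_pmf (?p e))) {\<omega>. \<omega> {x, y}}"
    using e by (simp add: lrp_graph_def vimage_def)
  also have "\<dots> = measure_pmf.prob
      (map_pmf (\<lambda>\<omega>. \<omega> {x, y}) (Pi_pmf (lrp_pairs d N) False (\<lambda>e. bernoulli_pmf (?p e)))) {True}"
    by (simp add: vimage_def)
  also have "\<dots> = pmf (bernoulli_pmf (?p {x, y})) True"
    using e by (simp add: Pi_pmf_component finite_lrp_pairs measure_pmf_single)
  also have "\<dots> = ?p {x, y}"
    using assms(1) by (subst pmf_bernoulli_True) (auto simp: lrp_edge_prob_def)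
  finally show ?thesis
    by (simp add: pair_length_doubleton)
qed

abbreviation lrp_diameter :: "nat \<Rightarrow> nat \<Rightarrow> (nat \<Rightarrow> int) set set \<Rightarrow> ereal" where
  "lrp_diameter d N E \<equiv> ereal_of_enat (graph_diameter (lrp_nodes d N) E)"

end

(*
  The lower bounds for s > 2d, d <= s < 2d are first moment bounds: a shortest path uses every edge
  at most once, so a total length o(N) of the edges longer than N^(1 - psi) forces N^psi edges, and
  the expected number of self-avoiding paths of n edges from a node is at most (mean degree)^n,
  where the mean degree is bounded for s > d and of order log N for s = d.  For d = 1, s = 2,
  beta < 1 every cut edge {i, i + 1} that no other edge jumps over must be used; i is such a cut
  with probability at least of order i^(-beta), and the number of cuts, each weighted by
  1 / (i P(i is a cut)), concentrates because scales far apart are almost independent.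

  For s < 2d any two boxes of side K^gamma, s / 2d < gamma < 1, inside a box of side K are joined
  by an edge except with tiny probability, so the diameter at scale K is about twice the one at
  scale K^gamma.  For s = 2d the expected distance along an axis at scale M^(n + 1) is at most rho
  times the one at scale M^n with rho < M, since with a probability bounded below the two end boxes
  of a row are joined directly; independence of the boxes of a row turns this into an exponential
  tail bound.  For s = d neighbourhoods explored along edges of length between N^0.7 and N^0.9 grow
  by a factor of order log N per step up to size N^(0.6 d), and two such neighbourhoods that are far
  apart are joined by an edge longer than all the explored ones.
*)

theory Submission
  imports Defs "HOL-Real_Asymp.Real_Asymp"
begin

section \<open>Graph distances\<close>

text \<open>The exponent for s > 2d comes from a balance: edges longer than N^(1 - psi) have
  expected total length of order N^(d - (1 - psi)(s - d - 1)), up to a small loss in the exponent,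
  and this is o(N) for psi < (s - 2d)/(s - d - 1). At s = 2d the probability that two boxes of side
  k at distance of order k are joined does not depend on k. No scale is good with high probability,
  so the recursion runs on expectations, and tails are recovered from independence only once, at
  side about sqrt N. An unweighted count of cuts is dominated by its largest scale and need not
  concentrate; the weights let every scale contribute equally, so that the variance is of the order
  of the mean log N. At s = d every doubling of the edge length contributes equally to the mean
  degree, hence intermediate edges alone give a degree of order log N. The exponent 0.6 lies below
  0.7, so that explored nodes are negligible among the possible neighbours, and above 1/2, so that
  the N^(1.2 d) pairs between two explored sets outweigh an edge probability of order N^(-d).
  Independence always means functions of E determined by E \<inter> F and E \<inter> G with F and G
  disjoint.\<close>

lemma graph_dist_le_iff:
  "graph_dist V E x y \<le> enat n \<longleftrightarrow> (\<exists>p. is_path V E x p y \<and> length p \<le> Suc n)"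
proof -
  have "graph_dist V E x y \<le> enat n \<longleftrightarrow> graph_dist V E x y < enat (Suc n)"
    by (cases "graph_dist V E x y") auto
  also have "\<dots> \<longleftrightarrow> (\<exists>p. is_path V E x p y \<and> length p - 1 < Suc n)"
    by (simp add: graph_dist_def INF_less_iff path_length_def)
  also have "\<dots> \<longleftrightarrow> (\<exists>p. is_path V E x p y \<and> length p \<le> Suc n)"
    by (metis (no_types, lifting) is_path_def One_nat_def Suc_pred length_greater_0_conv less_Suc_eq_le not_less_eq_eq)
  finally show ?thesis .
qed

text \<open>Cutting out the closed piece between two visits to the same vertex keeps both ends and
  shortens the walk. This allows paths to be concatenated without regard to repeated
  vertices.\<close>

lemma walk_imp_path:
  assumes "p \<noteq> []" "set p \<subseteq> V" "successively (\<lambda>u v. {u, v} \<in> E) p"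
  shows "\<exists>q. is_path V E (hd p) q (last p) \<and> length q \<le> length p"
  using assms
proof (induction p rule: length_induct)
  case (1 p)
  show ?case
  proof (cases "distinct p")
    case True
    then show ?thesis using 1 by (auto simp: is_path_def)
  next
    case False
    then obtain xs ys zs a where p: "p = xs @ [a] @ ys @ [a] @ zs"
      using not_distinct_decomp by blast
    let ?q = "xs @ [a] @ zs"
    have "length ?q < length p" "?q \<noteq> []" "set ?q \<subseteq> V" "successively (\<lambda>u v. {u, v} \<in> E) ?q"
      using 1 by (auto simp: p successively_append_iff successively_Cons)
    then have "\<exists>r. is_path V E (hd ?q) r (last ?q) \<and> length r \<le> length ?q"
      using 1(1) by blast
    moreover have "hd ?q = hd p" "last ?q = last p"
      by (auto simp: p hd_append)
    ultimately show ?thesis using \<open>length ?q < length p\<close> by fastforce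
  qed
qed

lemma graph_dist_le_walk:
  assumes "p \<noteq> []" "set p \<subseteq> V" "successively (\<lambda>u v. {u, v} \<in> E) p" "hd p = x" "last p = y"
    "length p \<le> Suc n"
  shows "graph_dist V E x y \<le> enat n"
  unfolding graph_dist_le_iff using walk_imp_path[OF assms(1-3)] assms by force

lemma graph_dist_refl: "x \<in> V \<Longrightarrow> graph_dist V E x x = 0"
  using graph_dist_le_walk[of "[x]" V E x x 0] by (simp add: zero_enat_def[symmetric])

lemma graph_dist_edge: "x \<in> V \<Longrightarrow> y \<in> V \<Longrightarrow> {x, y} \<in> E \<Longrightarrow> graph_dist V E x y \<le> 1"
  using graph_dist_le_walk[of "[x, y]" V E x y 1] by (simp add: one_enat_def)

lemma graph_dist_mono:
  assumes "V \<subseteq> V'" "E \<subseteq> E'"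
  shows "graph_dist V' E' x y \<le> graph_dist V E x y"
  unfolding graph_dist_def
proof (rule INF_superset_mono)
  show "{p. is_path V E x p y} \<subseteq> {p. is_path V' E' x p y}"
    using assms by (auto simp: is_path_def elim!: successively_mono)
qed simp

lemma graph_dist_commute: "graph_dist V E x y = graph_dist V E y x"
proof -
  have "graph_dist V E x y \<le> graph_dist V E y x" for x y
  proof (cases "graph_dist V E y x")
    case (enat n)
    then obtain p where p: "is_path V E y p x" "length p \<le> Suc n"
      using graph_dist_le_iff by (metis order_refl)
    then have "is_path V E x (rev p) y"
      by (auto simp: is_path_def hd_rev last_rev insert_commute)
    then have "graph_dist V E x y \<le> enat n"
      using p(2) unfolding graph_dist_le_iff by (intro exI[of _ "rev p"]) auto
    then show ?thesis by (simp add: enat)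
  qed simp
  then show ?thesis by (simp add: antisym)
qed

lemma graph_dist_triangle: "graph_dist V E x z \<le> graph_dist V E x y + graph_dist V E y z"
proof (cases "graph_dist V E x y"; cases "graph_dist V E y z")
  fix m n assume m: "graph_dist V E x y = enat m" and n: "graph_dist V E y z = enat n"
  obtain p where p: "is_path V E x p y" "length p \<le> Suc m"
    using m graph_dist_le_iff by (metis order_refl)
  obtain q where q: "is_path V E y q z" "length q \<le> Suc n"
    using n graph_dist_le_iff by (metis order_refl)
  obtain q' where q': "q = y # q'"
    using q(1) by (cases q) (auto simp: is_path_def)
  have "graph_dist V E x z \<le> enat (m + n)"
    using p q unfolding q'
    by (intro graph_dist_le_walk[of "p @ q'"])
      (auto simp: is_path_def successively_append_iff successively_Cons split: if_splits)
  then show ?thesis by (simp add: m n)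
qed auto

lemma is_path_restrict:
  assumes "\<And>u v. u \<in> V \<Longrightarrow> v \<in> V \<Longrightarrow> u \<noteq> v \<Longrightarrow> {u, v} \<in> F"
  shows "is_path V (E \<inter> F) x p y \<longleftrightarrow> is_path V E x p y"
proof -
  have "successively (\<lambda>u v. {u, v} \<in> E \<inter> F) p \<longleftrightarrow> successively (\<lambda>u v. {u, v} \<in> E) p"
    if "set p \<subseteq> V" "distinct p"
    using that
  proof (induction p)
    case (Cons a p)
    then show ?case
      using assms by (cases p) auto
  qed simp
  then show ?thesis by (auto simp: is_path_def)
qed

text \<open>Makes the distance inside a vertex set a function of the edges within that set, which is
  the form in which independence is used.\<close>

lemma graph_dist_restrict:
  assumes "\<And>u v. u \<in> V \<Longrightarrow> v \<in> V \<Longrightarrow> u \<noteq> v \<Longrightarrow> {u, v} \<in> F"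
  shows "graph_dist V (E \<inter> F) x y = graph_dist V E x y"
proof -
  have "is_path V (E \<inter> F) x p y = is_path V E x p y" for p
    using assms by (rule is_path_restrict)
  then show ?thesis by (simp add: graph_dist_def)
qed

lemma graph_diameter_le_iff:
  "graph_diameter V E \<le> n \<longleftrightarrow> (\<forall>x\<in>V. \<forall>y\<in>V. graph_dist V E x y \<le> n)"
  by (simp add: graph_diameter_def SUP_le_iff)

lemma graph_dist_le_diameter: "x \<in> V \<Longrightarrow> y \<in> V \<Longrightarrow> graph_dist V E x y \<le> graph_diameter V E"
  using graph_diameter_le_iff[of V E "graph_diameter V E"] by simp

section \<open>Random sets with independent elements\<close>

text \<open>The law of \<open>lrp_graph\<close> with a general ground set and general probabilities.
  The freedom in \<open>A\<close> matters because independence is obtained by splitting the ground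
  set.\<close>

definition rand_set :: "'a set \<Rightarrow> ('a \<Rightarrow> real) \<Rightarrow> 'a set pmf" where
  "rand_set A p = map_pmf (\<lambda>\<omega>. {e \<in> A. \<omega> e}) (Pi_pmf A False (\<lambda>e. bernoulli_pmf (p e)))"

lemma set_rand_set: "set_pmf (rand_set A p) \<subseteq> Pow A"
  by (auto simp: rand_set_def)

lemma finite_set_rand_set [simp]: "finite A \<Longrightarrow> finite (set_pmf (rand_set A p))"
  by (rule finite_subset[OF set_rand_set]) simp

lemma integrable_rand_set [simp]:
  "finite A \<Longrightarrow> integrable (measure_pmf (rand_set A p)) (f :: _ \<Rightarrow> real)"
  by (simp add: integrable_measure_pmf_finite)

lemma rand_set_union:
  assumes "finite A" "finite B" "A \<inter> B = {}"
  shows "rand_set (A \<union> B) p = map_pmf (\<lambda>(X, Y). X \<union> Y) (pair_pmf (rand_set A p) (rand_set B p))"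
proof -
  have "rand_set (A \<union> B) p = map_pmf (\<lambda>\<omega>. {e \<in> A. fst \<omega> e} \<union> {e \<in> B. snd \<omega> e})
     (pair_pmf (Pi_pmf A False (\<lambda>e. bernoulli_pmf (p e))) (Pi_pmf B False (\<lambda>e. bernoulli_pmf (p e))))"
    unfolding rand_set_def Pi_pmf_union[OF assms] map_pmf_comp
    using assms(3) by (intro map_pmf_cong refl) (auto simp: case_prod_unfold)
  also have "\<dots> = map_pmf (\<lambda>(X, Y). X \<union> Y) (pair_pmf (rand_set A p) (rand_set B p))"
    unfolding rand_set_def
    by (simp add: pair_map_pmf1 pair_map_pmf2 map_pmf_comp case_prod_unfold)
  finally show ?thesis .
qed

lemma expectation_pair_pmf_mult:
  fixes f :: "'a \<Rightarrow> real" and g :: "'b \<Rightarrow> real"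
  assumes "finite (set_pmf P)" "finite (set_pmf Q)"
  shows "measure_pmf.expectation (pair_pmf P Q) (\<lambda>z. f (fst z) * g (snd z)) =
    measure_pmf.expectation P f * measure_pmf.expectation Q g"
proof -
  have "measure_pmf.expectation (pair_pmf P Q) (\<lambda>z. f (fst z) * g (snd z)) =
    (\<Sum>z\<in>set_pmf P \<times> set_pmf Q. f (fst z) * g (snd z) * pmf (pair_pmf P Q) z)"
    using assms by (intro integral_measure_pmf_real) auto
  also have "\<dots> = (\<Sum>z\<in>set_pmf P \<times> set_pmf Q. (f (fst z) * pmf P (fst z)) * (g (snd z) * pmf Q (snd z)))"
    by (intro sum.cong refl) (auto simp: pmf_pair)
  also have "\<dots> = (\<Sum>x\<in>set_pmf P. \<Sum>y\<in>set_pmf Q. (f x * pmf P x) * (g y * pmf Q y))"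
    by (simp add: sum.cartesian_product case_prod_unfold)
  also have "\<dots> = (\<Sum>x\<in>set_pmf P. f x * pmf P x) * (\<Sum>y\<in>set_pmf Q. g y * pmf Q y)"
    by (simp add: sum_product)
  also have "\<dots> = measure_pmf.expectation P f * measure_pmf.expectation Q g"
    using assms by (simp add: integral_measure_pmf_real[of "set_pmf _"])
  finally show ?thesis .
qed

text \<open>The equation \<open>f (E \<inter> F) = f E\<close> says that \<open>f\<close> looks only
  at elements of \<open>F\<close>. Splitting \<open>A\<close> into \<open>A \<inter> F\<close> and
  \<open>A - F\<close> makes the law a product; the second part contains all that \<open>g\<close>
  looks at, since \<open>G\<close> is disjoint from \<open>F\<close>.\<close>

lemma expectation_rand_set_mult:
  fixes f g :: "'a set \<Rightarrow> real"
  assumes "finite A" "F \<inter> G = {}" "\<And>E. f (E \<inter> F) = f E" "\<And>E. g (E \<inter> G) = g E"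
  shows "measure_pmf.expectation (rand_set A p) (\<lambda>E. f E * g E) =
    measure_pmf.expectation (rand_set A p) f * measure_pmf.expectation (rand_set A p) g"
proof -
  let ?R = "pair_pmf (rand_set (A \<inter> F) p) (rand_set (A - F) p)"
  have R: "rand_set A p = map_pmf (\<lambda>(X, Y). X \<union> Y) ?R"
  proof -
    have "A \<inter> F \<union> (A - F) = A" "A \<inter> F \<inter> (A - F) = {}" by auto
    then show ?thesis
      using rand_set_union[of "A \<inter> F" "A - F" p] assms(1) by simp
  qed
  have f: "f (X \<union> Y) = f X" and g: "g (X \<union> Y) = g Y"
    if "(X, Y) \<in> set_pmf ?R" for X Y
  proof -
    have XY: "X \<subseteq> A \<inter> F" "Y \<subseteq> A - F"
      using that set_rand_set by fastforce+
    then have "(X \<union> Y) \<inter> F = X \<inter> F" "(X \<union> Y) \<inter> G = Y \<inter> G"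
      using assms(2) by auto
    then show "f (X \<union> Y) = f X" "g (X \<union> Y) = g Y"
      by (metis assms(3), metis assms(4))
  qed
  have 1: "measure_pmf.expectation (rand_set A p) h =
      measure_pmf.expectation ?R (\<lambda>z. h (fst z \<union> snd z))" for h :: "'a set \<Rightarrow> real"
    unfolding R by (simp add: case_prod_unfold)
  have "measure_pmf.expectation (rand_set A p) (\<lambda>E. f E * g E) =
     measure_pmf.expectation ?R (\<lambda>z. f (fst z) * g (snd z))"
    unfolding 1 using f g by (intro integral_cong_AE) (auto simp: AE_measure_pmf_iff)
  also have "\<dots> = measure_pmf.expectation (rand_set (A \<inter> F) p) f * measure_pmf.expectation (rand_set (A - F) p) g"
    using assms(1) by (intro expectation_pair_pmf_mult) auto
  also have "measure_pmf.expectation (rand_set (A \<inter> F) p) f = measure_pmf.expectation ?R (\<lambda>z. f (fst z))"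
    by simp
  also have "\<dots> = measure_pmf.expectation (rand_set A p) f"
    unfolding 1 using f by (intro integral_cong_AE) (auto simp: AE_measure_pmf_iff)
  also have "measure_pmf.expectation (rand_set (A - F) p) g = measure_pmf.expectation ?R (\<lambda>z. g (snd z))"
    by simp
  also have "\<dots> = measure_pmf.expectation (rand_set A p) g"
    unfolding 1 using g by (intro integral_cong_AE) (auto simp: AE_measure_pmf_iff)
  finally show ?thesis .
qed

lemma prob_rand_set_Int:
  assumes "finite A" "F \<inter> G = {}" "\<And>E. E \<inter> F \<in> X \<longleftrightarrow> E \<in> X" "\<And>E. E \<inter> G \<in> Y \<longleftrightarrow> E \<in> Y"
  shows "measure_pmf.prob (rand_set A p) (X \<inter> Y) =
    measure_pmf.prob (rand_set A p) X * measure_pmf.prob (rand_set A p) Y"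
proof -
  have "measure_pmf.expectation (rand_set A p) (\<lambda>E. indicator X E * indicator Y E) =
    measure_pmf.prob (rand_set A p) X * measure_pmf.prob (rand_set A p) Y"
    using expectation_rand_set_mult[OF assms(1,2), of "indicator X" "indicator Y" p] assms(3,4)
    by (simp add: indicator_def)
  then show ?thesis
    by (simp add: indicator_inter_arith[symmetric])
qed

lemma prob_rand_set_avoid:
  assumes "finite A" "F \<subseteq> A" "\<And>e. e \<in> A \<Longrightarrow> 0 \<le> p e \<and> p e \<le> 1"
  shows "measure_pmf.prob (rand_set A p) {E. E \<inter> F = {}} = (\<Prod>e\<in>F. 1 - p e)"
proof -
  have "(\<lambda>\<omega>. {e \<in> A. \<omega> e}) -` {E. E \<inter> F = {}} = Pi A (\<lambda>e. if e \<in> F then {False} else UNIV)"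
    using assms(2) by (auto split: if_splits)
  then have "measure_pmf.prob (rand_set A p) {E. E \<inter> F = {}} =
      (\<Prod>e\<in>A. measure_pmf.prob (bernoulli_pmf (p e)) (if e \<in> F then {False} else UNIV))"
    using assms(1) by (simp add: rand_set_def measure_Pi_pmf_Pi)
  also have "\<dots> = (\<Prod>e\<in>A. if e \<in> F then 1 - p e else 1)"
    using assms(3) by (intro prod.cong) (auto simp: measure_pmf_single)
  also have "\<dots> = (\<Prod>e\<in>F. 1 - p e)"
    using assms(1,2) by (simp add: prod.If_cases Int_absorb1)
  finally show ?thesis .
qed

lemma prob_rand_set_contain:
  assumes "finite A" "F \<subseteq> A" "\<And>e. e \<in> A \<Longrightarrow> 0 \<le> p e \<and> p e \<le> 1"
  shows "measure_pmf.prob (rand_set A p) {E. F \<subseteq> E} = (\<Prod>e\<in>F. p e)"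
proof -
  have "(\<lambda>\<omega>. {e \<in> A. \<omega> e}) -` {E. F \<subseteq> E} = Pi A (\<lambda>e. if e \<in> F then {True} else UNIV)"
    using assms(2) by (auto split: if_splits)
  then have "measure_pmf.prob (rand_set A p) {E. F \<subseteq> E} =
      (\<Prod>e\<in>A. measure_pmf.prob (bernoulli_pmf (p e)) (if e \<in> F then {True} else UNIV))"
    using assms(1) by (simp add: rand_set_def measure_Pi_pmf_Pi)
  also have "\<dots> = (\<Prod>e\<in>A. if e \<in> F then p e else 1)"
    using assms(3) by (intro prod.cong) (auto simp: measure_pmf_single)
  also have "\<dots> = (\<Prod>e\<in>F. p e)"
    using assms(1,2) by (simp add: prod.If_cases Int_absorb1)
  finally show ?thesis .
qed

lemma expectation_sum_rand_set:
  fixes w :: "'a \<Rightarrow> real"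
  assumes "finite A" "F \<subseteq> A" "\<And>e. e \<in> A \<Longrightarrow> 0 \<le> p e \<and> p e \<le> 1"
  shows "measure_pmf.expectation (rand_set A p) (\<lambda>E. \<Sum>e\<in>E \<inter> F. w e) = (\<Sum>e\<in>F. w e * p e)"
proof -
  have fin: "finite F" using assms finite_subset by auto
  have "(\<Sum>e\<in>E \<inter> F. w e) = (\<Sum>e\<in>F. w e * indicator {E. {e} \<subseteq> E} E)" for E
    using fin by (auto simp: indicator_def sum.inter_restrict Int_commute intro!: sum.cong)
  then have "measure_pmf.expectation (rand_set A p) (\<lambda>E. \<Sum>e\<in>E \<inter> F. w e) =
      (\<Sum>e\<in>F. measure_pmf.expectation (rand_set A p) (\<lambda>E. w e * indicator {E. {e} \<subseteq> E} E))"
    using assms(1) by (simp add: Bochner_Integration.integral_sum del: insert_subset)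
  also have "\<dots> = (\<Sum>e\<in>F. w e * p e)"
  proof (intro sum.cong refl)
    fix e assume "e \<in> F"
    then have "measure_pmf.prob (rand_set A p) {E. {e} \<subseteq> E} = p e"
      using prob_rand_set_contain[OF assms(1) _ assms(3), of "{e}"] assms(2) by auto
    then show "measure_pmf.expectation (rand_set A p) (\<lambda>E. w e * indicator {E. {e} \<subseteq> E} E) = w e * p e"
      by simp
  qed
  finally show ?thesis .
qed

text \<open>The implication is required only on the support, where for instance all unit edges are
  known to be present.\<close>

lemma prob_pmf_mono:
  assumes "\<And>x. x \<in> set_pmf M \<Longrightarrow> x \<in> A \<Longrightarrow> x \<in> B"
  shows "measure_pmf.prob M A \<le> measure_pmf.prob M B"
proof -
  have "measure_pmf.prob M A = measure_pmf.prob M (A \<inter> set_pmf M)"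
    by (simp add: measure_Int_set_pmf)
  also have "\<dots> \<le> measure_pmf.prob M B"
    using assms by (intro measure_pmf.finite_measure_mono) auto
  finally show ?thesis .
qed

lemma prob_pmf_markov:
  fixes f :: "'a \<Rightarrow> real"
  assumes "finite (set_pmf M)" "\<And>x. x \<in> set_pmf M \<Longrightarrow> f x \<ge> 0" "c > 0"
  shows "measure_pmf.prob M {x. f x \<ge> c} \<le> measure_pmf.expectation M f / c"
proof -
  have "c * measure_pmf.prob M {x. f x \<ge> c} = measure_pmf.expectation M (\<lambda>x. c * indicator {x. f x \<ge> c} x)"
    by simp
  also have "\<dots> \<le> measure_pmf.expectation M f"
    using assms by (intro integral_mono_AE integrable_measure_pmf_finite)
      (auto simp: AE_measure_pmf_iff indicator_def)
  finally show ?thesis using assms(3) by (simp add: field_simps)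
qed

lemma prob_tendsto_1I:
  assumes "\<forall>\<^sub>F N in sequentially. measure_pmf.prob (M N) (- A N) \<le> b N" "b \<longlonglongrightarrow> 0"
  shows "(\<lambda>N. measure_pmf.prob (M N) (A N)) \<longlonglongrightarrow> 1"
proof (rule tendsto_sandwich)
  show "\<forall>\<^sub>F N in sequentially. 1 - b N \<le> measure_pmf.prob (M N) (A N)"
    using assms(1)
  proof eventually_elim
    case (elim N)
    then show ?case
      using measure_pmf.prob_compl[of "A N" "M N"] by (simp add: Compl_eq_Diff_UNIV)
  qed
  show "(\<lambda>N. 1 - b N) \<longlonglongrightarrow> 1"
    using tendsto_diff[OF tendsto_const assms(2), of 1] by simp
qed auto

lemma prob_Int_tendsto_1:
  assumes "(\<lambda>N. measure_pmf.prob (M N) (A N)) \<longlonglongrightarrow> 1" "(\<lambda>N. measure_pmf.prob (M N) (B N)) \<longlonglongrightarrow> 1"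
  shows "(\<lambda>N. measure_pmf.prob (M N) (A N \<inter> B N)) \<longlonglongrightarrow> 1"
proof (rule prob_tendsto_1I)
  have "measure_pmf.prob (M N) (- (A N \<inter> B N)) \<le>
      (1 - measure_pmf.prob (M N) (A N)) + (1 - measure_pmf.prob (M N) (B N))" for N
    using measure_Un_le[of "- A N" "measure_pmf (M N)" "- B N"]
      measure_pmf.prob_compl[of "A N" "M N"] measure_pmf.prob_compl[of "B N" "M N"]
    by (simp add: Compl_eq_Diff_UNIV[symmetric] Compl_Int)
  then show "\<forall>\<^sub>F N in sequentially. measure_pmf.prob (M N) (- (A N \<inter> B N)) \<le>
      (1 - measure_pmf.prob (M N) (A N)) + (1 - measure_pmf.prob (M N) (B N))"
    by simp
  show "(\<lambda>N. (1 - measure_pmf.prob (M N) (A N)) + (1 - measure_pmf.prob (M N) (B N))) \<longlonglongrightarrow> 0"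
    using tendsto_add[OF tendsto_diff[OF tendsto_const assms(1), of 1] tendsto_diff[OF tendsto_const assms(2), of 1]]
    by simp
qed

section \<open>The lattice cube\<close>

definition ldist :: "nat \<Rightarrow> (nat \<Rightarrow> int) \<Rightarrow> (nat \<Rightarrow> int) \<Rightarrow> nat" where
  "ldist d x y = nat (l1_norm d (\<lambda>i. x i - y i))"

lemma int_ldist: "int (ldist d x y) = (\<Sum>i<d. \<bar>x i - y i\<bar>)"
  by (simp add: ldist_def l1_norm_def sum_nonneg)

lemma pair_length_eq: "pair_length d {x, y} = int (ldist d x y)"
  by (simp add: pair_length_doubleton ldist_def l1_norm_def sum_nonneg)

lemma ldist_commute: "ldist d x y = ldist d y x"
  by (metis insert_commute pair_length_eq of_nat_eq_iff)

lemma ldist_triangle: "ldist d x z \<le> ldist d x y + ldist d y z"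
proof -
  have "int (ldist d x z) \<le> int (ldist d x y) + int (ldist d y z)"
    unfolding int_ldist sum.distrib[symmetric] by (intro sum_mono) auto
  then show ?thesis by linarith
qed

lemma finite_lrp_nodes [simp]: "finite (lrp_nodes d N)"
  by (simp add: lrp_nodes_def finite_PiE)

lemma card_lrp_nodes: "card (lrp_nodes d N) = Suc N ^ d"
  by (simp add: lrp_nodes_def card_PiE nat_add_distrib)

lemma ldist_eq_0_iff:
  assumes "x \<in> lrp_nodes d N" "y \<in> lrp_nodes d N"
  shows "ldist d x y = 0 \<longleftrightarrow> x = y"
proof
  assume "ldist d x y = 0"
  then have "(\<Sum>i<d. \<bar>x i - y i\<bar>) = 0"
    by (metis int_ldist of_nat_0)
  then have "\<forall>i<d. x i = y i"
    by (subst (asm) sum_nonneg_eq_0_iff) auto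
  then show "x = y"
    using assms by (intro PiE_ext[of _ "{..<d}" "\<lambda>_. {0..int N}"]) (auto simp: lrp_nodes_def)
qed (simp add: ldist_def l1_norm_def)

lemma coord_le_ldist: "i < d \<Longrightarrow> \<bar>x i - y i\<bar> \<le> int (ldist d x y)"
  unfolding int_ldist by (rule member_le_sum) auto

lemma ldist_le:
  assumes "\<And>i. i < d \<Longrightarrow> \<bar>x i - y i\<bar> \<le> int k"
  shows "ldist d x y \<le> d * k"
proof -
  have "int (ldist d x y) \<le> (\<Sum>i<d. int k)"
    unfolding int_ldist using assms by (intro sum_mono) auto
  then have "int (ldist d x y) \<le> int (d * k)" by simp
  then show ?thesis by (simp only: of_nat_le_iff)
qed

lemma lrp_nodes_coord:
  "x \<in> lrp_nodes d N \<Longrightarrow> i < d \<Longrightarrow> 0 \<le> x i \<and> x i \<le> int N"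
  using PiE_mem[of x "{..<d}" "\<lambda>_. {0..int N}" i] by (simp add: lrp_nodes_def)

lemma ldist_nodes_le:
  assumes "x \<in> lrp_nodes d N" "y \<in> lrp_nodes d N"
  shows "ldist d x y \<le> d * N"
proof (rule ldist_le)
  fix i assume "i < d"
  then show "\<bar>x i - y i\<bar> \<le> int N"
    using lrp_nodes_coord[OF assms(1), of i] lrp_nodes_coord[OF assms(2), of i] by linarith
qed

text \<open>All coordinates but the last lie within \<open>r\<close> of those of \<open>x\<close>,
  which leaves at most (3r)^(d-1) choices; then the distance determines the last coordinate up to
  the side of \<open>x k\<close> on which it lies.\<close>

lemma card_ldist_sphere:
  assumes "r \<ge> 1"
  shows "card {y \<in> lrp_nodes d N. ldist d x y = r} \<le> 2 * 3 ^ (d - 1) * r ^ (d - 1)"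
proof (cases "d = 0")
  case True
  then show ?thesis using assms by (simp add: ldist_def l1_norm_def)
next
  case False
  then obtain k where d: "d = Suc k" by (cases d) auto
  let ?S = "{y \<in> lrp_nodes d N. ldist d x y = r}"
  let ?T = "(\<Pi>\<^sub>E i\<in>{..<k}. {x i - int r..x i + int r}) \<times> (UNIV :: bool set)"
  let ?f = "\<lambda>y. (restrict y {..<k}, x k \<le> y k)"
  have "inj_on ?f ?S"
  proof (rule inj_onI)
    fix y z assume y: "y \<in> ?S" and z: "z \<in> ?S" and eq: "?f y = ?f z"
    have eq1: "y i = z i" if "i < k" for i
      using eq that by (metis fst_conv lessThan_iff restrict_apply')
    have "(\<Sum>i<d. \<bar>x i - y i\<bar>) = (\<Sum>i<d. \<bar>x i - z i\<bar>)"
      using y z by (simp flip: int_ldist)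
    then have "\<bar>x k - y k\<bar> = \<bar>x k - z k\<bar>"
      using eq1 by (simp add: d)
    moreover have "x k \<le> y k \<longleftrightarrow> x k \<le> z k"
      using eq by simp
    ultimately have "y k = z k" by linarith
    then have "\<And>i. i < d \<Longrightarrow> y i = z i"
      using eq1 by (metis d less_Suc_eq)
    then show "y = z"
      using y z by (intro PiE_ext[of _ "{..<d}" "\<lambda>_. {0..int N}"]) (auto simp: lrp_nodes_def)
  qed
  moreover have "?f ` ?S \<subseteq> ?T"
  proof (rule image_subsetI)
    fix y assume y: "y \<in> ?S"
    have "restrict y {..<k} \<in> (\<Pi>\<^sub>E i\<in>{..<k}. {x i - int r..x i + int r})"
    proof (rule restrict_PiE_iff[THEN iffD2], intro ballI)
      fix i assume "i \<in> {..<k}"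
      then have "\<bar>x i - y i\<bar> \<le> int (ldist d x y)"
        by (intro coord_le_ldist) (simp add: d)
      then show "y i \<in> {x i - int r..x i + int r}"
        using y by auto
    qed
    then show "?f y \<in> ?T" by simp
  qed
  ultimately have "card ?S \<le> card ?T"
    by (rule card_inj_on_le) (simp add: finite_PiE)
  also have "\<dots> = (2 * r + 1) ^ k * 2"
  proof -
    have "card (\<Pi>\<^sub>E i\<in>{..<k}. {x i - int r..x i + int r}) = (\<Prod>i<k. card {x i - int r..x i + int r})"
      by (simp add: card_PiE)
    also have "\<dots> = (\<Prod>i<k. 2 * r + 1)"
      by (intro prod.cong refl) (simp add: algebra_simps nat_add_distrib)
    finally show ?thesis by (simp add: card_cartesian_product)
  qed
  also have "\<dots> \<le> (3 * r) ^ k * 2"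
    using assms by (intro mult_right_mono power_mono) auto
  finally show ?thesis by (simp add: d power_mult_distrib mult_ac)
qed

lemma sum_nodes_ldist_le:
  fixes f :: "nat \<Rightarrow> real"
  assumes "\<And>r. f r \<ge> 0" "x \<in> lrp_nodes d N"
  shows "(\<Sum>y\<in>lrp_nodes d N - {x}. f (ldist d x y))
    \<le> 2 * 3 ^ (d - 1) * (\<Sum>r=1..d * N. real r ^ (d - 1) * f r)"
proof -
  let ?V = "lrp_nodes d N - {x}"
  have im: "ldist d x ` ?V \<subseteq> {1..d * N}"
    using assms(2) ldist_nodes_le ldist_eq_0_iff by (fastforce simp: Suc_le_eq)
  have "(\<Sum>y\<in>?V. f (ldist d x y)) = (\<Sum>r=1..d * N. \<Sum>y\<in>{y\<in>?V. ldist d x y = r}. f (ldist d x y))"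
    using im by (intro sum.group[symmetric]) auto
  also have "\<dots> \<le> (\<Sum>r=1..d * N. 2 * 3 ^ (d - 1) * (real r ^ (d - 1) * f r))"
  proof (rule sum_mono)
    fix r assume r: "r \<in> {1..d * N}"
    have "card {y\<in>?V. ldist d x y = r} \<le> card {y\<in>lrp_nodes d N. ldist d x y = r}"
      by (intro card_mono) auto
    also have "\<dots> \<le> 2 * 3 ^ (d - 1) * r ^ (d - 1)"
      using r by (intro card_ldist_sphere) auto
    finally have "real (card {y\<in>?V. ldist d x y = r}) \<le> real (2 * 3 ^ (d - 1) * r ^ (d - 1))"
      by (simp only: of_nat_le_iff)
    then have "real (card {y\<in>?V. ldist d x y = r}) * f r \<le> real (2 * 3 ^ (d - 1) * r ^ (d - 1)) * f r"
      by (rule mult_right_mono) (rule assms(1))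
    then show "(\<Sum>y\<in>{y\<in>?V. ldist d x y = r}. f (ldist d x y)) \<le> 2 * 3 ^ (d - 1) * (real r ^ (d - 1) * f r)"
      by (simp add: mult.assoc)
  qed
  finally show ?thesis by (simp add: sum_distrib_left)
qed

text \<open>Every unordered pair arises in both orders on the right; the lost factor 2 does not
  matter for the first moment bounds.\<close>

lemma sum_pairs_le:
  fixes f :: "(nat \<Rightarrow> int) set \<Rightarrow> real"
  assumes "\<And>e. f e \<ge> 0"
  shows "(\<Sum>e\<in>lrp_pairs d N. f e) \<le> (\<Sum>x\<in>lrp_nodes d N. \<Sum>y\<in>lrp_nodes d N - {x}. f {x, y})"
proof -
  let ?S = "SIGMA x:lrp_nodes d N. lrp_nodes d N - {x}"
  have "lrp_pairs d N = (\<lambda>(x, y). {x, y}) ` ?S"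
    unfolding lrp_pairs_def by (auto simp: image_iff)
  then have "(\<Sum>e\<in>lrp_pairs d N. f e) \<le> (\<Sum>z\<in>?S. f ((\<lambda>(x, y). {x, y}) z))"
    using sum_image_le[of ?S f "\<lambda>(x, y). {x, y}"] assms by (simp add: o_def)
  also have "\<dots> = (\<Sum>x\<in>lrp_nodes d N. \<Sum>y\<in>lrp_nodes d N - {x}. f {x, y})"
    by (subst sum.Sigma) (auto simp: case_prod_unfold)
  finally show ?thesis .
qed

section \<open>Edge probabilities\<close>

lemma lrp_graph_eq_rand_set:
  "lrp_graph d \<beta> s N = rand_set (lrp_pairs d N) (\<lambda>e. lrp_edge_prob \<beta> s (pair_length d e))"
  by (simp add: lrp_graph_def rand_set_def)

lemma lrp_edge_prob_bounds: "\<beta> > 0 \<Longrightarrow> 0 \<le> lrp_edge_prob \<beta> s r \<and> lrp_edge_prob \<beta> s r \<le> 1"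
  by (simp add: lrp_edge_prob_def)

text \<open>The summand 1 in \<open>1 + \<beta>\<close> pays for \<open>r = 1\<close>, where the
  edge is certain however small \<open>\<beta>\<close> is. For larger \<open>r\<close> the bound is
  1 - exp(-x) \<le> x.\<close>

lemma lrp_edge_prob_le:
  assumes "\<beta> > 0" "r \<ge> 1"
  shows "lrp_edge_prob \<beta> s (int r) \<le> (1 + \<beta>) * real r powr - s"
proof (cases "r = 1")
  case False
  have "1 - \<beta> / real r powr s \<le> exp (- \<beta> / real r powr s)"
    using exp_ge_add_one_self[of "- \<beta> / real r powr s"] by simp
  then have "lrp_edge_prob \<beta> s (int r) \<le> \<beta> * real r powr - s"
    using False by (simp add: lrp_edge_prob_def powr_minus divide_inverse)
  also have "\<dots> \<le> (1 + \<beta>) * real r powr - s"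
    by (intro mult_right_mono) auto
  finally show ?thesis .
qed (use assms in \<open>simp add: lrp_edge_prob_def\<close>)

lemma integrable_lrp_graph [simp]:
  "integrable (measure_pmf (lrp_graph d \<beta> s N)) (f :: _ \<Rightarrow> real)"
  by (simp add: lrp_graph_eq_rand_set finite_lrp_pairs)

lemma set_lrp_graph: "E \<in> set_pmf (lrp_graph d \<beta> s N) \<Longrightarrow> E \<subseteq> lrp_pairs d N"
  using set_rand_set by (fastforce simp: lrp_graph_eq_rand_set)

lemma finite_set_lrp_graph [simp]: "finite (set_pmf (lrp_graph d \<beta> s N))"
  by (simp add: lrp_graph_eq_rand_set finite_lrp_pairs)

lemma lrp_nodes_corners:
  "(\<lambda>i. if i < d then 0 else undefined) \<in> lrp_nodes d N"
  "(\<lambda>i. if i < d then int N else undefined) \<in> lrp_nodes d N"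
  "ldist d (\<lambda>i. if i < d then 0 else undefined) (\<lambda>i. if i < d then int N else undefined) = d * N"
proof -
  show "ldist d (\<lambda>i. if i < d then 0 else undefined) (\<lambda>i. if i < d then int N else undefined) = d * N"
    unfolding of_nat_eq_iff[where 'a = int, symmetric] int_ldist by simp
qed (auto simp: lrp_nodes_def PiE_def extensional_def)

definition unit_pairs :: "nat \<Rightarrow> nat \<Rightarrow> (nat \<Rightarrow> int) set set" where
  "unit_pairs d N = {e \<in> lrp_pairs d N. pair_length d e = 1}"

lemma unit_pairs_subset: 
  assumes "E \<in> set_pmf (lrp_graph d \<beta> s N)"
  shows "unit_pairs d N \<subseteq> E"
proof
  fix e assume e: "e \<in> unit_pairs d N"
  obtain \<omega> where \<omega>: "\<omega> \<in> set_pmf (Pi_pmf (lrp_pairs d N) False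
         (\<lambda>e. bernoulli_pmf (lrp_edge_prob \<beta> s (pair_length d e))))"
    "E = {e \<in> lrp_pairs d N. \<omega> e}"
    using assms by (auto simp: lrp_graph_def)
  from \<omega>(1) have "\<omega> e \<in> set_pmf (bernoulli_pmf (lrp_edge_prob \<beta> s (pair_length d e)))"
    using e by (auto simp: set_Pi_pmf finite_lrp_pairs PiE_dflt_def unit_pairs_def)
  then have "pmf (bernoulli_pmf 1) (\<omega> e) \<noteq> 0"
    using e by (simp add: unit_pairs_def lrp_edge_prob_def set_pmf_iff)
  then have "\<omega> e"
    by (cases "\<omega> e") auto
  then show "e \<in> E" using e \<omega>(2) by (simp add: unit_pairs_def)
qed

text \<open>Unit pairs must stay out of \<open>F\<close>: they are present with probability 1,
  against the exponential formula.\<close>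

lemma prob_lrp_avoid:
  assumes "\<beta> > 0" "F \<subseteq> lrp_pairs d N - unit_pairs d N"
  shows "measure_pmf.prob (lrp_graph d \<beta> s N) {E. E \<inter> F = {}} =
    exp (- (\<Sum>e\<in>F. \<beta> / real_of_int (pair_length d e) powr s))"
proof -
  have "measure_pmf.prob (lrp_graph d \<beta> s N) {E. E \<inter> F = {}} =
      (\<Prod>e\<in>F. 1 - lrp_edge_prob \<beta> s (pair_length d e))"
    unfolding lrp_graph_eq_rand_set using assms(2)
    by (intro prob_rand_set_avoid[OF finite_lrp_pairs _ lrp_edge_prob_bounds[OF assms(1)]]) auto
  also have "\<dots> = (\<Prod>e\<in>F. exp (- (\<beta> / real_of_int (pair_length d e) powr s)))"
    using assms by (intro prod.cong) (auto simp: unit_pairs_def lrp_edge_prob_def)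
  also have "\<dots> = exp (- (\<Sum>e\<in>F. \<beta> / real_of_int (pair_length d e) powr s))"
    using finite_subset[OF assms(2)] finite_lrp_pairs by (subst exp_sum[symmetric]) (auto simp: sum_negf)
  finally show ?thesis .
qed

lemma prob_lrp_contain:
  assumes "\<beta> > 0" "F \<subseteq> lrp_pairs d N"
  shows "measure_pmf.prob (lrp_graph d \<beta> s N) {E. F \<subseteq> E} =
    (\<Prod>e\<in>F. lrp_edge_prob \<beta> s (pair_length d e))"
  unfolding lrp_graph_eq_rand_set
  by (rule prob_rand_set_contain[OF finite_lrp_pairs assms(2) lrp_edge_prob_bounds[OF assms(1)]])

section \<open>Lengths of the edges of a path\<close>

lemma ldist_le_sum_steps:
  "p \<noteq> [] \<Longrightarrow> ldist d (hd p) (last p) \<le> (\<Sum>i<length p - 1. ldist d (p ! i) (p ! Suc i))"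
proof (induction p)
  case (Cons a p)
  show ?case
  proof (cases "p = []")
    case False
    then obtain k where k: "length p = Suc k" by (cases p) auto
    have "ldist d a (last p) \<le> ldist d a (hd p) + ldist d (hd p) (last p)"
      by (rule ldist_triangle)
    also have "\<dots> \<le> ldist d a (p ! 0) + (\<Sum>i<length p - 1. ldist d (p ! i) (p ! Suc i))"
      using Cons.IH False by (simp add: hd_conv_nth)
    finally show ?thesis
      using False by (simp add: k sum.lessThan_Suc_shift del: sum.lessThan_Suc)
  qed (simp add: ldist_def l1_norm_def)
qed simp

text \<open>Here simplicity of paths enters: no edge is charged twice, so the long steps of a path
  are bounded by the total length of the long edges of the graph, and the edges of a path are
  independent.\<close>

lemma inj_on_path_edges:
  assumes "distinct p"
  shows "inj_on (\<lambda>i. {p ! i, p ! Suc i}) {..<length p - 1}"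
proof (rule inj_onI)
  fix i j assume "i \<in> {..<length p - 1}" "j \<in> {..<length p - 1}" "{p ! i, p ! Suc i} = {p ! j, p ! Suc j}"
  then show "i = j"
    using assms by (auto simp: doubleton_eq_iff nth_eq_iff_index_eq)
qed

lemma is_path_edge:
  assumes "is_path V E x p y" "i < length p - 1"
  shows "{p ! i, p ! Suc i} \<in> E"
  using assms by (auto simp: is_path_def successively_conv_nth)

lemma ldist_le_long_edges:
  fixes K :: real
  assumes "is_path V E x p y" "length p \<le> Suc n" "finite E" "K \<ge> 0"
  shows "real (ldist d x y) \<le> K * real n + (\<Sum>e\<in>E \<inter> {e. real_of_int (pair_length d e) > K}. real_of_int (pair_length d e))"
proof -
  let ?I = "{..<length p - 1}" and ?l = "\<lambda>i. ldist d (p ! i) (p ! Suc i)"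
  let ?e = "\<lambda>i. {p ! i, p ! Suc i}"
  let ?L = "{e. real_of_int (pair_length d e) > K}"
  have inj: "inj_on ?e ?I"
    using assms(1) by (intro inj_on_path_edges) (simp add: is_path_def)
  have "real (ldist d x y) \<le> real (\<Sum>i\<in>?I. ?l i)"
    using ldist_le_sum_steps[of p d] assms(1) unfolding of_nat_le_iff by (auto simp: is_path_def)
  also have "\<dots> \<le> (\<Sum>i\<in>?I. K + (if real (?l i) > K then real (?l i) else 0))"
    unfolding of_nat_sum using assms(4) by (intro sum_mono) auto
  also have "\<dots> = K * (length p - 1) + (\<Sum>i\<in>?I. if real (?l i) > K then real (?l i) else 0)"
    by (simp add: sum.distrib)
  also have "(\<Sum>i\<in>?I. if real (?l i) > K then real (?l i) else 0) = (\<Sum>i\<in>{i\<in>?I. real (?l i) > K}. real (?l i))"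
    by (rule sum.inter_filter[symmetric]) simp
  also have "\<dots> = (\<Sum>e\<in>?e ` {i\<in>?I. real (?l i) > K}. real_of_int (pair_length d e))"
    by (subst sum.reindex) (auto simp: pair_length_eq intro: inj_on_subset[OF inj])
  also have "\<dots> \<le> (\<Sum>e\<in>E \<inter> ?L. real_of_int (pair_length d e))"
    using is_path_edge[OF assms(1)] assms(3,4) by (intro sum_mono2) (auto simp: pair_length_eq)
  also have "K * real (length p - 1) \<le> K * real n"
    using assms(2,4) by (intro mult_left_mono) auto
  finally show ?thesis by simp
qed

section \<open>The case \<open>s > 2d\<close>\<close>

text \<open>The mean length is a tail sum of r^(d - s) over r > K. Writing this power as r^(-(s - d
  - 1 - \<epsilon>)) times r^(-1 - \<epsilon>) bounds the first factor by its value at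
  \<open>K\<close> and leaves a convergent series. The loss of \<open>\<epsilon>\<close> replaces an
  integral comparison and is affordable since the condition on the exponent of the diameter is
  strict.\<close>

lemma expectation_long_edges_le:
  fixes d N :: nat and \<beta> s K \<epsilon> :: real
  assumes "\<beta> > 0" "d \<ge> 1" "K > 0" "\<epsilon> > 0" "s - real d - 1 - \<epsilon> \<ge> 0"
  shows "measure_pmf.expectation (lrp_graph d \<beta> s N)
      (\<lambda>E. \<Sum>e\<in>E \<inter> {e\<in>lrp_pairs d N. real_of_int (pair_length d e) > K}. real_of_int (pair_length d e))
    \<le> real (Suc N) ^ d * (2 * 3 ^ (d - 1) * (1 + \<beta>) * (\<Sum>r. real r powr (- 1 - \<epsilon>))) * K powr - (s - real d - 1 - \<epsilon>)"
    (is "?E \<le> _ * (_ * ?Z) * ?K")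
proof -
  let ?L = "{e\<in>lrp_pairs d N. real_of_int (pair_length d e) > K}"
  define f where "f r = (if real r > K then (1 + \<beta>) * real r powr (1 - s) else 0)" for r
  have f_nonneg: "f r \<ge> 0" for r using assms by (simp add: f_def)
  have "?E = (\<Sum>e\<in>?L. real_of_int (pair_length d e) * lrp_edge_prob \<beta> s (pair_length d e))"
    unfolding lrp_graph_eq_rand_set using finite_lrp_pairs lrp_edge_prob_bounds[OF assms(1)]
    by (intro expectation_sum_rand_set) auto
  also have "\<dots> = (\<Sum>e\<in>lrp_pairs d N. if real_of_int (pair_length d e) > K
      then real_of_int (pair_length d e) * lrp_edge_prob \<beta> s (pair_length d e) else 0)"
    using finite_lrp_pairs by (simp add: sum.inter_filter)
  also have "\<dots> \<le> (\<Sum>e\<in>lrp_pairs d N. f (nat (pair_length d e)))"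
  proof (intro sum_mono)
    fix e assume "e \<in> lrp_pairs d N"
    then obtain x y where e: "e = {x, y}" "x \<in> lrp_nodes d N" "y \<in> lrp_nodes d N" "x \<noteq> y"
      by (auto simp: lrp_pairs_def)
    then have r: "ldist d x y \<ge> 1" using ldist_eq_0_iff by (metis One_nat_def Suc_leI neq0_conv)
    have "real (ldist d x y) * lrp_edge_prob \<beta> s (int (ldist d x y)) \<le>
        real (ldist d x y) * ((1 + \<beta>) * real (ldist d x y) powr - s)"
      using assms r by (intro mult_left_mono lrp_edge_prob_le) auto
    also have "\<dots> = (1 + \<beta>) * real (ldist d x y) powr (1 - s)"
      using r by (simp add: powr_diff powr_minus field_simps)
    finally show "(if real_of_int (pair_length d e) > K
      then real_of_int (pair_length d e) * lrp_edge_prob \<beta> s (pair_length d e) else 0) \<le> f (nat (pair_length d e))"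
      by (simp add: e pair_length_eq f_def)
  qed
  also have "\<dots> \<le> (\<Sum>x\<in>lrp_nodes d N. \<Sum>y\<in>lrp_nodes d N - {x}. f (ldist d x y))"
    using sum_pairs_le[of "\<lambda>e. f (nat (pair_length d e))" d N] f_nonneg by (simp add: pair_length_eq)
  also have "\<dots> \<le> (\<Sum>x\<in>lrp_nodes d N. 2 * 3 ^ (d - 1) * (\<Sum>r=1..d * N. real r ^ (d - 1) * f r))"
    using f_nonneg by (intro sum_mono sum_nodes_ldist_le)
  also have "\<dots> = real (Suc N) ^ d * (2 * 3 ^ (d - 1) * (\<Sum>r=1..d * N. real r ^ (d - 1) * f r))"
    by (simp add: card_lrp_nodes)
  also have "\<dots> \<le> real (Suc N) ^ d * (2 * 3 ^ (d - 1) * ((1 + \<beta>) * ?K * ?Z))"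
  proof (intro mult_left_mono)
    have "(\<Sum>r=1..d * N. real r ^ (d - 1) * f r) \<le> (\<Sum>r=1..d * N. (1 + \<beta>) * ?K * real r powr (- 1 - \<epsilon>))"
    proof (intro sum_mono)
      fix r assume "r \<in> {1..d * N}"
      then have r: "r > 0" by auto
      show "real r ^ (d - 1) * f r \<le> (1 + \<beta>) * ?K * real r powr (- 1 - \<epsilon>)"
      proof (cases "real r > K")
        case True
        have "real r ^ (d - 1) * f r = (1 + \<beta>) * (real r powr (real d - 1) * real r powr (1 - s))"
          using r True assms(2) by (simp add: f_def powr_realpow[symmetric] of_nat_diff)
        also have "real r powr (real d - 1) * real r powr (1 - s) = real r powr - (s - real d - 1 - \<epsilon>) * real r powr (- 1 - \<epsilon>)"
          by (simp add: powr_add[symmetric])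
        also have "\<dots> \<le> ?K * real r powr (- 1 - \<epsilon>)"
          using True assms by (intro mult_right_mono powr_mono2') auto
        finally show ?thesis using assms by (simp add: mult.assoc)
      qed (use assms in \<open>simp add: f_def\<close>)
    qed
    also have "\<dots> = (1 + \<beta>) * ?K * (\<Sum>r=1..d * N. real r powr (- 1 - \<epsilon>))"
      by (simp add: sum_distrib_left)
    also have "(\<Sum>r=1..d * N. real r powr (- 1 - \<epsilon>)) \<le> ?Z"
      using assms by (intro sum_le_suminf) (auto simp: summable_real_powr_iff)
    finally show "(\<Sum>r=1..d * N. real r ^ (d - 1) * f r) \<le> (1 + \<beta>) * ?K * ?Z"
      using assms by (simp add: mult_left_mono)
  qed auto
  finally show ?thesis by (simp add: mult_ac)
qed

lemma prob_diameter_lt_le: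
  fixes d N :: nat and \<beta> s \<psi> \<epsilon> :: real
  assumes "\<beta> > 0" "d \<ge> 1" "\<epsilon> > 0" "s - real d - 1 - \<epsilon> \<ge> 0" "N \<ge> 1"
  defines "A \<equiv> 2 * 3 ^ (d - 1) * (1 + \<beta>) * (\<Sum>r. real r powr (- 1 - \<epsilon>))"
  shows "measure_pmf.prob (lrp_graph d \<beta> s N) {E. lrp_diameter d N E < ereal (real N powr \<psi>)} \<le>
    (real (Suc N) ^ d * A * (real N powr (1 - \<psi>) / 2) powr - (s - real d - 1 - \<epsilon>)) / (real N / 2)"
proof -
  \<comment> \<open>With this threshold, fewer than \<open>N powr \<psi>\<close> steps of length at
    most \<open>K\<close> cover at most \<open>N / 2\<close>, whereas opposite corners are
    \<open>d * N \<ge> N\<close> apart. Long edges must supply the other half.\<close>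
  define K where "K = real N powr (1 - \<psi>) / 2"
  let ?L = "{e\<in>lrp_pairs d N. real_of_int (pair_length d e) > K}"
  let ?T = "\<lambda>E. \<Sum>e\<in>E \<inter> ?L. real_of_int (pair_length d e)"
  have K: "K > 0" using assms(5) by (simp add: K_def)
  have KN: "K * real N powr \<psi> = real N / 2"
    using assms(5) by (simp add: K_def powr_add[symmetric])
  have "?T E \<ge> real N / 2" if E: "E \<in> set_pmf (lrp_graph d \<beta> s N)" "lrp_diameter d N E < ereal (real N powr \<psi>)" for E
  proof -
    obtain n where n: "graph_diameter (lrp_nodes d N) E = enat n" "real n < real N powr \<psi>"
      using E(2) by (cases "graph_diameter (lrp_nodes d N) E") auto
    let ?a = "\<lambda>i. if i < d then 0 else undefined" and ?b = "\<lambda>i. if i < d then int N else undefined"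
    have "graph_dist (lrp_nodes d N) E ?a ?b \<le> enat n"
      using graph_dist_le_diameter[OF lrp_nodes_corners(1,2), of d N E] n by simp
    then obtain p where p: "is_path (lrp_nodes d N) E ?a p ?b" "length p \<le> Suc n"
      unfolding graph_dist_le_iff by auto
    have "finite E" by (rule finite_subset[OF set_lrp_graph[OF E(1)] finite_lrp_pairs])
    then have "real (d * N) \<le> K * real n + (\<Sum>e\<in>E \<inter> {e. real_of_int (pair_length d e) > K}. real_of_int (pair_length d e))"
      using ldist_le_long_edges[OF p, of K d] K by (simp add: lrp_nodes_corners)
    also have "E \<inter> {e. real_of_int (pair_length d e) > K} = E \<inter> ?L"
      using set_lrp_graph[OF E(1)] by auto
    also have "K * real n \<le> K * real N powr \<psi>"
      using n K by (intro mult_left_mono) auto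
    also note KN
    finally have "real (d * N) \<le> real N / 2 + ?T E" by simp
    moreover have "real (1 * N) \<le> real (d * N)"
      using assms(2) by (intro of_nat_mono mult_right_mono) auto
    ultimately show ?thesis by simp
  qed
  then have "measure_pmf.prob (lrp_graph d \<beta> s N) {E. lrp_diameter d N E < ereal (real N powr \<psi>)}
    \<le> measure_pmf.prob (lrp_graph d \<beta> s N) {E. ?T E \<ge> real N / 2}"
    by (intro prob_pmf_mono) auto
  also have "\<dots> \<le> measure_pmf.expectation (lrp_graph d \<beta> s N) ?T / (real N / 2)"
    using assms(1-5) K by (intro prob_pmf_markov) (auto intro!: sum_nonneg)
  also have "\<dots> \<le> (real (Suc N) ^ d * A * K powr - (s - real d - 1 - \<epsilon>)) / (real N / 2)"
    unfolding A_def using assms(1-5) K by (intro divide_right_mono expectation_long_edges_le) auto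
  finally show ?thesis by (simp add: K_def)
qed

theorem diameter_supercritical:
  fixes d :: nat and \<beta> s \<psi> :: real
  assumes "\<beta> > 0" "d \<ge> 1" "s > 2 * real d" "\<psi> < (s - 2 * real d) / (s - real d - 1)"
  shows "(\<lambda>N. measure_pmf.prob (lrp_graph d \<beta> s N)
           {E. lrp_diameter d N E \<ge> ereal (real N powr \<psi>)}) \<longlonglongrightarrow> 1"
proof -
  \<comment> \<open>Negative exponents are replaced by 0, which is still below the threshold because
    that is positive for s > 2d. The claim for the larger exponent implies the one for
    \<open>\<psi>\<close>.\<close>
  define \<phi> where "\<phi> = max \<psi> 0"
  have sd: "s - real d - 1 > 0" using assms by linarith
  then have "(s - 2 * real d) / (s - real d - 1) > 0" using assms by simp
  then have \<phi>: "\<phi> \<ge> 0" "\<psi> \<le> \<phi>" "\<phi> < (s - 2 * real d) / (s - real d - 1)"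
    using assms by (auto simp: \<phi>_def)
  then have gap: "\<phi> * (s - real d - 1) < s - 2 * real d"
    using sd by (simp add: pos_less_divide_eq)
  have "(s - 2 * real d) / (s - real d - 1) \<le> 1"
    using sd assms by (simp add: divide_le_eq)
  then have \<phi>1: "\<phi> < 1" using \<phi> by simp
  \<comment> \<open>Up to \<open>\<epsilon>\<close>, Markov's inequality gives N^d N^(-(1 -
    \<phi>)(s - d - 1)) / N, which is N^(-g).\<close>
  define g where "g = (1 - \<phi>) * (s - real d - 1) - (real d - 1)"
  have g: "g > 0" using gap by (simp add: g_def algebra_simps)
  \<comment> \<open>half of the gap is spent on the convergence of \<open>\<Sum>r. r powr (- 1 - \<epsilon>)\<close>\<close>
  define \<epsilon> where "\<epsilon> = g / (2 * (1 - \<phi>))"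
  have \<epsilon>: "\<epsilon> > 0" using g \<phi>1 by (simp add: \<epsilon>_def)
  define c where "c = s - real d - 1 - \<epsilon>"
  have c1: "(1 - \<phi>) * c = real d - 1 + g / 2"
    using \<phi>1 by (simp add: c_def \<epsilon>_def g_def field_simps)
  then have "(1 - \<phi>) * c > 0" using g assms by simp
  then have c: "c > 0" using \<phi>1 by (simp add: zero_less_mult_iff)
  define A where "A = 2 * 3 ^ (d - 1) * (1 + \<beta>) * (\<Sum>r. real r powr (- 1 - \<epsilon>))"
  have A: "A \<ge> 0" using assms \<epsilon> by (auto simp: A_def summable_real_powr_iff intro!: mult_nonneg_nonneg suminf_nonneg)
  show ?thesis
  proof (rule prob_tendsto_1I)
    show "(\<lambda>N. (2 ^ d * A * 2 powr c * 2) * real N powr - (g / 2)) \<longlonglongrightarrow> 0"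
      using g by (intro tendsto_mult_right_zero tendsto_neg_powr filterlim_real_sequentially) simp
    show "\<forall>\<^sub>F N in sequentially. measure_pmf.prob (lrp_graph d \<beta> s N) (- {E. lrp_diameter d N E \<ge> ereal (real N powr \<psi>)})
       \<le> (2 ^ d * A * 2 powr c * 2) * real N powr - (g / 2)"
      using eventually_ge_at_top[of 1]
    proof eventually_elim
      case (elim N)
      have "real N powr \<psi> \<le> real N powr \<phi>" using \<phi> elim by (intro powr_mono) auto
      then have "measure_pmf.prob (lrp_graph d \<beta> s N) (- {E. lrp_diameter d N E \<ge> ereal (real N powr \<psi>)})
        \<le> measure_pmf.prob (lrp_graph d \<beta> s N) {E. lrp_diameter d N E < ereal (real N powr \<phi>)}"
        by (intro measure_pmf.finite_measure_mono) (auto simp: not_le intro: less_le_trans)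
      also have "\<dots> \<le> (real (Suc N) ^ d * A * (real N powr (1 - \<phi>) / 2) powr - c) / (real N / 2)"
        unfolding A_def c_def using assms \<epsilon> c elim by (intro prob_diameter_lt_le) (auto simp: c_def)
      also have "(real N powr (1 - \<phi>) / 2) powr - c = real N powr - (real d - 1 + g / 2) * 2 powr c"
      proof -
        have "(real N powr (1 - \<phi>)) powr - c = real N powr - (real d - 1 + g / 2)"
          using c1 by (simp add: powr_powr)
        moreover have "(real N powr (1 - \<phi>) / 2) powr - c = (real N powr (1 - \<phi>)) powr - c / 2 powr - c"
          by (rule powr_divide)
        moreover have "a / 2 powr - c = a * 2 powr c" for a :: real
          by (simp add: powr_minus divide_inverse)
        ultimately show ?thesis by metis
      qed
      also have "(real (Suc N) ^ d * A * (real N powr - (real d - 1 + g / 2) * 2 powr c)) / (real N / 2)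
        \<le> ((2 * real N) ^ d * A * (real N powr - (real d - 1 + g / 2) * 2 powr c)) / (real N / 2)"
        using A elim by (intro divide_right_mono mult_right_mono power_mono) auto
      also have "\<dots> = (2 ^ d * A * 2 powr c * 2) * (real N powr real d * real N powr - (real d - 1 + g / 2) * real N powr - 1)"
        using elim by (simp add: power_mult_distrib powr_realpow powr_minus field_simps)
      also have "real N powr real d * real N powr - (real d - 1 + g / 2) * real N powr - 1 = real N powr - (g / 2)"
      proof -
        have "real d + - (real d - 1 + g / 2) + - 1 = - (g / 2)" by simp
        then show ?thesis by (simp only: powr_add[symmetric])
      qed
      finally show ?case by simp
    qed
  qed
qed

section \<open>Counting self-avoiding paths\<close>

text \<open>Self-avoiding sequences of \<open>j\<close> steps in the complete graph. The edges are
  demanded separately through \<open>path_edges\<close>, so that sums over sequences have a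
  deterministic index set.\<close>

definition dpaths :: "'a set \<Rightarrow> nat \<Rightarrow> 'a \<Rightarrow> 'a list set" where
  "dpaths V j x = {p. length p = Suc j \<and> hd p = x \<and> distinct p \<and> set p \<subseteq> V}"

definition path_edges :: "'a list \<Rightarrow> 'a set set" where
  "path_edges p = (\<lambda>i. {p ! i, p ! Suc i}) ` {..<length p - 1}"

lemma finite_dpaths: "finite V \<Longrightarrow> finite (dpaths V j x)"
  by (rule finite_subset[OF _ finite_lists_length_eq[of V "Suc j"]]) (auto simp: dpaths_def)

text \<open>Peel off the first step. Forgetting that the rest avoids the first vertex only enlarges
  the sum, as the weights are nonnegative, and the first step alone contributes at most
  \<open>\<Delta>\<close>.\<close>

lemma sum_dpaths_le:
  fixes q :: "'a \<Rightarrow> 'a \<Rightarrow> real"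
  assumes "finite V" "\<And>u v. q u v \<ge> 0" "\<And>u. u \<in> V \<Longrightarrow> (\<Sum>v\<in>V - {u}. q u v) \<le> \<Delta>"
  shows "x \<in> V \<Longrightarrow> (\<Sum>p\<in>dpaths V j x. \<Prod>i<j. q (p ! i) (p ! Suc i)) \<le> \<Delta> ^ j"
proof (induction j arbitrary: x)
  case 0
  have "dpaths V 0 x \<subseteq> {[x]}"
    by (auto simp: dpaths_def length_Suc_conv)
  then have "card (dpaths V 0 x) \<le> 1"
    using card_mono[of "{[x]}"] by force
  then show ?case by simp
next
  case (Suc j)
  let ?f = "\<lambda>j p. \<Prod>i<j. q (p ! i) (p ! Suc i)"
  let ?S = "SIGMA y:V - {x}. dpaths V j y"
  have fin: "finite ?S" by (intro finite_SigmaI finite_Diff finite_dpaths assms(1))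
  have \<Delta>: "\<Delta> \<ge> 0"
    using assms(2,3)[of x] Suc.prems by (meson order_trans sum_nonneg assms(2))
  have "dpaths V (Suc j) x \<subseteq> (\<lambda>(y, p). x # p) ` ?S"
  proof
    fix p assume "p \<in> dpaths V (Suc j) x"
    then obtain p' where p: "p = x # p'" "length p' = Suc j" "distinct p'" "x \<notin> set p'" "set p' \<subseteq> V"
      by (auto simp: dpaths_def length_Suc_conv)
    then have "hd p' \<in> V - {x}" by (cases p') auto
    then show "p \<in> (\<lambda>(y, p). x # p) ` ?S"
      using p by (intro image_eqI[of _ _ "(hd p', p')"]) (auto simp: dpaths_def)
  qed
  then have "(\<Sum>p\<in>dpaths V (Suc j) x. ?f (Suc j) p) \<le> (\<Sum>p\<in>(\<lambda>(y, p). x # p) ` ?S. ?f (Suc j) p)"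
    using fin by (intro sum_mono2 prod_nonneg ballI assms(2)) auto
  also have "\<dots> \<le> (\<Sum>z\<in>?S. ?f (Suc j) (x # snd z))"
    using sum_image_le[of ?S "?f (Suc j)" "\<lambda>(y, p). x # p"] fin assms(2)
    by (simp add: o_def case_prod_unfold prod_nonneg)
  also have "\<dots> = (\<Sum>z\<in>?S. q x (fst z) * ?f j (snd z))"
  proof (intro sum.cong refl)
    fix z assume "z \<in> ?S"
    then have "snd z ! 0 = fst z" by (cases "snd z") (auto simp: dpaths_def)
    then show "?f (Suc j) (x # snd z) = q x (fst z) * ?f j (snd z)"
      by (simp add: prod.lessThan_Suc_shift del: prod.lessThan_Suc)
  qed
  also have "\<dots> = (\<Sum>y\<in>V - {x}. q x y * (\<Sum>p\<in>dpaths V j y. ?f j p))"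
    unfolding sum_distrib_left by (subst sum.Sigma) (simp_all add: assms(1) finite_dpaths case_prod_unfold)
  also have "\<dots> \<le> (\<Sum>y\<in>V - {x}. q x y * \<Delta> ^ j)"
    using Suc.IH assms(2) by (intro sum_mono mult_left_mono) auto
  also have "\<dots> = (\<Sum>y\<in>V - {x}. q x y) * \<Delta> ^ j"
    by (simp add: sum_distrib_right)
  also have "\<dots> \<le> \<Delta> * \<Delta> ^ j"
    using assms(3) Suc.prems \<Delta> by (intro mult_right_mono) auto
  finally show ?case by simp
qed

text \<open>Every vertex is the last vertex of some path of at most \<open>n\<close> edges from
  \<open>x\<close>, so there are at least as many such paths as vertices.\<close>

lemma card_le_dpaths:
  assumes "finite V" "x \<in> V" "graph_diameter V E \<le> enat n"
  shows "card V \<le> (\<Sum>j\<le>n. card {p \<in> dpaths V j x. path_edges p \<subseteq> E})"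
proof -
  let ?P = "\<lambda>j. {p \<in> dpaths V j x. path_edges p \<subseteq> E}"
  have "V \<subseteq> last ` (\<Union>j\<le>n. ?P j)"
  proof
    fix y assume "y \<in> V"
    then have "graph_dist V E x y \<le> enat n"
      using assms graph_diameter_le_iff by metis
    then obtain p where p: "is_path V E x p y" "length p \<le> Suc n"
      unfolding graph_dist_le_iff by auto
    have "length p = Suc (length p - 1)" using p(1) by (auto simp: is_path_def)
    moreover have "path_edges p \<subseteq> E"
      using is_path_edge[OF p(1)] by (auto simp: path_edges_def)
    ultimately have "p \<in> ?P (length p - 1)" "length p - 1 \<le> n"
      using p by (auto simp: dpaths_def is_path_def)
    then show "y \<in> last ` (\<Union>j\<le>n. ?P j)"
      using p(1) by (intro image_eqI[of _ _ p]) (auto simp: is_path_def)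
  qed
  moreover have fin: "finite (\<Union>j\<le>n. ?P j)"
    using finite_dpaths[OF assms(1)] by auto
  ultimately have "card V \<le> card (\<Union>j\<le>n. ?P j)"
    by (meson card_image_le card_mono finite_imageI order_trans)
  also have "\<dots> \<le> (\<Sum>j\<le>n. card (?P j))"
    by (rule card_UN_le) simp
  finally show ?thesis .
qed

lemma prob_lrp_path_edges:
  assumes "\<beta> > 0" "p \<in> dpaths (lrp_nodes d N) j x"
  shows "measure_pmf.prob (lrp_graph d \<beta> s N) {E. path_edges p \<subseteq> E} =
    (\<Prod>i<j. lrp_edge_prob \<beta> s (int (ldist d (p ! i) (p ! Suc i))))"
proof -
  have p: "length p = Suc j" "distinct p" "set p \<subseteq> lrp_nodes d N"
    using assms(2) by (auto simp: dpaths_def)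
  have "path_edges p \<subseteq> lrp_pairs d N"
  proof
    fix e assume "e \<in> path_edges p"
    then obtain i where i: "i < j" "e = {p ! i, p ! Suc i}" using p by (auto simp: path_edges_def)
    then have "p ! i \<in> set p" "p ! Suc i \<in> set p" "p ! i \<noteq> p ! Suc i"
      using p nth_eq_iff_index_eq[of p i "Suc i"] by auto
    then show "e \<in> lrp_pairs d N" using i p unfolding lrp_pairs_def by blast
  qed
  then have "measure_pmf.prob (lrp_graph d \<beta> s N) {E. path_edges p \<subseteq> E} =
      (\<Prod>e\<in>path_edges p. lrp_edge_prob \<beta> s (pair_length d e))"
    by (rule prob_lrp_contain[OF assms(1)])
  also have "\<dots> = (\<Prod>i<j. lrp_edge_prob \<beta> s (int (ldist d (p ! i) (p ! Suc i))))"
    unfolding path_edges_def using inj_on_path_edges[OF p(2)] p(1)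
    by (subst prod.reindex) (auto simp: pair_length_eq)
  finally show ?thesis .
qed

lemma prob_diameter_le:
  assumes "\<beta> > 0" "\<Delta> \<ge> 2"
    "\<And>x. x \<in> lrp_nodes d N \<Longrightarrow>
      (\<Sum>y\<in>lrp_nodes d N - {x}. lrp_edge_prob \<beta> s (int (ldist d x y))) \<le> \<Delta>"
  shows "measure_pmf.prob (lrp_graph d \<beta> s N) {E. graph_diameter (lrp_nodes d N) E \<le> enat n}
    \<le> \<Delta> ^ Suc n / real (Suc N) ^ d"
proof -
  let ?V = "lrp_nodes d N" and ?M = "lrp_graph d \<beta> s N"
  obtain x where x: "x \<in> ?V" using lrp_nodes_corners(1) by blast
  let ?f = "\<lambda>E. \<Sum>j\<le>n. \<Sum>p\<in>dpaths ?V j x. indicator {E. path_edges p \<subseteq> E} E :: real"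
  have f: "?f E = real (\<Sum>j\<le>n. card {p \<in> dpaths ?V j x. path_edges p \<subseteq> E})" for E
  proof -
    have "(\<Sum>p\<in>dpaths ?V j x. indicator {E. path_edges p \<subseteq> E} E :: real) =
        real (card {p \<in> dpaths ?V j x. path_edges p \<subseteq> E})" for j
      using finite_dpaths[OF finite_lrp_nodes] by (simp add: indicator_def sum.If_cases Int_def)
    then show ?thesis by simp
  qed
  have "measure_pmf.prob ?M {E. graph_diameter ?V E \<le> enat n} \<le> measure_pmf.prob ?M {E. ?f E \<ge> real (card ?V)}"
    unfolding f of_nat_le_iff using card_le_dpaths[OF finite_lrp_nodes x]
    by (intro prob_pmf_mono) simp
  also have "\<dots> \<le> measure_pmf.expectation ?M ?f / real (card ?V)"
    by (intro prob_pmf_markov) (auto intro!: sum_nonneg simp: card_lrp_nodes)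
  also have "measure_pmf.expectation ?M ?f =
      (\<Sum>j\<le>n. \<Sum>p\<in>dpaths ?V j x. measure_pmf.prob ?M {E. path_edges p \<subseteq> E})"
    by (simp add: Bochner_Integration.integral_sum)
  also have "\<dots> \<le> (\<Sum>j\<le>n. \<Delta> ^ j)"
  proof (intro sum_mono)
    fix j
    have "(\<Sum>p\<in>dpaths ?V j x. measure_pmf.prob ?M {E. path_edges p \<subseteq> E}) =
      (\<Sum>p\<in>dpaths ?V j x. \<Prod>i<j. lrp_edge_prob \<beta> s (int (ldist d (p ! i) (p ! Suc i))))"
      using prob_lrp_path_edges[OF assms(1)] by (intro sum.cong) auto
    also have "\<dots> \<le> \<Delta> ^ j"
      using lrp_edge_prob_bounds[OF assms(1)] assms(3) x
      by (intro sum_dpaths_le[where q = "\<lambda>u v. lrp_edge_prob \<beta> s (int (ldist d u v))"]) auto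
    finally show "(\<Sum>p\<in>dpaths ?V j x. measure_pmf.prob ?M {E. path_edges p \<subseteq> E}) \<le> \<Delta> ^ j" .
  qed
  \<comment> \<open>Since \<open>\<Delta> \<ge> 2\<close>, the next power absorbs the whole
    geometric sum.\<close>
  also have "\<dots> \<le> \<Delta> ^ Suc n"
  proof (induction n)
    case (Suc n)
    have "(\<Sum>j\<le>Suc n. \<Delta> ^ j) \<le> 2 * \<Delta> ^ Suc n" using Suc by simp
    also have "\<dots> \<le> \<Delta> * \<Delta> ^ Suc n" using assms(2) by (intro mult_right_mono) auto
    finally show ?case by simp
  qed (use assms(2) in simp)
  finally show ?thesis by (simp add: card_lrp_nodes divide_right_mono)
qed

lemma prob_diameter_less:
  assumes "\<beta> > 0" "\<Delta> \<ge> 2"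
    "\<And>x. x \<in> lrp_nodes d N \<Longrightarrow>
      (\<Sum>y\<in>lrp_nodes d N - {x}. lrp_edge_prob \<beta> s (int (ldist d x y))) \<le> \<Delta>"
    "L \<ge> 0"
  shows "measure_pmf.prob (lrp_graph d \<beta> s N) (- {E. ereal L \<le> lrp_diameter d N E})
    \<le> \<Delta> powr (L + 1) / real (Suc N) ^ d"
proof -
  define n where "n = nat \<lfloor>L\<rfloor>"
  have n: "real n \<le> L" using assms(4) by (simp add: n_def)
  have "measure_pmf.prob (lrp_graph d \<beta> s N) (- {E. ereal L \<le> lrp_diameter d N E})
    \<le> measure_pmf.prob (lrp_graph d \<beta> s N) {E. graph_diameter (lrp_nodes d N) E \<le> enat n}"
  proof (intro measure_pmf.finite_measure_mono)
    show "- {E. ereal L \<le> lrp_diameter d N E} \<subseteq> {E. graph_diameter (lrp_nodes d N) E \<le> enat n}"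
    proof safe
      fix E assume "\<not> ereal L \<le> lrp_diameter d N E"
      then obtain m where m: "graph_diameter (lrp_nodes d N) E = enat m" "real m < L"
        by (cases "graph_diameter (lrp_nodes d N) E") auto
      then have "m \<le> n" by (simp add: n_def le_nat_floor)
      then show "graph_diameter (lrp_nodes d N) E \<le> enat n" by (simp add: m)
    qed
  qed simp
  also have "\<dots> \<le> \<Delta> ^ Suc n / real (Suc N) ^ d"
    using assms(1-3) by (rule prob_diameter_le)
  also have "\<dots> = \<Delta> powr (real n + 1) / real (Suc N) ^ d"
    using assms(2) powr_realpow[of \<Delta> "Suc n"] by (simp add: add.commute)
  also have "\<dots> \<le> \<Delta> powr (L + 1) / real (Suc N) ^ d"
    using n assms(2) by (intro divide_right_mono powr_mono) auto
  finally show ?thesis .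
qed

section \<open>Mean degrees and the resulting lower bounds for s > d and s = d\<close>

lemma degree_le:
  assumes "\<beta> > 0" "d \<ge> 1" "x \<in> lrp_nodes d N"
  shows "(\<Sum>y\<in>lrp_nodes d N - {x}. lrp_edge_prob \<beta> s (int (ldist d x y)))
    \<le> 2 * 3 ^ (d - 1) * (1 + \<beta>) * (\<Sum>r=1..d * N. real r powr (real d - 1 - s))"
proof -
  have "(\<Sum>y\<in>lrp_nodes d N - {x}. lrp_edge_prob \<beta> s (int (ldist d x y)))
      \<le> (\<Sum>y\<in>lrp_nodes d N - {x}. (1 + \<beta>) * real (ldist d x y) powr - s)"
  proof (intro sum_mono lrp_edge_prob_le assms)
    fix y assume "y \<in> lrp_nodes d N - {x}"
    then have "ldist d x y \<noteq> 0" using ldist_eq_0_iff assms(3) by auto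
    then show "1 \<le> ldist d x y" by simp
  qed
  also have "\<dots> \<le> 2 * 3 ^ (d - 1) * (\<Sum>r=1..d * N. real r ^ (d - 1) * ((1 + \<beta>) * real r powr - s))"
    using assms by (intro sum_nodes_ldist_le) auto
  also have "(\<Sum>r=1..d * N. real r ^ (d - 1) * ((1 + \<beta>) * real r powr - s)) =
      (1 + \<beta>) * (\<Sum>r=1..d * N. real r powr (real d - 1 - s))"
    unfolding sum_distrib_left
  proof (intro sum.cong refl)
    fix r assume "r \<in> {1..d * N}"
    then have "real r ^ (d - 1) * real r powr - s = real r powr (real d - 1 - s)"
      using assms(2) by (simp add: powr_realpow[symmetric] of_nat_diff powr_add[symmetric])
    then show "real r ^ (d - 1) * ((1 + \<beta>) * real r powr - s) = (1 + \<beta>) * real r powr (real d - 1 - s)"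
      by simp
  qed
  finally show ?thesis by (simp add: mult_ac)
qed

theorem diameter_ge_ln:
  assumes "\<beta> > 0" "d \<ge> 1" "s > real d"
  shows "\<exists>C>0. (\<lambda>N. measure_pmf.prob (lrp_graph d \<beta> s N)
    {E. ereal (C * ln (real N)) \<le> lrp_diameter d N E}) \<longlonglongrightarrow> 1"
proof -
  define \<Delta> where "\<Delta> = max 2 (2 * 3 ^ (d - 1) * (1 + \<beta>) * (\<Sum>r. real r powr (real d - 1 - s)))"
  have \<Delta>: "\<Delta> \<ge> 2" by (simp add: \<Delta>_def)
  \<comment> \<open>This \<open>C\<close> turns \<Delta>^(C ln N) into N^(1/2), which loses against
    the number of nodes, at least \<open>N\<close>.\<close>
  define C where "C = 1 / (2 * ln \<Delta>)"
  have C: "C > 0" "C * ln \<Delta> = 1 / 2" using \<Delta> by (auto simp: C_def)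
  have deg: "(\<Sum>y\<in>lrp_nodes d N - {x}. lrp_edge_prob \<beta> s (int (ldist d x y))) \<le> \<Delta>"
    if "x \<in> lrp_nodes d N" for x N
  proof -
    have "(\<Sum>r=1..d * N. real r powr (real d - 1 - s)) \<le> (\<Sum>r. real r powr (real d - 1 - s))"
      using assms by (intro sum_le_suminf) (auto simp: summable_real_powr_iff)
    then have "2 * 3 ^ (d - 1) * (1 + \<beta>) * (\<Sum>r=1..d * N. real r powr (real d - 1 - s)) \<le> \<Delta>"
      unfolding \<Delta>_def using assms by (intro max.coboundedI2 mult_left_mono) auto
    then show ?thesis using degree_le[OF assms(1,2) that, of s] by linarith
  qed
  have "(\<lambda>N. measure_pmf.prob (lrp_graph d \<beta> s N)
    {E. ereal (C * ln (real N)) \<le> lrp_diameter d N E}) \<longlonglongrightarrow> 1"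
  proof (rule prob_tendsto_1I)
    show "(\<lambda>N. \<Delta> * real N powr - (1 / 2)) \<longlonglongrightarrow> 0"
      by (intro tendsto_mult_right_zero tendsto_neg_powr filterlim_real_sequentially) simp
    show "\<forall>\<^sub>F N in sequentially. measure_pmf.prob (lrp_graph d \<beta> s N)
      (- {E. ereal (C * ln (real N)) \<le> lrp_diameter d N E}) \<le> \<Delta> * real N powr - (1 / 2)"
      using eventually_ge_at_top[of 1]
    proof eventually_elim
      case (elim N)
      have "measure_pmf.prob (lrp_graph d \<beta> s N) (- {E. ereal (C * ln (real N)) \<le> lrp_diameter d N E})
        \<le> \<Delta> powr (C * ln (real N) + 1) / real (Suc N) ^ d"
        using \<Delta> deg C elim by (intro prob_diameter_less[OF assms(1)]) auto
      also have "\<dots> \<le> \<Delta> powr (C * ln (real N) + 1) / real N"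
      proof (rule divide_left_mono)
        have "real N \<le> real (Suc N) ^ 1" by simp
        also have "\<dots> \<le> real (Suc N) ^ d" using assms(2) by (intro power_increasing) auto
        finally show "real N \<le> real (Suc N) ^ d" .
      qed (use elim in auto)
      also have "\<Delta> powr (C * ln (real N) + 1) = \<Delta> * real N powr (1 / 2)"
      proof -
        have "\<Delta> powr (C * ln (real N)) = exp (C * ln \<Delta> * ln (real N))"
          using \<Delta> by (simp add: powr_def mult_ac)
        also have "\<dots> = real N powr (1 / 2)"
          using elim unfolding C(2) by (simp add: powr_def)
        finally show ?thesis using \<Delta> by (simp add: powr_add mult.commute)
      qed
      also have "\<Delta> * real N powr (1 / 2) / real N = \<Delta> * real N powr - (1 / 2)"
        using powr_diff[of "real N" "1 / 2" 1] elim by simp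
      finally show ?case .
    qed
  qed
  then show ?thesis using C(1) by blast
qed

lemma harmonic_le_ln: "n \<ge> 1 \<Longrightarrow> (\<Sum>r=1..n. 1 / real r) \<le> 1 + ln (real n)"
proof -
  assume "n \<ge> 1"
  then obtain m where m: "n = Suc m" by (cases n) auto
  have "harm (Suc m) - ln (Suc m) \<le> harm (Suc 0) - ln (real (Suc 0))"
    using decseqD[OF decseq_harm_diff_ln, of 0 m] by simp
  then show ?thesis by (simp add: m harm_def inverse_eq_divide)
qed

theorem diameter_ge_ln_over_ln_ln:
  assumes "\<beta> > 0" "d \<ge> 1" "s = real d"
  shows "\<exists>C>0. (\<lambda>N. measure_pmf.prob (lrp_graph d \<beta> s N)
    {E. ereal (C * ln (real N) / ln (ln (real N))) \<le> lrp_diameter d N E}) \<longlonglongrightarrow> 1"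
proof -
  define A where "A = 2 * 3 ^ (d - 1) * (1 + \<beta>)"
  have A: "A > 2"
  proof -
    have "2 * 1 < 2 * 3 ^ (d - 1) * (1 + \<beta>)"
      using assms(1) by (intro mult_le_less_imp_less) auto
    then show ?thesis by (simp add: A_def)
  qed
  define \<Delta> where "\<Delta> N = A * (1 + ln (real (d * N)))" for N
  have \<Delta>: "\<Delta> N \<ge> 2" if "N \<ge> 1" for N
  proof -
    have "real 1 \<le> real (d * N)"
      using that assms(2) unfolding of_nat_le_iff by simp
    then have "ln (real (d * N)) \<ge> 0" by simp
    then have "2 * 1 \<le> A * (1 + ln (real (d * N)))" using A by (intro mult_mono) auto
    then show ?thesis by (simp add: \<Delta>_def)
  qed
  have deg: "(\<Sum>y\<in>lrp_nodes d N - {x}. lrp_edge_prob \<beta> s (int (ldist d x y))) \<le> \<Delta> N"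
    if "x \<in> lrp_nodes d N" "N \<ge> 1" for x N
  proof -
    have "(\<Sum>r=1..d * N. real r powr (real d - 1 - s)) = (\<Sum>r=1..d * N. 1 / real r)"
      using assms(3) by (intro sum.cong refl) (simp add: powr_minus_divide)
    also have "\<dots> \<le> 1 + ln (real (d * N))"
      using that assms(2) by (intro harmonic_le_ln) simp
    finally have "A * (\<Sum>r=1..d * N. real r powr (real d - 1 - s)) \<le> \<Delta> N"
      unfolding \<Delta>_def using A by (intro mult_left_mono) auto
    then show ?thesis
      using degree_le[OF assms(1,2) that(1), of s] by (simp add: A_def)
  qed
  \<comment> \<open>As \<open>\<Delta> N\<close> is of order ln N, the power is N^(1/4 + o(1)). The
    constant 1/4 only has to stay below 1.\<close>
  define b where "b N = \<Delta> N powr (1 / 4 * ln (real N) / ln (ln (real N)) + 1) / real N" for N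
  have "b \<longlonglongrightarrow> 0"
    unfolding b_def \<Delta>_def of_nat_mult using A assms(2) by real_asymp
  moreover have "\<forall>\<^sub>F N in sequentially. measure_pmf.prob (lrp_graph d \<beta> s N)
      (- {E. ereal (1 / 4 * ln (real N) / ln (ln (real N))) \<le> lrp_diameter d N E}) \<le> b N"
  proof -
    have "\<forall>\<^sub>F N in sequentially. ln (ln (real N)) > 0" by real_asymp
    then show ?thesis
      using eventually_ge_at_top[of 1]
    proof eventually_elim
      case (elim N)
      have "measure_pmf.prob (lrp_graph d \<beta> s N)
          (- {E. ereal (1 / 4 * ln (real N) / ln (ln (real N))) \<le> lrp_diameter d N E})
        \<le> \<Delta> N powr (1 / 4 * ln (real N) / ln (ln (real N)) + 1) / real (Suc N) ^ d"
        using \<Delta> deg elim by (intro prob_diameter_less[OF assms(1)]) auto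
      also have "\<dots> \<le> b N" unfolding b_def
      proof (rule divide_left_mono)
        have "real N \<le> real (Suc N) ^ 1" by simp
        also have "\<dots> \<le> real (Suc N) ^ d" using assms(2) by (intro power_increasing) auto
        finally show "real N \<le> real (Suc N) ^ d" .
      qed (use elim in auto)
      finally show ?case .
    qed
  qed
  ultimately have "(\<lambda>N. measure_pmf.prob (lrp_graph d \<beta> s N)
    {E. ereal (1 / 4 * ln (real N) / ln (ln (real N))) \<le> lrp_diameter d N E}) \<longlonglongrightarrow> 1"
    by (intro prob_tendsto_1I)
  then show ?thesis by (intro exI[of _ "1 / 4"]) simp
qed

section \<open>Boxes\<close>

definition lbox :: "nat \<Rightarrow> (nat \<Rightarrow> int) \<Rightarrow> nat \<Rightarrow> (nat \<Rightarrow> int) set" where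
  "lbox d c k = (\<Pi>\<^sub>E i\<in>{..<d}. {c i..<c i + int k})"

definition cross :: "'a set \<Rightarrow> 'a set \<Rightarrow> 'a set set" where
  "cross A B = (\<lambda>(u, v). {u, v}) ` (A \<times> B)"

lemma lrp_nodes_eq_lbox: "lrp_nodes d N = lbox d (\<lambda>_. 0) (Suc N)"
proof -
  have "{0..int N} = {0..<0 + int (Suc N)}" by auto
  then show ?thesis by (simp only: lrp_nodes_def lbox_def)
qed

lemma lbox_coord: "x \<in> lbox d c k \<Longrightarrow> i < d \<Longrightarrow> c i \<le> x i \<and> x i < c i + int k"
  using PiE_mem[of x "{..<d}" "\<lambda>i. {c i..<c i + int k}" i] by (simp add: lbox_def)

lemma lbox_extensional: "x \<in> lbox d c k \<Longrightarrow> x \<in> extensional {..<d}"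
  by (simp add: lbox_def PiE_def)

lemma lboxI:
  "x \<in> extensional {..<d} \<Longrightarrow> (\<And>i. i < d \<Longrightarrow> c i \<le> x i \<and> x i < c i + int k) \<Longrightarrow> x \<in> lbox d c k"
  by (auto simp: lbox_def PiE_def)

lemma finite_lbox [simp]: "finite (lbox d c k)"
  by (simp add: lbox_def finite_PiE)

lemma card_lbox: "card (lbox d c k) = k ^ d"
  by (simp add: lbox_def card_PiE)

lemma lbox_subsetI:
  assumes "\<And>i. i < d \<Longrightarrow> c i \<le> a i \<and> a i + int k \<le> c i + int K"
  shows "lbox d a k \<subseteq> lbox d c K"
proof
  fix x assume x: "x \<in> lbox d a k"
  show "x \<in> lbox d c K"
  proof (rule lboxI)
    fix i assume i: "i < d"
    show "c i \<le> x i \<and> x i < c i + int K"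
      using lbox_coord[OF x i] assms[OF i] by linarith
  qed (rule lbox_extensional[OF x])
qed

text \<open>The corner is \<open>x\<close> itself, pushed back in the coordinates where the small
  box would stick out. The corner belongs to its own box, so corners may be counted as nodes in
  union bounds.\<close>

lemma subbox_exists:
  assumes "x \<in> lbox d c K" "1 \<le> k" "k \<le> K"
  shows "\<exists>a. a \<in> lbox d a k \<and> x \<in> lbox d a k \<and> lbox d a k \<subseteq> lbox d c K"
proof -
  define a where "a = restrict (\<lambda>i. min (x i) (c i + int K - int k)) {..<d}"
  have "a \<in> lbox d a k"
    using assms by (intro lboxI) (auto simp: a_def)
  moreover have "x \<in> lbox d a k"
  proof (rule lboxI)
    fix i assume i: "i < d"
    show "a i \<le> x i \<and> x i < a i + int k"
      using lbox_coord[OF assms(1) i] assms i by (auto simp: a_def)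
  qed (rule lbox_extensional[OF assms(1)])
  moreover have "lbox d a k \<subseteq> lbox d c K"
  proof (rule lbox_subsetI)
    fix i assume i: "i < d"
    show "c i \<le> a i \<and> a i + int k \<le> c i + int K"
      using lbox_coord[OF assms(1) i] assms i by (auto simp: a_def)
  qed
  ultimately show ?thesis by blast
qed

lemma ldist_box_le:
  assumes "x \<in> lbox d c k" "y \<in> lbox d c k"
  shows "ldist d x y \<le> d * k"
proof (rule ldist_le)
  fix i assume i: "i < d"
  show "\<bar>x i - y i\<bar> \<le> int k"
    using lbox_coord[OF assms(1) i] lbox_coord[OF assms(2) i] by linarith
qed

lemma lbox_ext:
  assumes "x \<in> lbox d c k" "y \<in> lbox d c' k'" "\<And>i. i < d \<Longrightarrow> x i = y i"
  shows "x = y"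
  using extensionalityI[OF lbox_extensional[OF assms(1)] lbox_extensional[OF assms(2)]] assms(3) by simp

lemma ldist_fun_upd:
  assumes "i < d"
  shows "int (ldist d (x(i := t)) y) = int (ldist d x y) - \<bar>x i - y i\<bar> + \<bar>t - y i\<bar>"
proof -
  have "int (ldist d x y) = \<bar>x i - y i\<bar> + (\<Sum>j\<in>{..<d} - {i}. \<bar>x j - y j\<bar>)"
    unfolding int_ldist using assms by (subst sum.remove[of _ i]) auto
  moreover have "int (ldist d (x(i := t)) y) = \<bar>t - y i\<bar> + (\<Sum>j\<in>{..<d} - {i}. \<bar>x j - y j\<bar>)"
    unfolding int_ldist using assms by (subst sum.remove[of _ i]) auto
  ultimately show ?thesis by linarith
qed

lemma ldist_self [simp]: "ldist d x x = 0"
  by (simp add: ldist_def l1_norm_def)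

lemma unit_pairsI:
  assumes "x \<in> lrp_nodes d N" "y \<in> lrp_nodes d N" "ldist d x y = 1"
  shows "{x, y} \<in> unit_pairs d N"
proof -
  have "x \<noteq> y" using assms(3) by auto
  then have "{x, y} \<in> lrp_pairs d N" using assms by (auto simp: lrp_pairs_def)
  then show ?thesis using assms(3) by (simp add: unit_pairs_def pair_length_eq)
qed

text \<open>Moving one coordinate of \<open>x\<close> by one unit towards \<open>y\<close> uses a
  unit edge and never leaves the box, as the new coordinate lies between the old one and that of
  \<open>y\<close>.\<close>

lemma graph_dist_box_le_ldist:
  assumes "lbox d c k \<subseteq> lrp_nodes d N" "unit_pairs d N \<subseteq> E"
  shows "x \<in> lbox d c k \<Longrightarrow> y \<in> lbox d c k \<Longrightarrow> graph_dist (lbox d c k) E x y \<le> enat (ldist d x y)"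
proof (induction "ldist d x y" arbitrary: x)
  case 0
  then have "x = y" using ldist_eq_0_iff[of x d N y] assms(1) by auto
  then show ?case using 0 by (simp add: graph_dist_refl zero_enat_def)
next
  case (Suc n)
  have "\<exists>i<d. x i \<noteq> y i"
    using Suc.hyps(2) lbox_ext[OF Suc.prems] by fastforce
  then obtain i where i: "i < d" "x i \<noteq> y i" by blast
  define t where "t = x i + sgn (y i - x i)"
  define x' where "x' = x(i := t)"
  have t: "min (x i) (y i) \<le> t" "t \<le> max (x i) (y i)" "\<bar>t - y i\<bar> = \<bar>x i - y i\<bar> - 1" "\<bar>t - x i\<bar> = 1"
    using i(2) by (auto simp: t_def sgn_if)
  have x': "x' \<in> lbox d c k"
  proof (rule lboxI)
    show "x' \<in> extensional {..<d}"
      using lbox_extensional[OF Suc.prems(1)] i(1) by (auto simp: x'_def extensional_def)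
    fix j assume j: "j < d"
    show "c j \<le> x' j \<and> x' j < c j + int k"
      using lbox_coord[OF Suc.prems(1) j] lbox_coord[OF Suc.prems(2) j] t by (auto simp: x'_def)
  qed
  have "int (ldist d x' y) = int (ldist d x y) - 1"
    unfolding x'_def using ldist_fun_upd[OF i(1), of x t y] t by simp
  then have n: "n = ldist d x' y" using Suc.hyps(2) by linarith
  have "int (ldist d x' x) = 1"
    unfolding x'_def using ldist_fun_upd[OF i(1), of x t x] t by simp
  then have "{x, x'} \<in> E"
    using unit_pairsI[of x d N x'] x' Suc.prems assms by (auto simp: ldist_commute)
  then have "graph_dist (lbox d c k) E x x' \<le> 1"
    by (rule graph_dist_edge[OF Suc.prems(1) x'])
  moreover have "graph_dist (lbox d c k) E x' y \<le> enat n"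
    using Suc.hyps(1)[OF n x' Suc.prems(2)] n by simp
  ultimately have "graph_dist (lbox d c k) E x x' + graph_dist (lbox d c k) E x' y \<le> 1 + enat n"
    by (rule add_mono)
  then have "graph_dist (lbox d c k) E x y \<le> 1 + enat n"
    by (rule order_trans[OF graph_dist_triangle])
  then show ?case using Suc.hyps(2) by (simp add: one_enat_def)
qed

lemma inj_on_cross: "A \<inter> B = {} \<Longrightarrow> inj_on (\<lambda>(u, v). {u, v}) (A \<times> B)"
  by (auto simp: inj_on_def doubleton_eq_iff)

lemma cross_subset_pairs:
  "A \<subseteq> lrp_nodes d N \<Longrightarrow> B \<subseteq> lrp_nodes d N \<Longrightarrow> A \<inter> B = {} \<Longrightarrow> cross A B \<subseteq> lrp_pairs d N"
  by (force simp: cross_def lrp_pairs_def)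

lemma sum_cross:
  assumes "A \<inter> B = {}"
  shows "(\<Sum>e\<in>cross A B. f e) = (\<Sum>u\<in>A. \<Sum>v\<in>B. f {u, v})"
  unfolding cross_def sum.reindex[OF inj_on_cross[OF assms]] sum.cartesian_product
  by (simp add: case_prod_unfold o_def)

text \<open>If some pair between the sets has length 1, it is an edge almost surely and the
  probability is 0. Otherwise the exponential formula applies, and each pair contributes at least
  \<beta> / R^s to the exponent.\<close>

lemma prob_no_edge_between:
  assumes "\<beta> > 0" "s > 0" "A \<subseteq> lrp_nodes d N" "B \<subseteq> lrp_nodes d N" "A \<inter> B = {}"
    and R: "\<And>u v. u \<in> A \<Longrightarrow> v \<in> B \<Longrightarrow> ldist d u v \<le> R"
  shows "measure_pmf.prob (lrp_graph d \<beta> s N) {E. E \<inter> cross A B = {}}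
    \<le> exp (- \<beta> * real (card A) * real (card B) / real R powr s)"
proof (cases "cross A B \<inter> unit_pairs d N = {}")
  case True
  then have "measure_pmf.prob (lrp_graph d \<beta> s N) {E. E \<inter> cross A B = {}} =
      exp (- (\<Sum>e\<in>cross A B. \<beta> / real_of_int (pair_length d e) powr s))"
    using cross_subset_pairs[OF assms(3-5)] by (intro prob_lrp_avoid[OF assms(1)]) auto
  also have "(\<Sum>e\<in>cross A B. \<beta> / real_of_int (pair_length d e) powr s) =
      (\<Sum>u\<in>A. \<Sum>v\<in>B. \<beta> / real (ldist d u v) powr s)"
    by (simp add: sum_cross[OF assms(5)] pair_length_eq)
  also have "exp (- \<dots>) \<le> exp (- (\<Sum>u\<in>A. \<Sum>v\<in>B. \<beta> / real R powr s))"
  proof -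
    have "\<beta> / real R powr s \<le> \<beta> / real (ldist d u v) powr s" if "u \<in> A" "v \<in> B" for u v
    proof (rule divide_left_mono)
      have "u \<noteq> v" using that assms(5) by auto
      then have "ldist d u v \<noteq> 0" using that assms(3,4) ldist_eq_0_iff by (metis subsetD)
      then have pos: "0 < real (ldist d u v)" "real (ldist d u v) \<le> real R" using R[OF that] by auto
      then show "real (ldist d u v) powr s \<le> real R powr s" "0 < real R powr s * real (ldist d u v) powr s"
        using assms(2) by (auto intro!: powr_mono2)
    qed (use assms(1) in auto)
    then have "(\<Sum>u\<in>A. \<Sum>v\<in>B. \<beta> / real R powr s) \<le> (\<Sum>u\<in>A. \<Sum>v\<in>B. \<beta> / real (ldist d u v) powr s)"
      by (intro sum_mono)
    then show ?thesis by (simp only: exp_le_cancel_iff neg_le_iff_le)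
  qed
  finally show ?thesis by (simp add: mult_ac)
next
  case False
  then have "{E. E \<inter> cross A B = {}} \<inter> set_pmf (lrp_graph d \<beta> s N) = {}"
    using unit_pairs_subset by blast
  then have "measure_pmf.prob (lrp_graph d \<beta> s N) {E. E \<inter> cross A B = {}} = 0"
    by (metis measure_Int_set_pmf measure_empty)
  then show ?thesis by simp
qed

section \<open>The case \<open>d < s < 2d\<close>\<close>

text \<open>A single event for all pairs of boxes of one side, so that the recursion over scales is
  deterministic outside it. Requiring the corners to be nodes leaves (N + 1)^(2d) pairs for the
  union bound.\<close>

definition bad_boxes :: "nat \<Rightarrow> nat \<Rightarrow> nat \<Rightarrow> nat \<Rightarrow> (nat \<Rightarrow> int) set set set" where
  "bad_boxes d N k R = {E. \<exists>a\<in>lrp_nodes d N. \<exists>b\<in>lrp_nodes d N.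
     lbox d a k \<subseteq> lrp_nodes d N \<and> lbox d b k \<subseteq> lrp_nodes d N \<and> lbox d a k \<inter> lbox d b k = {} \<and>
     (\<forall>u\<in>lbox d a k. \<forall>v\<in>lbox d b k. ldist d u v \<le> R) \<and> E \<inter> cross (lbox d a k) (lbox d b k) = {}}"

lemma prob_bad_boxes:
  assumes "\<beta> > 0" "s > 0"
  shows "measure_pmf.prob (lrp_graph d \<beta> s N) (bad_boxes d N k R) \<le>
    real (Suc N) ^ (2 * d) * exp (- \<beta> * real k ^ (2 * d) / real R powr s)"
proof -
  let ?V = "lrp_nodes d N" and ?P = "measure_pmf.prob (lrp_graph d \<beta> s N)"
  let ?I = "{z\<in>?V \<times> ?V. lbox d (fst z) k \<subseteq> ?V \<and> lbox d (snd z) k \<subseteq> ?V \<and> lbox d (fst z) k \<inter> lbox d (snd z) k = {} \<and>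
     (\<forall>u\<in>lbox d (fst z) k. \<forall>v\<in>lbox d (snd z) k. ldist d u v \<le> R)}"
  let ?A = "\<lambda>z. {E. E \<inter> cross (lbox d (fst z) k) (lbox d (snd z) k) = {}}"
  let ?x = "exp (- \<beta> * real k ^ (2 * d) / real R powr s)"
  have fin: "finite ?I" by (rule finite_subset[of _ "?V \<times> ?V"]) auto
  have "bad_boxes d N k R \<subseteq> (\<Union>z\<in>?I. ?A z)"
  proof
    fix E assume "E \<in> bad_boxes d N k R"
    then obtain a b where "(a, b) \<in> ?I" "E \<in> ?A (a, b)"
      by (auto simp: bad_boxes_def)
    then show "E \<in> (\<Union>z\<in>?I. ?A z)" by blast
  qed
  then have "?P (bad_boxes d N k R) \<le> ?P (\<Union>z\<in>?I. ?A z)"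
    by (intro measure_pmf.finite_measure_mono) auto
  also have "\<dots> \<le> (\<Sum>z\<in>?I. ?P (?A z))"
    using fin by (intro measure_pmf.finite_measure_subadditive_finite) auto
  also have "\<dots> \<le> (\<Sum>z\<in>?I. ?x)"
  proof (intro sum_mono)
    fix z assume z: "z \<in> ?I"
    have "?P (?A z) \<le> exp (- \<beta> * real (card (lbox d (fst z) k)) * real (card (lbox d (snd z) k)) / real R powr s)"
      using z by (intro prob_no_edge_between[OF assms]) auto
    then show "?P (?A z) \<le> ?x" by (simp add: card_lbox power_add mult_2 mult.assoc)
  qed
  also have "\<dots> = real (card ?I) * ?x" by simp
  also have "\<dots> \<le> real (card (?V \<times> ?V)) * ?x"
    by (intro mult_right_mono of_nat_mono card_mono) auto
  also have "real (card (?V \<times> ?V)) = real (Suc N) ^ (2 * d)"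
    by (simp add: card_cartesian_product card_lrp_nodes power_add mult_2)
  finally show ?thesis .
qed

text \<open>Small boxes around \<open>x\<close> and \<open>y\<close> inside the large one either
  share a node or are disjoint and joined by an edge; in both cases crossing over costs at most one
  step, hence \<open>2 * m + 1\<close>.\<close>

lemma graph_dist_box_step:
  assumes E: "E \<notin> bad_boxes d N k (d * K)" and k: "1 \<le> k" "k \<le> K"
    and m: "\<And>c x y. lbox d c k \<subseteq> lrp_nodes d N \<Longrightarrow> x \<in> lbox d c k \<Longrightarrow> y \<in> lbox d c k \<Longrightarrow>
      graph_dist (lrp_nodes d N) E x y \<le> enat m"
    and c: "lbox d c K \<subseteq> lrp_nodes d N" "x \<in> lbox d c K" "y \<in> lbox d c K"
  shows "graph_dist (lrp_nodes d N) E x y \<le> enat (2 * m + 1)"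
proof -
  let ?d = "graph_dist (lrp_nodes d N) E"
  obtain a where a: "a \<in> lbox d a k" "x \<in> lbox d a k" "lbox d a k \<subseteq> lbox d c K"
    using subbox_exists[OF c(2) k] by blast
  obtain b where b: "b \<in> lbox d b k" "y \<in> lbox d b k" "lbox d b k \<subseteq> lbox d c K"
    using subbox_exists[OF c(3) k] by blast
  have "\<exists>u v. u \<in> lbox d a k \<and> v \<in> lbox d b k \<and> ?d u v \<le> 1"
  proof (cases "lbox d a k \<inter> lbox d b k = {}")
    case True
    have "\<forall>u\<in>lbox d a k. \<forall>v\<in>lbox d b k. ldist d u v \<le> d * K"
      using a b ldist_box_le by (meson subsetD)
    then have "E \<inter> cross (lbox d a k) (lbox d b k) \<noteq> {}"
      using E True a b c(1) unfolding bad_boxes_def by blast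
    then obtain u v where uv: "u \<in> lbox d a k" "v \<in> lbox d b k" "{u, v} \<in> E"
      by (auto simp: cross_def)
    moreover have "u \<in> lrp_nodes d N" "v \<in> lrp_nodes d N"
      using uv a(3) b(3) c(1) by auto
    ultimately show ?thesis using graph_dist_edge by metis
  next
    case False
    then obtain u where "u \<in> lbox d a k" "u \<in> lbox d b k" by blast
    moreover have "u \<in> lrp_nodes d N" using \<open>u \<in> lbox d a k\<close> a(3) c(1) by auto
    ultimately show ?thesis using graph_dist_refl by (metis zero_le)
  qed
  then obtain u v where uv: "u \<in> lbox d a k" "v \<in> lbox d b k" "?d u v \<le> 1" by blast
  have "?d x y \<le> ?d x u + ?d u y" by (rule graph_dist_triangle)
  also have "\<dots> \<le> ?d x u + (?d u v + ?d v y)"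
    by (intro add_left_mono graph_dist_triangle)
  also have "\<dots> \<le> enat m + (1 + enat m)"
    using uv a b c by (intro add_mono m) auto
  also have "\<dots> = enat (2 * m + 1)" by (simp add: one_enat_def)
  finally show ?thesis .
qed

text \<open>Under the recursion m \<rightarrow> 2m + 1 the quantity m + 1 doubles, which explains
  the closed form. It starts at the smallest scale with the lattice distance
  \<open>d * k J\<close>.\<close>

lemma diameter_le_box_scales:
  assumes k: "k 0 = Suc N" "\<And>j. k j \<ge> 1" "\<And>j. k (Suc j) \<le> k j"
    and E: "unit_pairs d N \<subseteq> E" "\<And>j. j < J \<Longrightarrow> E \<notin> bad_boxes d N (k (Suc j)) (d * k j)"
  shows "graph_diameter (lrp_nodes d N) E \<le> enat (2 ^ J * (d * k J + 1) - 1)"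
proof -
  have "graph_dist (lrp_nodes d N) E x y \<le> enat (2 ^ (J - i) * (d * k J + 1) - 1)"
    if "i \<le> J" "lbox d c (k i) \<subseteq> lrp_nodes d N" "x \<in> lbox d c (k i)" "y \<in> lbox d c (k i)" for i c x y
    using that
  proof (induction i arbitrary: c x y rule: inc_induct)
    case base
    have "graph_dist (lrp_nodes d N) E x y \<le> graph_dist (lbox d c (k J)) E x y"
      using base by (intro graph_dist_mono) auto
    also have "\<dots> \<le> enat (ldist d x y)"
      using base E(1) by (intro graph_dist_box_le_ldist)
    also have "\<dots> \<le> enat (d * k J)"
      using ldist_box_le base by simp
    finally show ?case by simp
  next
    case (step i)
    let ?m = "2 ^ (J - Suc i) * (d * k J + 1) - 1"
    have "graph_dist (lrp_nodes d N) E x y \<le> enat (2 * ?m + 1)"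
      using step k(2,3) E(2)[of i] by (intro graph_dist_box_step[where k = "k (Suc i)" and K = "k i"]) auto
    also have "2 * ?m + 1 = 2 * (2 ^ (J - Suc i) * (d * k J + 1)) - 1"
    proof -
      have "0 < (2::nat) ^ (J - Suc i) * (d * k J + 1)"
        by (intro mult_pos_pos) simp_all
      then show ?thesis by linarith
    qed
    also have "2 * (2 ^ (J - Suc i) * (d * k J + 1)) = 2 ^ Suc (J - Suc i) * (d * k J + 1)"
      by simp
    also have "Suc (J - Suc i) = J - i" using step by simp
    finally show ?case .
  qed
  from this[of 0 "\<lambda>_. 0"] show ?thesis
    using k(1) by (simp add: graph_diameter_le_iff lrp_nodes_eq_lbox)
qed

lemma prob_diameter_gt_box_scales:
  assumes "\<beta> > 0" "s > 0" and k: "k 0 = Suc N" "\<And>j. k j \<ge> 1" "\<And>j. k (Suc j) \<le> k j"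
    and X: "\<And>j. j < J \<Longrightarrow> X \<le> real (k (Suc j)) ^ (2 * d) / real (d * k j) powr s"
    and L: "real (2 ^ J * (d * k J + 1)) \<le> L"
  shows "measure_pmf.prob (lrp_graph d \<beta> s N) (- {E. lrp_diameter d N E \<le> ereal L})
    \<le> real J * (real (Suc N) ^ (2 * d) * exp (- \<beta> * X))"
proof -
  let ?P = "measure_pmf.prob (lrp_graph d \<beta> s N)"
  have "?P (- {E. lrp_diameter d N E \<le> ereal L}) \<le> ?P (\<Union>j<J. bad_boxes d N (k (Suc j)) (d * k j))"
  proof (rule prob_pmf_mono, rule ccontr)
    fix E assume E: "E \<in> set_pmf (lrp_graph d \<beta> s N)" "E \<in> - {E. lrp_diameter d N E \<le> ereal L}"
      "E \<notin> (\<Union>j<J. bad_boxes d N (k (Suc j)) (d * k j))"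
    have "graph_diameter (lrp_nodes d N) E \<le> enat (2 ^ J * (d * k J + 1) - 1)"
      using E(3) by (intro diameter_le_box_scales k unit_pairs_subset[OF E(1)]) auto
    then have "lrp_diameter d N E \<le> ereal_of_enat (enat (2 ^ J * (d * k J + 1) - 1))"
      by (simp only: ereal_of_enat_le_iff)
    also have "\<dots> \<le> ereal (real (2 ^ J * (d * k J + 1)))"
      by (simp only: ereal_of_enat_simps ereal_less_eq of_nat_le_iff diff_le_self)
    also have "\<dots> \<le> ereal L" using L by (simp only: ereal_less_eq)
    finally show False using E(2) by simp
  qed
  also have "\<dots> \<le> (\<Sum>j<J. ?P (bad_boxes d N (k (Suc j)) (d * k j)))"
    by (intro measure_pmf.finite_measure_subadditive_finite) auto
  also have "\<dots> \<le> (\<Sum>j<J. real (Suc N) ^ (2 * d) * exp (- \<beta> * X))"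
  proof (intro sum_mono)
    fix j assume "j \<in> {..<J}"
    then have "\<beta> * X \<le> \<beta> * (real (k (Suc j)) ^ (2 * d) / real (d * k j) powr s)"
      using X assms(1) by (intro mult_left_mono) auto
    then have "real (Suc N) ^ (2 * d) * exp (- \<beta> * real (k (Suc j)) ^ (2 * d) / real (d * k j) powr s)
      \<le> real (Suc N) ^ (2 * d) * exp (- \<beta> * X)"
      by (intro mult_left_mono) auto
    then show "?P (bad_boxes d N (k (Suc j)) (d * k j)) \<le> real (Suc N) ^ (2 * d) * exp (- \<beta> * X)"
      using prob_bad_boxes[OF assms(1,2), of d N "k (Suc j)" "d * k j"] by linarith
  qed
  finally show ?thesis by simp
qed

text \<open>Picks the last usable scale. The lower bound keeps failures improbable up to that scale;
  the upper bound on the next power shows that the boxes there are already small.\<close>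

lemma exists_last_power_ge:
  fixes \<gamma> q :: real
  assumes "0 < \<gamma>" "\<gamma> < 1" "0 < q" "q < 1"
  shows "\<exists>J. \<gamma> ^ J \<ge> q \<and> \<gamma> ^ Suc J < q"
proof -
  define n where "n = (LEAST n. \<gamma> ^ n < q)"
  have "\<exists>n. \<gamma> ^ n < q" by (rule real_arch_pow_inv[OF assms(3,2)])
  then have n: "\<gamma> ^ n < q" unfolding n_def by (rule LeastI_ex)
  then have "n \<noteq> 0" using assms by (cases n) simp_all
  then obtain J where J: "n = Suc J" by (cases n) auto
  have "\<not> \<gamma> ^ J < q" using not_less_Least[of J "\<lambda>n. \<gamma> ^ n < q"] J n_def by simp
  then show ?thesis using n J by (auto simp: not_less)
qed

text \<open>The sides are r_j = exp (L \<gamma>^j), so that r_(j+1) = r_j^\<gamma> and r_(j+1)^(2d)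
  / r_j^s = r_j^\<theta>. The scales stop while this is still at least L^2, because exp(- const L^2)
  beats the exp(2 d L) pairs of boxes. Then there are about ln L / ln (1/\<gamma>) scales, giving
  the doubling factor L^a, and the last side is at most 2 L^b.\<close>

lemma prob_diameter_gt_polylog:
  fixes d N :: nat and \<beta> s \<gamma> L :: real
  assumes "\<beta> > 0" "s > 0" "d \<ge> 1" "0 < \<gamma>" "\<gamma> < 1" "2 * real d * \<gamma> - s > 0"
    and L: "L = ln (real (Suc N))" "2 / (2 * real d * \<gamma> - s) * ln L < L" "(2 * real d * \<gamma> - s) / 2 \<le> ln L" "1 < L"
  defines "\<theta> \<equiv> 2 * real d * \<gamma> - s" and "a \<equiv> ln 2 / ln (1 / \<gamma>)"
  defines "b \<equiv> 2 / (\<theta> * \<gamma>)"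
  shows "measure_pmf.prob (lrp_graph d \<beta> s N)
      (- {E. lrp_diameter d N E \<le> ereal (L powr a * (2 * real d * L powr b + 1))})
    \<le> L powr a * (real (Suc N) powr (2 * real d) * exp (- \<beta> / (2 * real d) powr s * L\<^sup>2))"
proof -
  have \<theta>: "\<theta> > 0" using assms(6) by (simp add: \<theta>_def)
  \<comment> \<open>Chosen so that \<gamma>^j \<ge> q is the same as r_j^\<theta> \<ge> L^2.\<close>
  define q where "q = 2 / \<theta> * ln L / L"
  have lnL: "ln L > 0" using L(4) by simp
  have q: "0 < q" "q < 1" "1 / L \<le> q"
  proof -
    have "2 / \<theta> * ln L < L" "\<theta> / 2 \<le> ln L" using L(2,3) by (simp_all add: \<theta>_def)
    then have "1 \<le> 2 / \<theta> * ln L" using \<theta> by (simp add: field_simps)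
    then show "1 / L \<le> q" unfolding q_def using L(4) by (intro divide_right_mono) auto
    show "q < 1" unfolding q_def using L(4) \<open>2 / \<theta> * ln L < L\<close> by (subst pos_divide_less_eq) auto
    show "0 < q" unfolding q_def using \<theta> lnL L(4) by simp
  qed
  obtain J where J: "\<gamma> ^ J \<ge> q" "\<gamma> ^ Suc J < q"
    using exists_last_power_ge[OF assms(4,5) q(1,2)] by blast
  have M: "real (Suc N) = exp L" using L(1) by simp
  define r where "r j = exp (L * \<gamma> ^ j)" for j
  have r1: "r j \<ge> 1" for j using L(4) assms(4) by (simp add: r_def)
  have r_anti: "r i \<ge> r j" if "i \<le> j" for i j
    using that L(4) assms(4,5) by (simp add: r_def power_decreasing)
  have r_Suc: "r (Suc j) = r j powr \<gamma>" for j
    by (simp add: r_def powr_def mult_ac)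
  \<comment> \<open>Rounding up costs at most a factor 2 because \<open>r j \<ge> 1\<close>; this is
    the 2 in \<open>(2 * real d) powr s\<close>.\<close>
  define k where "k j = nat \<lceil>r j\<rceil>" for j
  have k_bounds: "r j \<le> real (k j)" "real (k j) \<le> 2 * r j" for j
    using r1[of j] by (auto simp: k_def) linarith+
  have k: "k 0 = Suc N" "\<And>j. k j \<ge> 1" "\<And>j. k (Suc j) \<le> k j"
  proof -
    have "r 0 = real (Suc N)" using M by (simp add: r_def)
    then show "k 0 = Suc N" by (simp only: k_def ceiling_of_nat nat_int)
    show "k j \<ge> 1" for j using k_bounds(1)[of j] r1[of j] by linarith
    show "k (Suc j) \<le> k j" for j unfolding k_def by (intro nat_mono ceiling_mono r_anti) simp
  qed
  have rJ: "r J powr \<theta> \<ge> L\<^sup>2"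
  proof -
    have "L\<^sup>2 = exp (2 * ln L)" using L(4) by (simp add: exp_double)
    also have "2 * ln L = \<theta> * (L * q)" using \<theta> L(4) by (simp add: q_def)
    also have "\<dots> \<le> \<theta> * (L * \<gamma> ^ J)" using J(1) \<theta> L(4) by (intro mult_left_mono) auto
    finally show ?thesis by (simp add: r_def powr_def)
  qed
  have X: "L\<^sup>2 / (2 * real d) powr s \<le> real (k (Suc j)) ^ (2 * d) / real (d * k j) powr s" if "j < J" for j
  proof -
    have "L\<^sup>2 \<le> r j powr \<theta>"
      using rJ r_anti[of j J] that \<theta> r1[of J] powr_mono2[of \<theta> "r J" "r j"] by linarith
    also have "r j powr \<theta> = r (Suc j) powr (2 * real d) / r j powr s"
      by (simp add: r_Suc powr_powr powr_diff \<theta>_def mult_ac)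
    finally have "L\<^sup>2 / (2 * real d) powr s \<le> r (Suc j) powr (2 * real d) / r j powr s / (2 * real d) powr s"
      by (rule divide_right_mono) simp
    also have "\<dots> = r (Suc j) ^ (2 * d) / (real d * (2 * r j)) powr s"
      using r1[of "Suc j"] powr_realpow[of "r (Suc j)" "2 * d"] by (simp add: powr_mult mult_ac)
    also have "\<dots> \<le> real (k (Suc j)) ^ (2 * d) / real (d * k j) powr s"
    proof (intro frac_le power_mono k_bounds powr_mono2)
      show "real (d * k j) \<le> real d * (2 * r j)"
        using k_bounds(2)[of j] by (simp add: mult_left_mono)
      have "0 < d * k j" using assms(3) k(2)[of j] by simp
      then show "0 < real (d * k j) powr s" by (simp del: of_nat_mult)
      show "0 \<le> r (Suc j)" using r1[of "Suc j"] by simp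
    qed (use assms in auto)
    finally show ?thesis .
  qed
  have two_J: "2 ^ J \<le> L powr a"
  proof -
    have "1 / L \<le> \<gamma> ^ J" using q(3) J(1) by simp
    then have "ln (1 / L) \<le> ln (\<gamma> ^ J)" using L(4) assms(4) by (subst ln_le_cancel_iff) auto
    then have "real J * ln (1 / \<gamma>) \<le> ln L"
      using L(4) assms(4) by (simp add: ln_div ln_realpow)
    moreover have g: "ln (1 / \<gamma>) > 0" using assms(4,5) by simp
    ultimately have "real J \<le> ln L / ln (1 / \<gamma>)" by (simp add: pos_le_divide_eq)
    then have "real J * ln 2 \<le> ln L / ln (1 / \<gamma>) * ln 2" by (intro mult_right_mono) auto
    also have "\<dots> = a * ln L" by (simp add: a_def)
    finally have "exp (real J * ln 2) \<le> L powr a" using L(4) by (simp add: powr_def)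
    moreover have "exp (real J * ln 2) = 2 ^ J" by (simp add: exp_of_nat_mult)
    ultimately show ?thesis by simp
  qed
  have kJ: "real (k J) \<le> 2 * L powr b"
  proof -
    have "\<gamma> ^ J < q / \<gamma>" using J(2) assms(4) by (simp add: field_simps)
    then have "L * \<gamma> ^ J \<le> L * (q / \<gamma>)" using L(4) by (intro mult_left_mono) auto
    also have "\<dots> = b * ln L" using L(4) by (simp add: q_def b_def)
    finally have "r J \<le> L powr b" using L(4) by (simp add: r_def powr_def)
    then show ?thesis using k_bounds(2)[of J] by simp
  qed
  have "real (2 ^ J * (d * k J + 1)) = 2 ^ J * (real d * real (k J) + 1)"
    by (simp add: algebra_simps)
  also have "\<dots> \<le> L powr a * (real d * (2 * L powr b) + 1)"
    using two_J kJ by (intro mult_mono add_right_mono mult_left_mono) auto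
  finally have D: "real (2 ^ J * (d * k J + 1)) \<le> L powr a * (2 * real d * L powr b + 1)"
    by (simp add: mult_ac)
  have "measure_pmf.prob (lrp_graph d \<beta> s N)
      (- {E. lrp_diameter d N E \<le> ereal (L powr a * (2 * real d * L powr b + 1))})
    \<le> real J * (real (Suc N) ^ (2 * d) * exp (- \<beta> * (L\<^sup>2 / (2 * real d) powr s)))"
    by (rule prob_diameter_gt_box_scales[OF assms(1,2) k X D])
  also have "\<dots> \<le> L powr a * (real (Suc N) ^ (2 * d) * exp (- \<beta> * (L\<^sup>2 / (2 * real d) powr s)))"
  proof (rule mult_right_mono)
    have "real J \<le> 2 ^ J" using of_nat_less_two_power[of J, where 'a = real] by simp
    then show "real J \<le> L powr a" using two_J by (rule order_trans)
  qed auto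
  also have "real (Suc N) ^ (2 * d) = real (Suc N) powr (2 * real d)"
    using powr_realpow[of "real (Suc N)" "2 * d"] by simp
  finally show ?thesis by simp
qed

theorem diameter_le_polylog:
  fixes d :: nat and \<beta> s :: real
  assumes "\<beta> > 0" "d \<ge> 1" "0 < s" "s < 2 * real d"
  shows "\<exists>\<delta>>1. (\<lambda>N. measure_pmf.prob (lrp_graph d \<beta> s N)
    {E. lrp_diameter d N E \<le> ereal (ln (real N) powr \<delta>)}) \<longlonglongrightarrow> 1"
proof -
  \<comment> \<open>The midpoint between s / (2d), below which the boxes would no longer be joined,
    and 1. It gives \<theta> = (2d - s) / 2.\<close>
  define \<gamma> where "\<gamma> = (s / (2 * real d) + 1) / 2"
  define \<theta> where "\<theta> = 2 * real d * \<gamma> - s"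
  have \<gamma>: "0 < \<gamma>" "\<gamma> < 1" using assms by (auto simp: \<gamma>_def field_simps)
  have "\<theta> = (2 * real d - s) / 2" using assms by (simp add: \<theta>_def \<gamma>_def field_simps)
  then have \<theta>: "\<theta> > 0" using assms by simp
  define a where "a = ln 2 / ln (1 / \<gamma>)"
  define b where "b = 2 / (\<theta> * \<gamma>)"
  have a: "a > 0" using \<gamma> by (simp add: a_def)
  have b: "b > 0" using \<gamma> \<theta> by (simp add: b_def)
  define c where "c = \<beta> / (2 * real d) powr s"
  have c: "c > 0" using assms by (simp add: c_def)
  define D where "D = real d"
  have D: "D \<ge> 1" using assms by (simp add: D_def)
  let ?L = "\<lambda>N. ln (real (Suc N))"
  \<comment> \<open>The exponents \<open>a\<close> and \<open>b\<close> come from the number of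
    scales and the smallest side. The additional 2 absorbs constants and the passage from N + 1 to
    N, and ensures an exponent above 1.\<close>
  have "(\<lambda>N. measure_pmf.prob (lrp_graph d \<beta> s N)
    {E. lrp_diameter d N E \<le> ereal (ln (real N) powr (a + b + 2))}) \<longlonglongrightarrow> 1"
  proof (rule prob_tendsto_1I)
    show "(\<lambda>N. ?L N powr a * (real (Suc N) powr (2 * D) * exp (- c * (?L N)\<^sup>2))) \<longlonglongrightarrow> 0"
      using a c D by real_asymp
    have "\<forall>\<^sub>F N in sequentially. 2 / \<theta> * ln (?L N) < ?L N" using \<theta> by real_asymp
    moreover have "\<forall>\<^sub>F N in sequentially. \<theta> / 2 \<le> ln (?L N)" using \<theta> by real_asymp
    moreover have "\<forall>\<^sub>F N in sequentially. 1 < ?L N" by real_asymp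
    moreover have "\<forall>\<^sub>F N in sequentially. ?L N powr a * (2 * D * ?L N powr b + 1) \<le> ln (real N) powr (a + b + 2)"
      using a b D by real_asymp
    ultimately show "\<forall>\<^sub>F N in sequentially. measure_pmf.prob (lrp_graph d \<beta> s N)
        (- {E. lrp_diameter d N E \<le> ereal (ln (real N) powr (a + b + 2))})
      \<le> ?L N powr a * (real (Suc N) powr (2 * D) * exp (- c * (?L N)\<^sup>2))"
    proof eventually_elim
      case (elim N)
      have "measure_pmf.prob (lrp_graph d \<beta> s N)
          (- {E. lrp_diameter d N E \<le> ereal (ln (real N) powr (a + b + 2))}) \<le>
        measure_pmf.prob (lrp_graph d \<beta> s N)
          (- {E. lrp_diameter d N E \<le> ereal (?L N powr a * (2 * D * ?L N powr b + 1))})"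
        using elim(4) by (intro measure_pmf.finite_measure_mono) (auto intro: order_trans)
      also have "\<dots> \<le> ?L N powr a * (real (Suc N) powr (2 * D) * exp (- c * (?L N)\<^sup>2))"
        using prob_diameter_gt_polylog[OF assms(1,3,2) \<gamma> \<theta>[unfolded \<theta>_def] refl] elim
        by (simp add: D_def c_def a_def b_def \<theta>_def)
      finally show ?case .
    qed
  qed
  then show ?thesis using a b by (intro exI[of _ "a + b + 2"]) simp
qed

section \<open>Cut edges in the case \<open>d = 1\<close>, \<open>s = 2\<close>\<close>

text \<open>Integers as nodes of the one-dimensional cube; \<open>undefined\<close> off coordinate 0
  makes them extensional.\<close>

definition pt :: "nat \<Rightarrow> nat \<Rightarrow> int" where
  "pt u = (\<lambda>j. if j < 1 then int u else undefined)"

text \<open>Among the pairs that straddle the cut between \<open>i\<close> and \<open>i + 1\<close>,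
  the condition \<open>u + 2 \<le> v\<close> removes exactly the unit edge at the cut.\<close>

definition jumps :: "nat \<Rightarrow> nat \<Rightarrow> (nat \<times> nat) set" where
  "jumps N i = {(u, v). u \<le> i \<and> i < v \<and> v \<le> N \<and> u + 2 \<le> v}"

definition jump_pairs :: "(nat \<times> nat) set \<Rightarrow> (nat \<Rightarrow> int) set set" where
  "jump_pairs I = (\<lambda>(u, v). {pt u, pt v}) ` I"

definition cut_edges :: "nat \<Rightarrow> (nat \<Rightarrow> int) set set \<Rightarrow> nat set" where
  "cut_edges N E = {i. i < N \<and> E \<inter> jump_pairs (jumps N i) = {}}"

lemma pt_0 [simp]: "pt u 0 = int u"
  by (simp add: pt_def)

lemma pt_inject [simp]: "pt u = pt v \<longleftrightarrow> u = v"
  by (metis pt_0 of_nat_eq_iff)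

lemma ldist_pt: "u \<le> v \<Longrightarrow> ldist 1 (pt u) (pt v) = v - u"
  by (simp add: ldist_def l1_norm_def)

lemma pt_in_nodes: "u \<le> N \<Longrightarrow> pt u \<in> lrp_nodes 1 N"
  by (auto simp: lrp_nodes_def pt_def PiE_def extensional_def)

lemma node_eq_pt:
  assumes "x \<in> lrp_nodes 1 N"
  shows "x = pt (nat (x 0)) \<and> nat (x 0) \<le> N"
proof -
  have x0: "0 \<le> x 0" "x 0 \<le> int N" using lrp_nodes_coord[OF assms, of 0] by auto
  have *: "x j = pt (nat (x 0)) j" for j
  proof (cases "j = 0")
    case False
    then have "x j = undefined"
      using PiE_arb[of x "{..<1}" "\<lambda>_. {0..int N}" j] assms by (simp add: lrp_nodes_def)
    then show ?thesis using False by (simp add: pt_def)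
  qed (use x0 in simp)
  show ?thesis using x0 by (intro conjI ext *) simp
qed

lemma finite_jumps: "finite (jumps N i)"
  by (rule finite_subset[of _ "{..N} \<times> {..N}"]) (auto simp: jumps_def)

lemma finite_cut_edges [simp]: "finite (cut_edges N E)"
  by (simp add: cut_edges_def)

text \<open>The step at which the path first exceeds a cut \<open>i\<close> cannot be a jump, so it
  starts at \<open>i\<close> itself. Each cut is therefore a visited position other than the last
  one.\<close>

lemma card_cut_edges_le:
  assumes "is_path (lrp_nodes 1 N) E (pt 0) p (pt N)"
  shows "card (cut_edges N E) \<le> length p - 1"
proof -
  define c where "c k = nat ((p ! k) 0)" for k
  have p: "p \<noteq> []" "hd p = pt 0" "last p = pt N" "set p \<subseteq> lrp_nodes 1 N"
    using assms by (auto simp: is_path_def)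
  have pc: "p ! k = pt (c k)" "c k \<le> N" if "k < length p" for k
    using node_eq_pt[of "p ! k" N] that p(4) nth_mem unfolding c_def by blast+
  have c0: "c 0 = 0" using p by (simp add: c_def hd_conv_nth[symmetric])
  have "p ! (length p - 1) = pt N" using last_conv_nth[OF p(1)] p(3) by metis
  then have cN: "c (length p - 1) = N" by (simp add: c_def)
  have "\<exists>k. k < length p - 1 \<and> c k = i" if i: "i \<in> cut_edges N E" for i
  proof -
    have iN: "i < N" "E \<inter> jump_pairs (jumps N i) = {}" using i by (auto simp: cut_edges_def)
    define k where "k = (LEAST k. i < c k)"
    have "i < c (length p - 1)" using iN cN by simp
    then have k: "i < c k" "k \<le> length p - 1"
      unfolding k_def by (rule LeastI, rule Least_le)
    have "k \<noteq> 0" using k(1) c0 by (cases k) auto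
    then obtain l where l: "k = Suc l" by (cases k) auto
    have "\<not> i < c l" using not_less_Least[of l "\<lambda>k. i < c k"] l by (simp add: k_def)
    then have cl: "c l \<le> i" by simp
    have lp: "l < length p - 1" using k(2) l by simp
    have "{p ! l, p ! Suc l} \<in> E" using is_path_edge[OF assms lp] .
    then have e: "{pt (c l), pt (c k)} \<in> E" using pc(1)[of l] pc(1)[of k] l lp by simp
    have "\<not> c l + 2 \<le> c k"
    proof
      assume "c l + 2 \<le> c k"
      then have "(c l, c k) \<in> jumps N i"
        using cl k pc(2)[of k] lp l by (auto simp: jumps_def)
      then have "{pt (c l), pt (c k)} \<in> jump_pairs (jumps N i)"
        unfolding jump_pairs_def by (intro image_eqI[of _ _ "(c l, c k)"]) auto
      then show False using e iN(2) by blast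
    qed
    then have "c l = i" using cl k(1) by linarith
    then show ?thesis using lp by blast
  qed
  then have "cut_edges N E \<subseteq> c ` {..<length p - 1}" by blast
  then have "card (cut_edges N E) \<le> card {..<length p - 1}"
    by (meson card_image_le card_mono finite_imageI finite_lessThan order_trans)
  then show ?thesis by simp
qed

lemma card_cut_edges_le_diameter:
  "enat (card (cut_edges N E)) \<le> graph_diameter (lrp_nodes 1 N) E"
proof (cases "graph_diameter (lrp_nodes 1 N) E")
  case (enat n)
  have "graph_dist (lrp_nodes 1 N) E (pt 0) (pt N) \<le> enat n"
    using graph_dist_le_diameter[of "pt 0" "lrp_nodes 1 N" "pt N" E] enat pt_in_nodes by simp
  then obtain p where "is_path (lrp_nodes 1 N) E (pt 0) p (pt N)" "length p \<le> Suc n"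
    unfolding graph_dist_le_iff by auto
  then have "card (cut_edges N E) \<le> n" using card_cut_edges_le by fastforce
  then show ?thesis by (simp only: enat enat_ord_simps)
qed simp

lemma prob_no_jumps:
  assumes "\<beta> > 0" "I \<subseteq> {(u, v). v \<le> N \<and> u + 2 \<le> v}"
  shows "measure_pmf.prob (lrp_graph 1 \<beta> 2 N) {E. E \<inter> jump_pairs I = {}}
    = exp (- \<beta> * (\<Sum>(u, v)\<in>I. 1 / (real v - real u)\<^sup>2))"
proof -
  have inj: "inj_on (\<lambda>(u, v). {pt u, pt v}) I"
  proof (rule inj_onI)
    fix z w assume zw: "z \<in> I" "w \<in> I" "(\<lambda>(u, v). {pt u, pt v}) z = (\<lambda>(u, v). {pt u, pt v}) w"
    obtain a b where z: "z = (a, b)" by (cases z)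
    obtain a' b' where w: "w = (a', b')" by (cases w)
    have "a + 2 \<le> b" "a' + 2 \<le> b'" using zw(1,2) assms(2) by (auto simp: z w)
    moreover have "a = a' \<and> b = b' \<or> a = b' \<and> b = a'"
      using zw(3) by (simp add: z w doubleton_eq_iff)
    ultimately show "z = w" unfolding z w by auto
  qed
  have "jump_pairs I \<subseteq> lrp_pairs 1 N - unit_pairs 1 N"
  proof
    fix e assume "e \<in> jump_pairs I"
    then obtain u v where uv: "(u, v) \<in> I" "e = {pt u, pt v}" by (auto simp: jump_pairs_def)
    then have *: "v \<le> N" "u + 2 \<le> v" using assms(2) by auto
    then have "e \<in> lrp_pairs 1 N" unfolding lrp_pairs_def uv(2)
      using pt_in_nodes[of u N] pt_in_nodes[of v N] pt_inject[of u v] by fastforce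
    moreover have "pair_length 1 e \<noteq> 1"
      using * ldist_pt[of u v] by (simp add: uv(2) pair_length_eq)
    ultimately show "e \<in> lrp_pairs 1 N - unit_pairs 1 N" by (simp add: unit_pairs_def)
  qed
  then have "measure_pmf.prob (lrp_graph 1 \<beta> 2 N) {E. E \<inter> jump_pairs I = {}} =
      exp (- (\<Sum>e\<in>jump_pairs I. \<beta> / real_of_int (pair_length 1 e) powr 2))"
    by (rule prob_lrp_avoid[OF assms(1)])
  also have "(\<Sum>e\<in>jump_pairs I. \<beta> / real_of_int (pair_length 1 e) powr 2) =
      (\<Sum>(u, v)\<in>I. \<beta> * (1 / (real v - real u)\<^sup>2))"
    unfolding jump_pairs_def sum.reindex[OF inj]
  proof (intro sum.cong refl)
    fix z assume z: "z \<in> I"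
    obtain u v where uv: "z = (u, v)" by (cases z)
    have "u + 2 \<le> v" using assms(2) z uv by auto
    then show "((\<lambda>e. \<beta> / real_of_int (pair_length 1 e) powr 2) \<circ> (\<lambda>(u, v). {pt u, pt v})) z =
        (case z of (u, v) \<Rightarrow> \<beta> * (1 / (real v - real u)\<^sup>2))"
      using ldist_pt[of u v] by (simp add: uv pair_length_eq of_nat_diff)
  qed
  also have "\<dots> = \<beta> * (\<Sum>(u, v)\<in>I. 1 / (real v - real u)\<^sup>2)"
    by (simp add: sum_distrib_left case_prod_unfold)
  finally show ?thesis by simp
qed

section \<open>Sums of inverse squares over jumps\<close>

text \<open>Telescoping with 1/(t+1)^2 \<le> 1/t - 1/(t+1). The induction needs the sharper bound in
  which the final term of the telescope is still subtracted.\<close>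

lemma sum_inverse_squares_le:
  assumes "u < a"
  shows "(\<Sum>v\<in>{a<..n}. 1 / (real v - real u)\<^sup>2) \<le> 1 / (real a - real u)"
proof (cases "a \<le> n")
  case True
  have "(\<Sum>v\<in>{a<..n}. 1 / (real v - real u)\<^sup>2) \<le> 1 / (real a - real u) - 1 / (real n - real u)"
    using True
  proof (induction n rule: dec_induct)
    case (step n)
    have n: "real n - real u > 0" using step assms by simp
    have "{a<..Suc n} = insert (Suc n) {a<..n}" using step by auto
    then have "(\<Sum>v\<in>{a<..Suc n}. 1 / (real v - real u)\<^sup>2) \<le>
        1 / (real (Suc n) - real u)\<^sup>2 + (1 / (real a - real u) - 1 / (real n - real u))"
      using step.IH by simp
    moreover have "1 / (real (Suc n) - real u)\<^sup>2 \<le> 1 / (real n - real u) - 1 / (real (Suc n) - real u)"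
    proof -
      define t where "t = real n - real u"
      have t: "t > 0" using n by (simp add: t_def)
      have "1 / (t + 1)\<^sup>2 \<le> 1 / (t * (t + 1))"
        using t unfolding power2_eq_square by (intro divide_left_mono mult_right_mono) auto
      also have "\<dots> = 1 / t - 1 / (t + 1)" using t by (simp add: field_simps)
      finally have "1 / (t + 1)\<^sup>2 \<le> 1 / t - 1 / (t + 1)" .
      then show ?thesis by (simp add: t_def algebra_simps)
    qed
    ultimately show ?case by linarith
  qed simp
  moreover have "1 / (real n - real u) \<ge> 0" using True assms by simp
  ultimately show ?thesis by linarith
qed (use assms in simp)

text \<open>The coefficient 1 of the logarithm is essential: it makes the probability of a cut at
  least of order i^(-\<beta>), with an exponent below 1. The row u = i is treated apart because its
  jumps start only at i + 2.\<close>

lemma sum_jumps_le: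
  assumes "i \<ge> 1"
  shows "(\<Sum>(u, v)\<in>jumps N i. 1 / (real v - real u)\<^sup>2) \<le> 2 + ln (real i)"
proof -
  let ?f = "\<lambda>u v. 1 / (real v - real u)\<^sup>2"
  let ?B = "\<lambda>u. {v. i < v \<and> v \<le> N \<and> u + 2 \<le> v}"
  have fin: "finite (?B u)" for u by (rule finite_subset[of _ "{..N}"]) auto
  have "jumps N i = (SIGMA u:{..i}. ?B u)" by (auto simp: jumps_def)
  then have "(\<Sum>(u, v)\<in>jumps N i. ?f u v) = (\<Sum>u\<le>i. \<Sum>v\<in>?B u. ?f u v)"
    using fin by (simp add: sum.Sigma)
  also have "{..i} = insert i {..<i}" by auto
  also have "(\<Sum>u\<in>insert i {..<i}. \<Sum>v\<in>?B u. ?f u v) =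
      (\<Sum>v\<in>?B i. ?f i v) + (\<Sum>u<i. \<Sum>v\<in>?B u. ?f u v)" by simp
  also have "\<dots> \<le> 1 + (\<Sum>u<i. 1 / (real i - real u))"
  proof (intro add_mono sum_mono)
    have "?B i = {Suc i<..N}" by auto
    then show "(\<Sum>v\<in>?B i. ?f i v) \<le> 1"
      using sum_inverse_squares_le[of i "Suc i" N] by simp
    fix u assume "u \<in> {..<i}"
    then have u: "u < i" by simp
    then have "?B u = {i<..N}" by auto
    then show "(\<Sum>v\<in>?B u. ?f u v) \<le> 1 / (real i - real u)"
      using sum_inverse_squares_le[OF u, of N] by simp
  qed
  also have "(\<Sum>u<i. 1 / (real i - real u)) = (\<Sum>r=1..i. 1 / real r)"
    by (rule sum.reindex_bij_witness[of _ "\<lambda>r. i - r" "\<lambda>u. i - u"]) (auto simp: of_nat_diff)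
  also have "\<dots> \<le> 1 + ln (real i)" by (rule harmonic_le_ln[OF assms])
  finally show ?thesis by simp
qed

lemma ln_le_sum_reciprocals:
  assumes "1 \<le> m" "m \<le> n"
  shows "ln (real n / real m) \<le> (\<Sum>i=m..<n. 1 / real i)"
  using assms(2)
proof (induction n rule: dec_induct)
  case (step n)
  have n: "real n > 0" "real m > 0" using step assms(1) by simp_all
  have "ln (real (Suc n) / real m) = ln (real n / real m) + ln (1 + 1 / real n)"
  proof -
    have "real (Suc n) / real m = real n / real m * (1 + 1 / real n)"
      using n by (simp add: field_simps)
    moreover have "ln (real n / real m * (1 + 1 / real n)) = ln (real n / real m) + ln (1 + 1 / real n)"
      using n by (intro ln_mult_pos) (auto intro: add_pos_nonneg)
    ultimately show ?thesis by (simp only:)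
  qed
  also have "ln (1 + 1 / real n) \<le> 1 / real n" by (rule ln_add_one_self_le_self) simp
  finally show ?case using step by simp
qed (use assms(1) in simp)

lemma sum_common_jumps_le:
  assumes "i < j"
  shows "(\<Sum>(u, v)\<in>jumps N i \<inter> jumps N j. 1 / (real v - real u)\<^sup>2) \<le> (\<Sum>u\<le>i. 1 / (real j - real u))"
proof -
  let ?f = "\<lambda>u v. 1 / (real v - real u)\<^sup>2"
  have "jumps N i \<inter> jumps N j = (SIGMA u:{..i}. {j<..N})" using assms by (auto simp: jumps_def)
  then have "(\<Sum>(u, v)\<in>jumps N i \<inter> jumps N j. ?f u v) = (\<Sum>u\<le>i. \<Sum>v\<in>{j<..N}. ?f u v)"
    by (simp add: sum.Sigma)
  also have "\<dots> \<le> (\<Sum>u\<le>i. 1 / (real j - real u))"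
    using assms by (intro sum_mono sum_inverse_squares_le) auto
  finally show ?thesis .
qed

lemma sum_reciprocals_le_ratio:
  assumes "i < j"
  shows "(\<Sum>u\<le>i. 1 / (real j - real u)) \<le> (real i + 1) / (real j - real i)"
proof -
  have "(\<Sum>u\<le>i. 1 / (real j - real u)) \<le> (\<Sum>u\<le>i. 1 / (real j - real i))"
    using assms by (intro sum_mono divide_left_mono) auto
  then show ?thesis by (simp add: add.commute)
qed

text \<open>An integral comparison done by induction on the last index, with ln (1 - 1/(t+1)) \<le>
  -1/(t+1) as the step. The coefficient of the logarithm is again 1, so exponentiating \<beta> times
  the sum gives a singularity of order \<beta> and no worse.\<close>

lemma sum_reciprocals_le_ln:
  assumes "i < j"
  shows "(\<Sum>u\<le>i. 1 / (real j - real u)) \<le> 1 + ln (real j / (real j - real i))"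
proof -
  have "(\<Sum>u\<le>k. 1 / (real j - real u)) \<le> 1 / (real j - real k) + ln (real j / (real j - real k))" if "k \<le> i" for k
    using that
  proof (induction k)
    case 0
    then show ?case using assms by simp
  next
    case (Suc k)
    define t where "t = real j - real (Suc k)"
    have t: "t > 0" using Suc.prems assms by (simp add: t_def)
    have tk: "real j - real k = t + 1" by (simp add: t_def)
    have j: "real j > 0" using assms by simp
    have "ln (1 + - (1 / (t + 1))) \<le> - (1 / (t + 1))"
      using t by (intro ln_add_one_self_le_self2) simp
    also have "1 + - (1 / (t + 1)) = t / (t + 1)" using t by (simp add: field_simps)
    also have "ln (t / (t + 1)) = ln t - ln (t + 1)" using t by (simp add: ln_div)
    finally have *: "1 / (t + 1) + ln (real j / (t + 1)) \<le> ln (real j / t)"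
      using t j by (simp add: ln_div)
    have "(\<Sum>u\<le>Suc k. 1 / (real j - real u)) = (\<Sum>u\<le>k. 1 / (real j - real u)) + 1 / t"
      by (simp add: t_def)
    also have "\<dots> \<le> 1 / (t + 1) + ln (real j / (t + 1)) + 1 / t"
      using Suc.IH Suc.prems by (simp add: tk)
    also have "\<dots> \<le> ln (real j / t) + 1 / t" using * by simp
    finally show ?case by (simp add: t_def)
  qed
  from this[of i] have "(\<Sum>u\<le>i. 1 / (real j - real u)) \<le> 1 / (real j - real i) + ln (real j / (real j - real i))"
    by simp
  moreover have "1 / (real j - real i) \<le> 1" using assms by simp
  ultimately show ?thesis by linarith
qed

text \<open>Young's inequality replaces the integral: (t-1)^(1-\<beta>) t^\<beta> \<le> t -
  (1-\<beta>), and division by t^\<beta> shows that the right-hand side grows by at least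
  t^(-\<beta>) per step.\<close>

lemma sum_powr_neg_le:
  fixes \<beta> :: real
  assumes "0 < \<beta>" "\<beta> < 1"
  shows "(\<Sum>t=1..n. real t powr - \<beta>) \<le> real n powr (1 - \<beta>) / (1 - \<beta>)"
proof (induction n)
  case (Suc n)
  show ?case
  proof (cases "n = 0")
    case True
    then show ?thesis using assms by (simp add: field_simps)
  next
    case False
    define t where "t = real (Suc n)"
    have t: "t > 1" "real n = t - 1" using False by (auto simp: t_def)
    have "(t - 1) powr (1 - \<beta>) * t powr \<beta> \<le> (1 - \<beta>) * (t - 1) + \<beta> * t"
      using t assms by (intro Youngs_inequality_0) auto
    also have "\<dots> = t - (1 - \<beta>)" by (simp add: algebra_simps)
    finally have "(t - 1) powr (1 - \<beta>) \<le> (t - (1 - \<beta>)) / t powr \<beta>"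
      using t by (simp add: pos_le_divide_eq)
    also have "\<dots> = t powr (1 - \<beta>) - (1 - \<beta>) * t powr - \<beta>"
      using t by (simp add: powr_diff powr_minus field_simps)
    finally have "(t - 1) powr (1 - \<beta>) / (1 - \<beta>) \<le> (t powr (1 - \<beta>) - (1 - \<beta>) * t powr - \<beta>) / (1 - \<beta>)"
      using assms by (intro divide_right_mono) auto
    also have "\<dots> = t powr (1 - \<beta>) / (1 - \<beta>) - t powr - \<beta>"
      using assms by (simp add: field_simps)
    finally have "(t - 1) powr (1 - \<beta>) / (1 - \<beta>) + t powr - \<beta> \<le> t powr (1 - \<beta>) / (1 - \<beta>)" by simp
    moreover have "(\<Sum>t=1..Suc n. real t powr - \<beta>) = (\<Sum>t=1..n. real t powr - \<beta>) + t powr - \<beta>"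
      by (simp add: t_def)
    ultimately show ?thesis using Suc by (simp add: t(2) t_def[symmetric])
  qed
qed simp

text \<open>
  Here \<open>R i\<close> stands for the sum over the common jumps of \<open>i\<close> and \<open>j\<close>.  It is of order \<open>i / j\<close> for
  \<open>2 * i \<le> j\<close>; for the other \<open>i\<close> its exponential has a singularity of order \<open>\<beta> < 1\<close> at \<open>j\<close>, which is
  summable.
\<close>

lemma sum_correlation_le:
  fixes \<beta> :: real
  assumes "0 < \<beta>" "\<beta> < 1" "j \<ge> 1"
    and R: "\<And>i. i < j \<Longrightarrow> R i \<le> (\<Sum>u\<le>i. 1 / (real j - real u))" "\<And>i. i < j \<Longrightarrow> R i \<ge> 0"
  shows "(\<Sum>i=1..<j. (exp (\<beta> * R i) - 1) / (real i * real j)) \<le> (4 * exp 2 + 2 * exp 1 / (1 - \<beta>)) / real j"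
proof -
  have j: "real j > 0" using assms by simp
  have "(\<Sum>i=1..<j. (exp (\<beta> * R i) - 1) / (real i * real j)) \<le>
    (\<Sum>i=1..<j. 4 * exp 2 / (real j)\<^sup>2 + 2 * exp 1 * real j powr (\<beta> - 2) * (real j - real i) powr - \<beta>)"
  proof (rule sum_mono)
    fix i assume "i \<in> {1..<j}"
    then have i: "1 \<le> i" "i < j" by auto
    let ?T1 = "4 * exp 2 / (real j)\<^sup>2" and ?T2 = "2 * exp 1 * real j powr (\<beta> - 2) * (real j - real i) powr - \<beta>"
    have T: "?T1 \<ge> 0" "?T2 \<ge> 0" by auto
    have \<beta>R: "\<beta> * R i \<le> R i" using R(2)[OF i(2)] assms by (simp add: mult_left_le_one_le)
    show "(exp (\<beta> * R i) - 1) / (real i * real j) \<le> ?T1 + ?T2"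
    proof (cases "2 * i \<le> j")
      case True
      have "R i \<le> (real i + 1) / (real j - real i)"
        using R(1)[OF i(2)] sum_reciprocals_le_ratio[OF i(2)] by linarith
      also have "\<dots> \<le> (2 * real i) / (real j / 2)"
        using i True by (intro frac_le) auto
      finally have R4: "\<beta> * R i \<le> 4 * real i / real j" using \<beta>R by simp
      also have "4 * real i / real j \<le> 2" using True j by (simp add: field_simps)
      finally have R2: "\<beta> * R i \<le> 2" .
      have "1 - \<beta> * R i \<le> exp (- (\<beta> * R i))" using exp_ge_add_one_self[of "- (\<beta> * R i)"] by simp
      then have "(1 - \<beta> * R i) * exp (\<beta> * R i) \<le> exp (- (\<beta> * R i)) * exp (\<beta> * R i)"
        by (intro mult_right_mono) auto
      then have "exp (\<beta> * R i) - 1 \<le> \<beta> * R i * exp (\<beta> * R i)"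
        by (simp add: exp_minus algebra_simps)
      also have "\<dots> \<le> (4 * real i / real j) * exp 2"
        using R4 R2 by (intro mult_mono) auto
      finally have "(exp (\<beta> * R i) - 1) / (real i * real j) \<le> (4 * real i / real j) * exp 2 / (real i * real j)"
        by (intro divide_right_mono) auto
      also have "\<dots> = ?T1" using i j by (simp add: power2_eq_square)
      finally show ?thesis using T by linarith
    next
      case False
      have "R i \<le> 1 + ln (real j / (real j - real i))"
        using R(1)[OF i(2)] sum_reciprocals_le_ln[OF i(2)] by linarith
      then have "\<beta> * R i \<le> \<beta> * (1 + ln (real j / (real j - real i)))"
        using assms by (intro mult_left_mono) auto
      also have "\<dots> \<le> 1 + \<beta> * ln (real j / (real j - real i))"
        using assms by (simp add: algebra_simps)
      finally have "exp (\<beta> * R i) \<le> exp 1 * (real j / (real j - real i)) powr \<beta>"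
        using i j by (simp add: powr_def exp_add[symmetric])
      then have "(exp (\<beta> * R i) - 1) / (real i * real j) \<le>
          (exp 1 * (real j / (real j - real i)) powr \<beta>) / (real j / 2 * real j)"
        using False i j by (intro frac_le) auto
      also have "\<dots> = ?T2"
      proof -
        have "(real j / (real j - real i)) powr \<beta> = real j powr \<beta> * (real j - real i) powr - \<beta>"
          using i by (simp add: powr_divide powr_minus_divide)
        moreover have "real j powr (\<beta> - 2) = real j powr \<beta> / (real j * real j)"
          using j by (simp add: powr_diff power2_eq_square)
        ultimately show ?thesis by simp
      qed
      finally show ?thesis using T by linarith
    qed
  qed
  also have "\<dots> = (\<Sum>i=1..<j. 4 * exp 2 / (real j)\<^sup>2) + 2 * exp 1 * real j powr (\<beta> - 2) * (\<Sum>i=1..<j. (real j - real i) powr - \<beta>)"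
    by (simp add: sum.distrib sum_distrib_left)
  also have "\<dots> \<le> 4 * exp 2 / real j + 2 * exp 1 * real j powr (\<beta> - 2) * (real j powr (1 - \<beta>) / (1 - \<beta>))"
  proof (intro add_mono mult_left_mono)
    have "(\<Sum>i=1..<j. 4 * exp 2 / (real j)\<^sup>2) \<le> real j * (4 * exp 2 / (real j)\<^sup>2)"
      unfolding sum_constant card_atLeastLessThan by (intro mult_right_mono of_nat_mono) auto
    also have "\<dots> = 4 * exp 2 / real j" using j by (simp add: power2_eq_square)
    finally show "(\<Sum>i=1..<j. 4 * exp 2 / (real j)\<^sup>2) \<le> 4 * exp 2 / real j" .
    have "(\<Sum>i=1..<j. (real j - real i) powr - \<beta>) = (\<Sum>t=1..<j. real t powr - \<beta>)"
      by (rule sum.reindex_bij_witness[of _ "\<lambda>r. j - r" "\<lambda>u. j - u"]) (auto simp: of_nat_diff)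
    also have "\<dots> \<le> (\<Sum>t=1..j. real t powr - \<beta>)"
      by (intro sum_mono2) auto
    also have "\<dots> \<le> real j powr (1 - \<beta>) / (1 - \<beta>)" using assms by (intro sum_powr_neg_le)
    finally show "(\<Sum>i=1..<j. (real j - real i) powr - \<beta>) \<le> real j powr (1 - \<beta>) / (1 - \<beta>)" .
  qed auto
  also have "2 * exp 1 * real j powr (\<beta> - 2) * (real j powr (1 - \<beta>) / (1 - \<beta>)) = 2 * exp 1 / (1 - \<beta>) / real j"
  proof -
    have "real j powr (\<beta> - 2) * real j powr (1 - \<beta>) = real j powr - 1"
      by (simp add: powr_add[symmetric])
    also have "\<dots> = 1 / real j" using j by (simp add: powr_minus_divide)
    finally have "2 * exp 1 * (real j powr (\<beta> - 2) * real j powr (1 - \<beta>)) / (1 - \<beta>) = 2 * exp 1 * (1 / real j) / (1 - \<beta>)"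
      by (simp only:)
    then show ?thesis by (simp add: mult_ac)
  qed
  finally show ?thesis by (simp add: add_divide_distrib)
qed

section \<open>The second moment of the weighted number of cut edges\<close>

context
  fixes \<beta> :: real and N m :: nat
  assumes \<beta>: "0 < \<beta>" "\<beta> < 1" and m: "1 \<le> m" "m < N"
begin

definition jump_sum :: "nat \<Rightarrow> real" where
  "jump_sum i = (\<Sum>(u, v)\<in>jumps N i. 1 / (real v - real u)\<^sup>2)"

definition common_sum :: "nat \<Rightarrow> nat \<Rightarrow> real" where
  "common_sum i j = (\<Sum>(u, v)\<in>jumps N i \<inter> jumps N j. 1 / (real v - real u)\<^sup>2)"

definition cut_weight :: "nat \<Rightarrow> real" where
  "cut_weight i = exp (\<beta> * jump_sum i) / real i"

definition weighted_cuts :: "(nat \<Rightarrow> int) set set \<Rightarrow> real" where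
  "weighted_cuts E = (\<Sum>i=m..<N. cut_weight i * indicator {E. E \<inter> jump_pairs (jumps N i) = {}} E)"

definition mean_cuts :: real where
  "mean_cuts = (\<Sum>i=m..<N. 1 / real i)"

lemma common_sum_commute: "common_sum i j = common_sum j i"
  by (simp add: common_sum_def Int_commute)

lemma common_sum_nonneg: "common_sum i j \<ge> 0"
  unfolding common_sum_def by (intro sum_nonneg) auto

lemma cut_weight_le:
  assumes "i \<ge> 1"
  shows "cut_weight i \<le> exp 2 * real i powr (\<beta> - 1)"
proof -
  have "jump_sum i \<le> 2 + ln (real i)" unfolding jump_sum_def by (rule sum_jumps_le[OF assms])
  then have "\<beta> * jump_sum i \<le> \<beta> * (2 + ln (real i))" using \<beta> by (intro mult_left_mono) auto
  also have "\<dots> \<le> 2 + \<beta> * ln (real i)" using \<beta> by (simp add: algebra_simps)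
  finally have "exp (\<beta> * jump_sum i) \<le> exp 2 * real i powr \<beta>"
    using assms by (simp add: powr_def exp_add[symmetric])
  then have "cut_weight i \<le> exp 2 * real i powr \<beta> / real i"
    unfolding cut_weight_def by (intro divide_right_mono) auto
  also have "\<dots> = exp 2 * real i powr (\<beta> - 1)"
    using assms by (simp add: powr_diff)
  finally show ?thesis .
qed

lemma prob_cut:
  "measure_pmf.prob (lrp_graph 1 \<beta> 2 N) {E. E \<inter> jump_pairs (jumps N i) = {}} = exp (- \<beta> * jump_sum i)"
  unfolding jump_sum_def using \<beta> by (intro prob_no_jumps) (auto simp: jumps_def)

text \<open>Both cuts survive when the union of their jumps is avoided. Common jumps are paid for
  only once, and this is the whole correlation.\<close>

lemma prob_two_cuts:
  "measure_pmf.prob (lrp_graph 1 \<beta> 2 N)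
    ({E. E \<inter> jump_pairs (jumps N i) = {}} \<inter> {E. E \<inter> jump_pairs (jumps N j) = {}}) =
   exp (- \<beta> * (jump_sum i + jump_sum j - common_sum i j))"
proof -
  have "{E. E \<inter> jump_pairs (jumps N i) = {}} \<inter> {E. E \<inter> jump_pairs (jumps N j) = {}} =
      {E. E \<inter> jump_pairs (jumps N i \<union> jumps N j) = {}}"
    by (auto simp: jump_pairs_def)
  moreover have "(\<Sum>(u, v)\<in>jumps N i \<union> jumps N j. 1 / (real v - real u)\<^sup>2) =
      jump_sum i + jump_sum j - common_sum i j"
    unfolding jump_sum_def common_sum_def by (intro sum_Un finite_jumps)
  moreover have "measure_pmf.prob (lrp_graph 1 \<beta> 2 N) {E. E \<inter> jump_pairs (jumps N i \<union> jumps N j) = {}} =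
      exp (- \<beta> * (\<Sum>(u, v)\<in>jumps N i \<union> jumps N j. 1 / (real v - real u)\<^sup>2))"
    using \<beta> by (intro prob_no_jumps) (auto simp: jumps_def)
  ultimately show ?thesis by simp
qed

lemma expectation_weighted_cuts:
  "measure_pmf.expectation (lrp_graph 1 \<beta> 2 N) weighted_cuts = mean_cuts"
proof -
  define A where "A i = {E. E \<inter> jump_pairs (jumps N i) = {}}" for i
  have "measure_pmf.expectation (lrp_graph 1 \<beta> 2 N) (\<lambda>E. \<Sum>i=m..<N. cut_weight i * indicator (A i) E) =
      (\<Sum>i=m..<N. measure_pmf.expectation (lrp_graph 1 \<beta> 2 N) (\<lambda>E. cut_weight i * indicator (A i) E))"
    by (intro Bochner_Integration.integral_sum integrable_lrp_graph)
  also have "\<dots> = (\<Sum>i=m..<N. cut_weight i * measure_pmf.prob (lrp_graph 1 \<beta> 2 N) (A i))"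
    by simp
  finally have "measure_pmf.expectation (lrp_graph 1 \<beta> 2 N) (\<lambda>E. \<Sum>i=m..<N. cut_weight i * indicator (A i) E) =
      (\<Sum>i=m..<N. cut_weight i * measure_pmf.prob (lrp_graph 1 \<beta> 2 N) (A i))" .
  then have "measure_pmf.expectation (lrp_graph 1 \<beta> 2 N) weighted_cuts =
      (\<Sum>i=m..<N. cut_weight i * exp (- \<beta> * jump_sum i))"
    unfolding weighted_cuts_def A_def prob_cut .
  also have "\<dots> = mean_cuts"
    unfolding mean_cuts_def cut_weight_def by (intro sum.cong refl) (simp add: exp_minus)
  finally show ?thesis .
qed

lemma expectation_weighted_cuts_square:
  "measure_pmf.expectation (lrp_graph 1 \<beta> 2 N) (\<lambda>E. (weighted_cuts E)\<^sup>2) =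
    (\<Sum>i=m..<N. \<Sum>j=m..<N. exp (\<beta> * common_sum i j) / (real i * real j))"
proof -
  define A where "A i = {E. E \<inter> jump_pairs (jumps N i) = {}}" for i
  have "(weighted_cuts E)\<^sup>2 = (\<Sum>i=m..<N. \<Sum>j=m..<N. cut_weight i * cut_weight j * indicator (A i \<inter> A j) E)" for E
    unfolding weighted_cuts_def power2_eq_square sum_product A_def[symmetric]
    by (intro sum.cong refl) (simp add: indicator_inter_arith)
  then have "measure_pmf.expectation (lrp_graph 1 \<beta> 2 N) (\<lambda>E. (weighted_cuts E)\<^sup>2) =
      measure_pmf.expectation (lrp_graph 1 \<beta> 2 N)
        (\<lambda>E. \<Sum>i=m..<N. \<Sum>j=m..<N. cut_weight i * cut_weight j * indicator (A i \<inter> A j) E)"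
    by (simp only:)
  also have "\<dots> = (\<Sum>i=m..<N. measure_pmf.expectation (lrp_graph 1 \<beta> 2 N)
        (\<lambda>E. \<Sum>j=m..<N. cut_weight i * cut_weight j * indicator (A i \<inter> A j) E))"
    by (intro Bochner_Integration.integral_sum integrable_lrp_graph)
  also have "\<dots> = (\<Sum>i=m..<N. \<Sum>j=m..<N. measure_pmf.expectation (lrp_graph 1 \<beta> 2 N)
        (\<lambda>E. cut_weight i * cut_weight j * indicator (A i \<inter> A j) E))"
    by (intro sum.cong refl Bochner_Integration.integral_sum integrable_lrp_graph)
  also have "\<dots> = (\<Sum>i=m..<N. \<Sum>j=m..<N. cut_weight i * cut_weight j * measure_pmf.prob (lrp_graph 1 \<beta> 2 N) (A i \<inter> A j))"
    by simp
  also have "\<dots> = (\<Sum>i=m..<N. \<Sum>j=m..<N. cut_weight i * cut_weight j * exp (- \<beta> * (jump_sum i + jump_sum j - common_sum i j)))"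
    unfolding A_def prob_two_cuts ..
  also have "\<dots> = (\<Sum>i=m..<N. \<Sum>j=m..<N. exp (\<beta> * common_sum i j) / (real i * real j))"
  proof (intro sum.cong refl)
    fix i j
    have "exp (\<beta> * jump_sum i) * exp (\<beta> * jump_sum j) * exp (- \<beta> * (jump_sum i + jump_sum j - common_sum i j)) =
        exp (\<beta> * common_sum i j)"
      by (simp add: exp_add[symmetric] algebra_simps)
    then show "cut_weight i * cut_weight j * exp (- \<beta> * (jump_sum i + jump_sum j - common_sum i j)) =
        exp (\<beta> * common_sum i j) / (real i * real j)"
      unfolding cut_weight_def by (simp add: field_simps)
  qed
  finally show ?thesis .
qed

text \<open>The weights cancel the individual probabilities, so the covariance of the terms at
  \<open>i\<close> and \<open>j\<close> is (exp (\<beta> \<open>common_sum i j\<close>) - 1) / (i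
  j). By symmetry only i < j and the diagonal matter; for each \<open>j\<close> both contribute
  O(1/j), the diagonal because \<open>cut_weight\<close> is bounded for \<beta> < 1. So the variance
  is at most a constant times the mean.\<close>

lemma variance_weighted_cuts_le:
  "measure_pmf.expectation (lrp_graph 1 \<beta> 2 N) (\<lambda>E. (weighted_cuts E - mean_cuts)\<^sup>2) \<le>
    (exp 2 + 2 * (4 * exp 2 + 2 * exp 1 / (1 - \<beta>))) * mean_cuts"
proof -
  let ?M = "lrp_graph 1 \<beta> 2 N" and ?C = "4 * exp 2 + 2 * exp 1 / (1 - \<beta>)"
  let ?g = "\<lambda>i j. (exp (\<beta> * common_sum i j) - 1) / (real i * real j)"
  have sym: "?g i j = ?g j i" for i j by (simp add: common_sum_commute mult.commute)
  have g0: "?g i j \<ge> 0" for i j using \<beta> common_sum_nonneg[of i j] by simp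
  have "measure_pmf.expectation ?M (\<lambda>E. (weighted_cuts E - mean_cuts)\<^sup>2) =
      measure_pmf.expectation ?M (\<lambda>E. (weighted_cuts E)\<^sup>2) - 2 * mean_cuts * measure_pmf.expectation ?M weighted_cuts + mean_cuts\<^sup>2"
    by (simp add: power2_diff mult_ac)
  also have "\<dots> = (\<Sum>i=m..<N. \<Sum>j=m..<N. exp (\<beta> * common_sum i j) / (real i * real j)) - mean_cuts * mean_cuts"
    unfolding expectation_weighted_cuts expectation_weighted_cuts_square by (simp add: power2_eq_square)
  also have "\<dots> = (\<Sum>i=m..<N. \<Sum>j=m..<N. ?g i j)"
    unfolding mean_cuts_def sum_product by (simp add: sum_subtractf[symmetric] diff_divide_distrib)
  also have "\<dots> \<le> (\<Sum>j=m..<N. ?g j j + 2 * (\<Sum>i=m..<j. ?g i j))"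
  proof -
    have split: "(\<Sum>j=m..<N. ?g i j) = (\<Sum>j=m..<i. ?g i j) + ?g i i + (\<Sum>j=Suc i..<N. ?g i j)" if "i \<in> {m..<N}" for i
    proof -
      have "{m..<N} = {m..<i} \<union> {i..<N}" using that by auto
      then have "(\<Sum>j=m..<N. ?g i j) = (\<Sum>j=m..<i. ?g i j) + (\<Sum>j=i..<N. ?g i j)"
        by (simp add: sum.union_disjoint)
      also have "(\<Sum>j=i..<N. ?g i j) = ?g i i + (\<Sum>j=Suc i..<N. ?g i j)"
        using that by (intro sum.atLeast_Suc_lessThan) auto
      finally show ?thesis by simp
    qed
    have "(\<Sum>i=m..<N. \<Sum>j=Suc i..<N. ?g i j) = (\<Sum>j=m..<N. \<Sum>i=m..<j. ?g i j)"
      unfolding sum.Sigma[OF finite_atLeastLessThan ballI[OF finite_atLeastLessThan]]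
      by (rule sum.reindex_bij_witness[of _ "\<lambda>(a, b). (b, a)" "\<lambda>(a, b). (b, a)"]) auto
    moreover have "(\<Sum>i=m..<N. \<Sum>j=m..<i. ?g i j) = (\<Sum>j=m..<N. \<Sum>i=m..<j. ?g i j)"
      by (intro sum.cong refl) (simp add: common_sum_commute mult.commute)
    ultimately show ?thesis
      by (simp only: split sum.distrib cong: sum.cong) (simp add: sum.distrib sum_distrib_left)
  qed
  also have "\<dots> \<le> (\<Sum>j=m..<N. exp 2 / real j + 2 * (?C / real j))"
  proof (intro sum_mono add_mono mult_left_mono)
    fix j assume "j \<in> {m..<N}"
    then have j: "j \<ge> 1" using m by simp
    have "common_sum j j = jump_sum j" by (simp add: common_sum_def jump_sum_def)
    then have "?g j j \<le> cut_weight j / real j"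
      using j unfolding cut_weight_def by (simp add: divide_right_mono)
    also have "\<dots> \<le> exp 2 / real j"
    proof (intro divide_right_mono)
      have "cut_weight j \<le> exp 2 * real j powr (\<beta> - 1)" by (rule cut_weight_le[OF j])
      also have "\<dots> \<le> exp 2 * real j powr 0" using j \<beta> by (intro mult_left_mono powr_mono) auto
      finally show "cut_weight j \<le> exp 2" using j by simp
    qed simp
    finally show "?g j j \<le> exp 2 / real j" .
    have "(\<Sum>i=m..<j. ?g i j) \<le> (\<Sum>i=1..<j. ?g i j)"
      using g0 m by (intro sum_mono2) auto
    also have "\<dots> \<le> ?C / real j"
      using sum_common_jumps_le common_sum_nonneg
      by (intro sum_correlation_le \<beta> j) (auto simp: common_sum_def)
    finally show "(\<Sum>i=m..<j. ?g i j) \<le> ?C / real j" .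
  qed simp
  also have "\<dots> = (exp 2 + 2 * ?C) * mean_cuts"
    unfolding mean_cuts_def sum_distrib_left by (intro sum.cong refl) (simp add: add_divide_distrib algebra_simps)
  finally show ?thesis .
qed

lemma mean_cuts_ge: "ln (real N / real m) \<le> mean_cuts"
  unfolding mean_cuts_def using m by (intro ln_le_sum_reciprocals) auto

text \<open>The bound of order i^(\<beta>-1) on the weights decreases in \<open>i\<close>. Counting
  cuts only from \<open>m\<close> on therefore turns a weighted count that is merely logarithmic
  into a power of \<open>m\<close>.\<close>

lemma card_cut_edges_ge:
  assumes "weighted_cuts E \<ge> c" "c \<ge> 0"
  shows "c * real m powr (1 - \<beta>) / exp 2 \<le> real (card (cut_edges N E))"
proof -
  let ?w = "exp 2 * real m powr (\<beta> - 1)"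
  have "weighted_cuts E \<le> (\<Sum>i=m..<N. ?w * indicator (cut_edges N E) i)"
    unfolding weighted_cuts_def
  proof (intro sum_mono)
    fix i assume i: "i \<in> {m..<N}"
    have "cut_weight i \<le> exp 2 * real i powr (\<beta> - 1)" using i m by (intro cut_weight_le) auto
    also have "\<dots> \<le> ?w" using i m \<beta> by (intro mult_left_mono powr_mono2') auto
    finally show "cut_weight i * indicator {E. E \<inter> jump_pairs (jumps N i) = {}} E \<le> ?w * indicator (cut_edges N E) i"
      using i by (simp add: cut_edges_def indicator_def)
  qed
  also have "\<dots> = ?w * real (card ({m..<N} \<inter> cut_edges N E))"
    by (simp add: indicator_def sum.If_cases flip: sum_distrib_left)
  also have "\<dots> \<le> ?w * real (card (cut_edges N E))"
    by (intro mult_left_mono of_nat_mono card_mono) auto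
  finally have "c \<le> ?w * real (card (cut_edges N E))" using assms by simp
  then have "c * real m powr (1 - \<beta>) / exp 2 \<le> ?w * real (card (cut_edges N E)) * real m powr (1 - \<beta>) / exp 2"
    by (intro divide_right_mono mult_right_mono) auto
  also have "\<dots> = real (card (cut_edges N E)) * (real m powr (\<beta> - 1) * real m powr (1 - \<beta>))" by simp
  also have "real m powr (\<beta> - 1) * real m powr (1 - \<beta>) = 1"
    using m by (simp add: powr_add[symmetric])
  finally show ?thesis by simp
qed

text \<open>Chebyshev's inequality at half the mean: a variance of at most a constant times the mean
  leaves a probability of order 1 / mean.\<close>

lemma prob_diameter_lt_cuts:
  assumes "L \<le> mean_cuts / 2 * real m powr (1 - \<beta>) / exp 2"
  shows "measure_pmf.prob (lrp_graph 1 \<beta> 2 N) (- {E. ereal L \<le> lrp_diameter 1 N E}) \<le>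
    4 * (exp 2 + 2 * (4 * exp 2 + 2 * exp 1 / (1 - \<beta>))) / ln (real N / real m)"
proof -
  let ?M = "lrp_graph 1 \<beta> 2 N" and ?C = "exp 2 + 2 * (4 * exp 2 + 2 * exp 1 / (1 - \<beta>))"
  have l: "ln (real N / real m) > 0" using m by simp
  then have \<mu>: "mean_cuts > 0" using mean_cuts_ge by linarith
  have "measure_pmf.prob ?M (- {E. ereal L \<le> lrp_diameter 1 N E}) \<le>
      measure_pmf.prob ?M {E. (weighted_cuts E - mean_cuts)\<^sup>2 \<ge> mean_cuts\<^sup>2 / 4}"
  proof (intro measure_pmf.finite_measure_mono subsetI)
    fix E assume E: "E \<in> - {E. ereal L \<le> lrp_diameter 1 N E}"
    have "weighted_cuts E < mean_cuts / 2"
    proof (rule ccontr)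
      assume "\<not> weighted_cuts E < mean_cuts / 2"
      then have "mean_cuts / 2 * real m powr (1 - \<beta>) / exp 2 \<le> real (card (cut_edges N E))"
        using \<mu> by (intro card_cut_edges_ge) auto
      then have "ereal L \<le> ereal_of_enat (enat (card (cut_edges N E)))" using assms by simp
      also have "\<dots> \<le> lrp_diameter 1 N E"
        by (simp only: ereal_of_enat_le_iff card_cut_edges_le_diameter)
      finally show False using E by simp
    qed
    then have "mean_cuts / 2 \<le> mean_cuts - weighted_cuts E" by simp
    then have "(mean_cuts / 2)\<^sup>2 \<le> (mean_cuts - weighted_cuts E)\<^sup>2" using \<mu> by (intro power_mono) auto
    then show "E \<in> {E. (weighted_cuts E - mean_cuts)\<^sup>2 \<ge> mean_cuts\<^sup>2 / 4}"
      by (simp add: power2_commute power_divide)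
  qed simp
  also have "\<dots> \<le> measure_pmf.expectation ?M (\<lambda>E. (weighted_cuts E - mean_cuts)\<^sup>2) / (mean_cuts\<^sup>2 / 4)"
    using \<mu> by (intro prob_pmf_markov) auto
  also have "\<dots> \<le> (?C * mean_cuts) / (mean_cuts\<^sup>2 / 4)"
    by (intro divide_right_mono variance_weighted_cuts_le) auto
  also have "\<dots> = 4 * ?C / mean_cuts" using \<mu> by (simp add: power2_eq_square)
  also have "\<dots> \<le> 4 * ?C / ln (real N / real m)"
    using mean_cuts_ge l \<beta> \<mu> by (intro divide_left_mono mult_nonneg_nonneg add_nonneg_nonneg) auto
  finally show ?thesis .
qed

end

theorem diameter_ge_power_critical:
  fixes \<beta> :: real
  assumes "0 < \<beta>" "\<beta> < 1"
  shows "(\<lambda>N. measure_pmf.prob (lrp_graph 1 \<beta> 2 N)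
    {E. lrp_diameter 1 N E \<ge> ereal (real N powr ((1 - \<beta>) / 2))}) \<longlonglongrightarrow> 1"
proof (rule prob_tendsto_1I)
  define K where "K = 4 * (exp 2 + 2 * (4 * exp 2 + 2 * exp 1 / (1 - \<beta>)))"
  show "(\<lambda>N. K / ln (real N / (2 * sqrt (real N)))) \<longlonglongrightarrow> 0"
    by real_asymp
  have "\<forall>\<^sub>F N in sequentially. ln (real N / (2 * sqrt (real N))) \<ge> 2 * exp 2" by real_asymp
  moreover have "\<forall>\<^sub>F N in sequentially. 2 * sqrt (real N) < real N" by real_asymp
  ultimately show "\<forall>\<^sub>F N in sequentially. measure_pmf.prob (lrp_graph 1 \<beta> 2 N)
      (- {E. lrp_diameter 1 N E \<ge> ereal (real N powr ((1 - \<beta>) / 2))}) \<le> K / ln (real N / (2 * sqrt (real N)))"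
    using eventually_ge_at_top[of 1]
  proof eventually_elim
    case (elim N)
    \<comment> \<open>With \<open>m\<close> of order N^(1/2), m^(1-\<beta>) reaches the claimed
      power of \<open>N\<close>, while ln (N/m) still tends to infinity.\<close>
    define m where "m = nat \<lceil>sqrt (real N)\<rceil>"
    have s: "sqrt (real N) \<ge> 1" using elim by simp
    have m: "sqrt (real N) \<le> real m" "real m \<le> 2 * sqrt (real N)"
    proof -
      have "real m = of_int \<lceil>sqrt (real N)\<rceil>" using s by (simp add: m_def)
      then show "sqrt (real N) \<le> real m" "real m \<le> 2 * sqrt (real N)"
        using ceiling_correct[of "sqrt (real N)"] s by linarith+
    qed
    have "1 \<le> real m" "real m < real N" using m s elim by linarith+
    then have mN: "1 \<le> m" "m < N" by simp_all
    have l: "ln (real N / (2 * sqrt (real N))) \<le> ln (real N / real m)"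
      using m s mN by (subst ln_le_cancel_iff) (auto intro!: divide_left_mono)
    have "ln (real N / real m) \<le> mean_cuts N m" by (rule mean_cuts_ge[OF assms mN])
    then have \<mu>: "2 * exp 2 \<le> mean_cuts N m" using l elim by linarith
    have "real N powr ((1 - \<beta>) / 2) = sqrt (real N) powr (1 - \<beta>)"
      by (simp add: powr_half_sqrt[symmetric] powr_powr)
    also have "\<dots> \<le> real m powr (1 - \<beta>)" using m s assms by (intro powr_mono2) auto
    also have "\<dots> = 2 * exp 2 / 2 * real m powr (1 - \<beta>) / exp 2" by simp
    also have "\<dots> \<le> mean_cuts N m / 2 * real m powr (1 - \<beta>) / exp 2"
      using \<mu> by (intro divide_right_mono mult_right_mono) auto
    finally have "measure_pmf.prob (lrp_graph 1 \<beta> 2 N)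
      (- {E. ereal (real N powr ((1 - \<beta>) / 2)) \<le> lrp_diameter 1 N E}) \<le> K / ln (real N / real m)"
      unfolding K_def by (rule prob_diameter_lt_cuts[OF assms mN])
    also have "\<dots> \<le> K / ln (real N / (2 * sqrt (real N)))"
    proof (rule divide_left_mono[OF l])
      show "0 \<le> K" using assms by (simp add: K_def)
      have "ln (real N / (2 * sqrt (real N))) > 0" using elim(1) by (rule less_le_trans[rotated]) simp
      then show "0 < ln (real N / real m) * ln (real N / (2 * sqrt (real N)))"
        using l by (intro mult_pos_pos) auto
    qed
    finally show ?case .
  qed
qed

section \<open>Hop counts inside boxes\<close>

text \<open>
  Adding the unit edges makes distances in boxes finite for every edge set.  Counting nodes instead of
  edges makes hop counts subadditive along rows of boxes, with no extra term for the unit edge that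
  connects two boxes.
\<close>

definition hops :: "nat \<Rightarrow> nat \<Rightarrow> (nat \<Rightarrow> int) set \<Rightarrow> (nat \<Rightarrow> int) set set \<Rightarrow> (nat \<Rightarrow> int) \<Rightarrow> (nat \<Rightarrow> int) \<Rightarrow> real" where
  "hops d N B E x y = real (the_enat (graph_dist B (E \<union> unit_pairs d N) x y)) + 1"

definition node_box :: "nat \<Rightarrow> nat \<Rightarrow> (nat \<Rightarrow> int) set \<Rightarrow> bool" where
  "node_box d N B \<longleftrightarrow> (\<exists>c k. B = lbox d c k) \<and> B \<subseteq> lrp_nodes d N"

text \<open>All nonempty subsets, singletons included, so that \<open>{u, v}\<close> needs no case
  distinction. The empty set is left out because otherwise disjoint boxes would share it.\<close>

definition inner_pairs :: "'a set \<Rightarrow> 'a set set" where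
  "inner_pairs B = Pow B - {{}}"

lemma node_box_nodes: "node_box d N (lrp_nodes d N)"
  using lrp_nodes_eq_lbox by (auto simp: node_box_def)

lemma node_box_lbox: "lbox d c k \<subseteq> lrp_nodes d N \<Longrightarrow> node_box d N (lbox d c k)"
  by (auto simp: node_box_def)

lemma graph_dist_node_box:
  assumes "node_box d N B" "x \<in> B" "y \<in> B"
  shows "graph_dist B (E \<union> unit_pairs d N) x y \<le> enat (ldist d x y)"
  using assms graph_dist_box_le_ldist[of d _ _ N "E \<union> unit_pairs d N" x y] by (auto simp: node_box_def)

lemma enat_hops:
  assumes "node_box d N B" "x \<in> B" "y \<in> B"
  obtains n where "graph_dist B (E \<union> unit_pairs d N) x y = enat n" "hops d N B E x y = real n + 1"
proof -
  obtain n where "graph_dist B (E \<union> unit_pairs d N) x y = enat n"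
    using graph_dist_node_box[OF assms, of E] by (cases "graph_dist B (E \<union> unit_pairs d N) x y") auto
  then show ?thesis using that by (simp add: hops_def)
qed

lemma hops_ge_1: "hops d N B E x y \<ge> 1"
  by (simp add: hops_def)

lemma hops_commute: "hops d N B E x y = hops d N B E y x"
  by (simp add: hops_def graph_dist_commute)

lemma hops_le_ldist:
  assumes "node_box d N B" "x \<in> B" "y \<in> B"
  shows "hops d N B E x y \<le> real (ldist d x y) + 1"
proof -
  obtain n where n: "graph_dist B (E \<union> unit_pairs d N) x y = enat n" "hops d N B E x y = real n + 1"
    by (rule enat_hops[OF assms])
  then show ?thesis using graph_dist_node_box[OF assms, of E] by simp
qed

text \<open>A path inside \<open>B\<close> uses only edges inside \<open>B\<close>. Hop counts in
  disjoint boxes are therefore independent.\<close>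

lemma hops_inner: "hops d N B (E \<inter> inner_pairs B) x y = hops d N B E x y"
proof -
  have F: "{u, v} \<in> inner_pairs B" if "u \<in> B" "v \<in> B" for u v using that by (simp add: inner_pairs_def)
  have "((E \<inter> inner_pairs B) \<union> unit_pairs d N) \<inter> inner_pairs B = (E \<union> unit_pairs d N) \<inter> inner_pairs B" by blast
  then have "graph_dist B ((E \<inter> inner_pairs B) \<union> unit_pairs d N) x y = graph_dist B (E \<union> unit_pairs d N) x y"
    using graph_dist_restrict[of B "inner_pairs B" "(E \<inter> inner_pairs B) \<union> unit_pairs d N" x y]
      graph_dist_restrict[of B "inner_pairs B" "E \<union> unit_pairs d N" x y] F by simp
  then show ?thesis by (simp add: hops_def)
qed

text \<open>Two pieces with \<open>a\<close> and \<open>b\<close> edges and a connecting edge have a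
  + b + 2 nodes, the sum of the two counts. If the pieces share the node \<open>y = y'\<close>, the
  bound gives away one.\<close>

lemma hops_join:
  assumes "node_box d N B1" "node_box d N B2" "node_box d N Q" "B1 \<subseteq> Q" "B2 \<subseteq> Q"
    "x \<in> B1" "y \<in> B1" "y' \<in> B2" "z \<in> B2" "y = y' \<or> {y, y'} \<in> E \<union> unit_pairs d N"
  shows "hops d N Q E x z \<le> hops d N B1 E x y + hops d N B2 E y' z"
proof -
  let ?E = "E \<union> unit_pairs d N"
  obtain a where a: "graph_dist B1 ?E x y = enat a" "hops d N B1 E x y = real a + 1"
    by (rule enat_hops[OF assms(1,6,7)])
  obtain b where b: "graph_dist B2 ?E y' z = enat b" "hops d N B2 E y' z = real b + 1"
    by (rule enat_hops[OF assms(2,8,9)])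
  have in_Q: "x \<in> Q" "y \<in> Q" "y' \<in> Q" "z \<in> Q" using assms by auto
  obtain n where n: "graph_dist Q ?E x z = enat n" "hops d N Q E x z = real n + 1"
    by (rule enat_hops[OF assms(3) in_Q(1,4)])
  have e: "graph_dist Q ?E y y' \<le> 1"
    using assms(10) graph_dist_edge[OF in_Q(2,3), of ?E] graph_dist_refl[OF in_Q(2), of ?E] by auto
  have "enat n \<le> graph_dist Q ?E x y + graph_dist Q ?E y z"
    unfolding n(1)[symmetric] by (rule graph_dist_triangle)
  also have "\<dots> \<le> graph_dist Q ?E x y + (graph_dist Q ?E y y' + graph_dist Q ?E y' z)"
    by (intro add_left_mono graph_dist_triangle)
  also have "\<dots> \<le> graph_dist B1 ?E x y + (1 + graph_dist B2 ?E y' z)"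
    using assms e by (intro add_mono graph_dist_mono) auto
  also have "\<dots> = enat (a + (1 + b))" by (simp add: a b one_enat_def)
  finally show ?thesis using a b n by simp
qed

text \<open>The intermediate points switch the coordinates from \<open>x\<close> to \<open>y\<close>
  one at a time. The chain does not depend on \<open>E\<close>, so expectations can be taken segment
  by segment.\<close>

lemma hops_coordinate_chain:
  assumes "node_box d N B" "B = lbox d c k" "x \<in> B" "y \<in> B" "d \<ge> 1"
  shows "\<exists>z. z 0 = x \<and> z d = y \<and> (\<forall>m\<le>d. z m \<in> B) \<and> (\<forall>m<d. \<forall>j. j \<noteq> m \<longrightarrow> z m j = z (Suc m) j) \<and>
    (\<forall>E. hops d N B E x y \<le> (\<Sum>m<d. hops d N B E (z m) (z (Suc m))))"
proof -
  define z where "z m = (\<lambda>j. if j < m then y j else x j)" for m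
  have z0: "z 0 = x" by (simp add: z_def)
  have ext: "x \<in> extensional {..<d}" "y \<in> extensional {..<d}"
    using assms lbox_extensional by auto
  have zd: "z d = y"
    using ext by (auto simp: z_def extensional_def fun_eq_iff)
  have zB: "z m \<in> B" if "m \<le> d" for m
    unfolding assms(2)
  proof (rule lboxI)
    show "z m \<in> extensional {..<d}" using ext by (auto simp: z_def extensional_def)
    fix j assume "j < d"
    then show "c j \<le> z m j \<and> z m j < c j + int k"
      using lbox_coord[of x d c k j] lbox_coord[of y d c k j] assms by (simp add: z_def)
  qed
  have al: "z m j = z (Suc m) j" if "j \<noteq> m" for m j using that by (simp add: z_def less_Suc_eq)
  have "hops d N B E (z 0) (z (Suc m)) \<le> (\<Sum>l<Suc m. hops d N B E (z l) (z (Suc l)))" if "m < d" for m E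
    using that
  proof (induction m)
    case (Suc m)
    have "hops d N B E (z 0) (z (Suc (Suc m))) \<le> hops d N B E (z 0) (z (Suc m)) + hops d N B E (z (Suc m)) (z (Suc (Suc m)))"
      using Suc.prems zB by (intro hops_join assms(1)) auto
    then show ?case using Suc by simp
  qed simp
  from this[of "d - 1"] have "hops d N B E x y \<le> (\<Sum>m<d. hops d N B E (z m) (z (Suc m)))" for E
    using assms(5) z0 zd by simp
  then show ?thesis using z0 zd zB al by blast
qed

section \<open>Rows of boxes\<close>

definition row_box :: "nat \<Rightarrow> (nat \<Rightarrow> int) \<Rightarrow> nat \<Rightarrow> nat \<Rightarrow> nat \<Rightarrow> (nat \<Rightarrow> int) set" where
  "row_box d a i k l = lbox d (a(i := a i + int (l * k))) k"

lemma row_box_disjoint: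
  assumes "i < d" "l < m"
  shows "row_box d a i k l \<inter> row_box d a i k m = {}"
proof (rule ccontr)
  assume "row_box d a i k l \<inter> row_box d a i k m \<noteq> {}"
  then obtain x where x: "x \<in> row_box d a i k l" "x \<in> row_box d a i k m" by blast
  have "x i < a i + int (l * k) + int k" "a i + int (m * k) \<le> x i"
    using lbox_coord[OF x(1)[unfolded row_box_def] assms(1)] lbox_coord[OF x(2)[unfolded row_box_def] assms(1)] by auto
  then have "int (m * k) < int (Suc l * k)" by simp
  then have "m * k < Suc l * k" by (simp only: of_nat_less_iff)
  moreover have "Suc l * k \<le> m * k" using assms(2) by (intro mult_right_mono) auto
  ultimately show False by linarith
qed

lemma row_point_in_box:
  assumes "i < d" "x \<in> extensional {..<d}" "\<And>j. j < d \<Longrightarrow> j \<noteq> i \<Longrightarrow> a j \<le> x j \<and> x j < a j + int k"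
    "a i + int (l * k) \<le> t" "t < a i + int (Suc l * k)"
  shows "x(i := t) \<in> row_box d a i k l"
  unfolding row_box_def
proof (rule lboxI)
  show "x(i := t) \<in> extensional {..<d}" using assms(1,2) by (auto simp: extensional_def)
  fix j assume "j < d"
  then show "(a(i := a i + int (l * k))) j \<le> (x(i := t)) j \<and> (x(i := t)) j < (a(i := a i + int (l * k))) j + int k"
    using assms(3)[of j] assms(4,5) by auto
qed

lemma unit_pair_row:
  assumes "i < d" "x(i := t) \<in> lrp_nodes d N" "x(i := t + 1) \<in> lrp_nodes d N"
  shows "{x(i := t), x(i := t + 1)} \<in> unit_pairs d N"
proof (rule unit_pairsI[OF assms(2,3)])
  have "int (ldist d ((x(i := t + 1))(i := t)) (x(i := t + 1))) = 1"
    using ldist_fun_upd[OF assms(1), of "x(i := t + 1)" t "x(i := t + 1)"] by simp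
  then show "ldist d (x(i := t)) (x(i := t + 1)) = 1" by simp
qed

text \<open>\<open>f l\<close> and \<open>g l\<close> are the points where the straight segment
  enters and leaves the box with index \<open>l\<close>; the exit of one box and the entry of the
  next are joined by a unit edge. These points do not depend on \<open>E\<close> either.\<close>

lemma hops_row:
  assumes i: "i < d" and x: "x \<in> extensional {..<d}" "\<And>j. j < d \<Longrightarrow> j \<noteq> i \<Longrightarrow> a j \<le> x j \<and> x j < a j + int k"
    and pq: "p \<le> q" and t: "a i + int (p * k) \<le> t" "t < a i + int (Suc p * k)"
    and u: "a i + int (q * k) \<le> u" "u < a i + int (Suc q * k)" "t \<le> u"
    and Q: "node_box d N Q" "\<And>l. p \<le> l \<Longrightarrow> l \<le> q \<Longrightarrow> row_box d a i k l \<subseteq> Q"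
  defines "f \<equiv> \<lambda>l. x(i := max t (a i + int (l * k)))"
    and "g \<equiv> \<lambda>l. x(i := min u (a i + int (Suc l * k) - 1))"
  shows "(\<forall>l\<in>{p..q}. f l \<in> row_box d a i k l \<and> g l \<in> row_box d a i k l) \<and> f p = x(i := t) \<and> g q = x(i := u) \<and>
    (\<forall>E. hops d N Q E (x(i := t)) (x(i := u)) \<le> (\<Sum>l=p..q. hops d N (row_box d a i k l) E (f l) (g l)))"
proof -
  have mono: "int (l * k) \<le> int (l' * k)" if "l \<le> l'" for l l'
    using that by (simp only: of_nat_le_iff mult_le_mono1)
  have k: "k \<ge> 1" using t by (cases k) auto
  have fg: "f l \<in> row_box d a i k l" "g l \<in> row_box d a i k l" if "p \<le> l" "l \<le> q" for l
  proof -
    have "t < a i + int (Suc l * k)" using t(2) mono[of "Suc p" "Suc l"] that by linarith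
    then show "f l \<in> row_box d a i k l"
      unfolding f_def using k by (intro row_point_in_box[OF i x]) auto
    have "a i + int (l * k) \<le> u" using u(1) mono[of l q] that by linarith
    then show "g l \<in> row_box d a i k l"
      unfolding g_def using k by (intro row_point_in_box[OF i x]) auto
  qed
  have fp: "f p = x(i := t)" using t(1) by (simp add: f_def max_def)
  have gq: "g q = x(i := u)" using u(2) by (simp add: g_def min_def)
  have nb: "node_box d N (row_box d a i k l)" if "p \<le> l" "l \<le> q" for l
    using Q that unfolding row_box_def node_box_def by blast
  have main: "hops d N Q E (f p) (g m) \<le> (\<Sum>l=p..m. hops d N (row_box d a i k l) E (f l) (g l))"
    if "p \<le> m" "m \<le> q" for m E
    using that
  proof (induction m rule: dec_induct)
    case base
    have "hops d N Q E (f p) (g p) \<le> hops d N (row_box d a i k p) E (f p) (g p)"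
    proof -
      have gQ: "f p \<in> row_box d a i k p" "g p \<in> row_box d a i k p" using fg base by auto
      moreover have sub: "row_box d a i k p \<subseteq> Q" using Q base by simp
      ultimately have inQ: "f p \<in> Q" "g p \<in> Q" by auto
      obtain n where n: "graph_dist Q (E \<union> unit_pairs d N) (f p) (g p) = enat n" "hops d N Q E (f p) (g p) = real n + 1"
        by (rule enat_hops[OF Q(1) inQ])
      obtain m where m: "graph_dist (row_box d a i k p) (E \<union> unit_pairs d N) (f p) (g p) = enat m"
          "hops d N (row_box d a i k p) E (f p) (g p) = real m + 1"
        using base nb by (auto intro: enat_hops[OF _ gQ])
      have "enat n \<le> enat m" unfolding n(1)[symmetric] m(1)[symmetric] using sub by (intro graph_dist_mono) auto
      then show ?thesis using n m by simp
    qed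
    then show ?case by simp
  next
    case (step m)
    have mq: "Suc m \<le> q" "p \<le> m" using step by auto
    have "a i + int (Suc m * k) \<le> u" using u(1) mono[of "Suc m" q] mq by linarith
    then have g: "g m = x(i := a i + int (Suc m * k) - 1)" by (simp add: g_def min_def)
    have "t \<le> a i + int (Suc m * k)" using t(2) mono[of "Suc p" "Suc m"] mq by linarith
    then have f: "f (Suc m) = x(i := (a i + int (Suc m * k) - 1) + 1)"
      by (simp only: f_def max_absorb2 diff_add_cancel)
    have gm: "g m \<in> row_box d a i k m" and fm: "f (Suc m) \<in> row_box d a i k (Suc m)" "g (Suc m) \<in> row_box d a i k (Suc m)"
      using fg mq by auto
    then have "g m \<in> lrp_nodes d N" "f (Suc m) \<in> lrp_nodes d N"
      using nb[of m] nb[of "Suc m"] mq by (auto simp: node_box_def)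
    then have e: "{g m, f (Suc m)} \<in> unit_pairs d N" unfolding f g by (rule unit_pair_row[OF i])
    have "hops d N Q E (f p) (g (Suc m)) \<le> hops d N Q E (f p) (g m) + hops d N (row_box d a i k (Suc m)) E (f (Suc m)) (g (Suc m))"
    proof (rule hops_join)
      show "f p \<in> Q" using fg[of p] Q(2)[of p] pq by auto
      show "g m \<in> Q" using gm Q(2)[of m] mq by auto
    qed (use Q nb mq fm e in auto)
    then show ?case using step by simp
  qed
  have "hops d N Q E (x(i := t)) (x(i := u)) \<le> (\<Sum>l=p..q. hops d N (row_box d a i k l) E (f l) (g l))" for E
    using main[OF pq order_refl, of E] unfolding fp gq .
  then show ?thesis using fg fp gq by (intro conjI ballI allI) auto
qed

section \<open>The mean hop count along an axis\<close>

lemma expectation_lrp_mult: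
  fixes f g :: "(nat \<Rightarrow> int) set set \<Rightarrow> real"
  assumes "F \<inter> G = {}" "\<And>E. f (E \<inter> F) = f E" "\<And>E. g (E \<inter> G) = g E"
  shows "measure_pmf.expectation (lrp_graph d \<beta> s N) (\<lambda>E. f E * g E) =
    measure_pmf.expectation (lrp_graph d \<beta> s N) f * measure_pmf.expectation (lrp_graph d \<beta> s N) g"
  unfolding lrp_graph_eq_rand_set by (rule expectation_rand_set_mult[where f = f and g = g, OF finite_lrp_pairs assms])

lemma expectation_lrp_mono:
  fixes f g :: "(nat \<Rightarrow> int) set set \<Rightarrow> real"
  assumes "\<And>E. f E \<le> g E"
  shows "measure_pmf.expectation (lrp_graph d \<beta> s N) f \<le> measure_pmf.expectation (lrp_graph d \<beta> s N) g"
  using assms by (intro integral_mono) auto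

lemma expectation_lrp_sum:
  fixes f :: "'i \<Rightarrow> (nat \<Rightarrow> int) set set \<Rightarrow> real"
  shows "measure_pmf.expectation (lrp_graph d \<beta> s N) (\<lambda>E. \<Sum>i\<in>I. f i E) =
    (\<Sum>i\<in>I. measure_pmf.expectation (lrp_graph d \<beta> s N) (f i))"
  by (intro Bochner_Integration.integral_sum integrable_lrp_graph)

text \<open>Uniform in the position of the box and in the axis, since a step of the recursion uses
  the bound for all boxes of a row and for all axes.\<close>

definition axis_hops_le :: "nat \<Rightarrow> nat \<Rightarrow> real \<Rightarrow> real \<Rightarrow> nat \<Rightarrow> real \<Rightarrow> bool" where
  "axis_hops_le d N \<beta> s k A \<longleftrightarrow> (\<forall>c x y i. lbox d c k \<subseteq> lrp_nodes d N \<longrightarrow> x \<in> lbox d c k \<longrightarrow> y \<in> lbox d c k \<longrightarrow>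
     i < d \<longrightarrow> (\<forall>j. j \<noteq> i \<longrightarrow> x j = y j) \<longrightarrow>
     measure_pmf.expectation (lrp_graph d \<beta> s N) (\<lambda>E. hops d N (lbox d c k) E x y) \<le> A)"

lemma mean_hops_le:
  assumes "axis_hops_le d N \<beta> s k A" "lbox d c k \<subseteq> lrp_nodes d N" "x \<in> lbox d c k" "y \<in> lbox d c k" "d \<ge> 1"
  shows "measure_pmf.expectation (lrp_graph d \<beta> s N) (\<lambda>E. hops d N (lbox d c k) E x y) \<le> real d * A"
proof -
  obtain z where z: "\<forall>m\<le>d. z m \<in> lbox d c k" "\<forall>m<d. \<forall>j. j \<noteq> m \<longrightarrow> z m j = z (Suc m) j"
    "\<forall>E. hops d N (lbox d c k) E x y \<le> (\<Sum>m<d. hops d N (lbox d c k) E (z m) (z (Suc m)))"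
    using hops_coordinate_chain[OF node_box_lbox[OF assms(2)] refl assms(3-5)] by blast
  have "measure_pmf.expectation (lrp_graph d \<beta> s N) (\<lambda>E. hops d N (lbox d c k) E x y) \<le>
      measure_pmf.expectation (lrp_graph d \<beta> s N) (\<lambda>E. \<Sum>m<d. hops d N (lbox d c k) E (z m) (z (Suc m)))"
    using z(3) by (intro expectation_lrp_mono) auto
  also have "\<dots> = (\<Sum>m<d. measure_pmf.expectation (lrp_graph d \<beta> s N) (\<lambda>E. hops d N (lbox d c k) E (z m) (z (Suc m))))"
    by (rule expectation_lrp_sum)
  also have "\<dots> \<le> (\<Sum>m<d. A)"
  proof (rule sum_mono)
    fix m assume m: "m \<in> {..<d}"
    show "measure_pmf.expectation (lrp_graph d \<beta> s N) (\<lambda>E. hops d N (lbox d c k) E (z m) (z (Suc m))) \<le> A"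
      using assms(1,2) z(1,2) m unfolding axis_hops_le_def by (auto simp del: fun_upd_apply)
  qed
  finally show ?thesis by simp
qed

text \<open>
  The edge joining the two end boxes is revealed first; the hop counts inside the boxes are
  independent of it.
\<close>

lemma mean_hops_shortcut:
  assumes bx: "node_box d N Q" "node_box d N B" "node_box d N B'" "B \<subseteq> Q" "B' \<subseteq> Q" "B \<inter> B' = {}" "x \<in> B" "y \<in> B'"
    and h: "\<And>E. hops d N Q E x y \<le> h E" "\<And>E. h (E - cross B B') = h E"
    and m: "\<And>u. u \<in> B \<Longrightarrow> measure_pmf.expectation (lrp_graph d \<beta> s N) (\<lambda>E. hops d N B E x u) \<le> m"
    and m': "\<And>v. v \<in> B' \<Longrightarrow> measure_pmf.expectation (lrp_graph d \<beta> s N) (\<lambda>E. hops d N B' E v y) \<le> m"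
    and r: "measure_pmf.prob (lrp_graph d \<beta> s N) {E. E \<inter> cross B B' = {}} = r"
  shows "measure_pmf.expectation (lrp_graph d \<beta> s N) (\<lambda>E. hops d N Q E x y) \<le>
    r * measure_pmf.expectation (lrp_graph d \<beta> s N) h + (1 - r) * (2 * m)"
proof -
  let ?E = "measure_pmf.expectation (lrp_graph d \<beta> s N)"
  define X where "X = cross B B'"
  define S where "S = {E. E \<inter> X = {}}"
  define W where "W = B \<times> B'"
  \<comment> \<open>The joining edge is selected from \<open>E \<inter> X\<close> alone. Hence
    \<open>H w\<close>, the event that the selected pair is \<open>w\<close>, depends only on edges
    in \<open>X\<close> and is independent of hop counts inside the two boxes.\<close>
  define pick where "pick E = (SOME w. w \<in> W \<and> {fst w, snd w} \<in> E)" for E :: "(nat \<Rightarrow> int) set set"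
  define H where "H w = {E. E \<notin> S \<and> pick (E \<inter> X) = w}" for w
  have fin: "finite W" using bx(2,3) by (auto simp: W_def node_box_def)
  have pick: "pick (E \<inter> X) \<in> W" "{fst (pick (E \<inter> X)), snd (pick (E \<inter> X))} \<in> E \<inter> X" if "E \<notin> S" for E
  proof -
    have "\<exists>w. w \<in> W \<and> {fst w, snd w} \<in> E \<inter> X"
      using that by (fastforce simp: S_def X_def cross_def W_def)
    then have "pick (E \<inter> X) \<in> W \<and> {fst (pick (E \<inter> X)), snd (pick (E \<inter> X))} \<in> E \<inter> X"
      unfolding pick_def by (rule someI_ex)
    then show "pick (E \<inter> X) \<in> W" "{fst (pick (E \<inter> X)), snd (pick (E \<inter> X))} \<in> E \<inter> X" by auto
  qed
  have sumH: "(\<Sum>w\<in>W. indicator (H w) E * t w) = (if E \<in> S then 0 else t (pick (E \<inter> X)))" for E and t :: "_ \<Rightarrow> real"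
  proof (cases "E \<in> S")
    case True
    then show ?thesis by (simp add: H_def)
  next
    case False
    then have "(\<Sum>w\<in>W. indicator (H w) E * t w) = (\<Sum>w\<in>W. if w = pick (E \<inter> X) then t w else 0)"
      by (intro sum.cong) (auto simp: H_def)
    then show ?thesis using False pick(1)[OF False] fin by simp
  qed
  have "?E (\<lambda>E. hops d N Q E x y) \<le> ?E (\<lambda>E. indicator S E * h E +
      (\<Sum>w\<in>W. indicator (H w) E * (hops d N B E x (fst w) + hops d N B' E (snd w) y)))"
  proof (rule expectation_lrp_mono)
    fix E
    show "hops d N Q E x y \<le> indicator S E * h E +
      (\<Sum>w\<in>W. indicator (H w) E * (hops d N B E x (fst w) + hops d N B' E (snd w) y))"
    proof (cases "E \<in> S")
      case True
      then show ?thesis unfolding sumH using h(1) by simp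
    next
      case False
      have "hops d N Q E x y \<le> hops d N B E x (fst (pick (E \<inter> X))) + hops d N B' E (snd (pick (E \<inter> X))) y"
        using pick[OF False] bx by (intro hops_join) (auto simp: W_def)
      then show ?thesis unfolding sumH using False by simp
    qed
  qed
  also have "\<dots> = ?E (\<lambda>E. indicator S E * h E) +
      (\<Sum>w\<in>W. ?E (\<lambda>E. indicator (H w) E * (hops d N B E x (fst w) + hops d N B' E (snd w) y)))"
    by (simp add: expectation_lrp_sum)
  also have "?E (\<lambda>E. indicator S E * h E) = ?E (indicator S) * ?E h"
    using h(2) by (intro expectation_lrp_mult[of X "- X"])
      (auto simp: S_def indicator_def X_def Diff_eq[symmetric])
  also have "?E (indicator S) = r" using r by (simp add: S_def X_def)
  also have "(\<Sum>w\<in>W. ?E (\<lambda>E. indicator (H w) E * (hops d N B E x (fst w) + hops d N B' E (snd w) y))) \<le>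
      (\<Sum>w\<in>W. ?E (indicator (H w)) * (2 * m))"
  proof (rule sum_mono)
    fix w assume w: "w \<in> W"
    have HX: "indicator (H w) (E \<inter> X) = (indicator (H w) E :: real)" for E
      by (simp add: H_def S_def indicator_def)
    have disj: "X \<inter> inner_pairs B = {}" "X \<inter> inner_pairs B' = {}"
      using bx(6) by (auto simp: X_def cross_def inner_pairs_def)
    have "?E (\<lambda>E. indicator (H w) E * (hops d N B E x (fst w) + hops d N B' E (snd w) y)) =
      ?E (\<lambda>E. indicator (H w) E * hops d N B E x (fst w)) + ?E (\<lambda>E. indicator (H w) E * hops d N B' E (snd w) y)"
      by (simp add: distrib_left)
    also have "?E (\<lambda>E. indicator (H w) E * hops d N B E x (fst w)) = ?E (indicator (H w)) * ?E (\<lambda>E. hops d N B E x (fst w))"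
      by (rule expectation_lrp_mult[where f = "indicator (H w)" and g = "\<lambda>E. hops d N B E x (fst w)", OF disj(1) HX hops_inner])
    also have "?E (\<lambda>E. indicator (H w) E * hops d N B' E (snd w) y) = ?E (indicator (H w)) * ?E (\<lambda>E. hops d N B' E (snd w) y)"
      by (rule expectation_lrp_mult[where f = "indicator (H w)" and g = "\<lambda>E. hops d N B' E (snd w) y", OF disj(2) HX hops_inner])
    also have "?E (indicator (H w)) * ?E (\<lambda>E. hops d N B E x (fst w)) + ?E (indicator (H w)) * ?E (\<lambda>E. hops d N B' E (snd w) y)
      \<le> ?E (indicator (H w)) * m + ?E (indicator (H w)) * m"
      using w m m' by (intro add_mono mult_left_mono) (auto simp: W_def)
    finally show "?E (\<lambda>E. indicator (H w) E * (hops d N B E x (fst w) + hops d N B' E (snd w) y)) \<le> ?E (indicator (H w)) * (2 * m)"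
      by (simp add: algebra_simps)
  qed
  also have "\<dots> = (1 - r) * (2 * m)"
  proof -
    have "(\<Sum>w\<in>W. ?E (indicator (H w))) = (?E (\<lambda>E. \<Sum>w\<in>W. indicator (H w) E) :: real)"
      by (subst expectation_lrp_sum) (rule refl)
    also have "\<dots> = ?E (indicator (- S))"
      using sumH[of _ "\<lambda>_. 1"] by (intro Bochner_Integration.integral_cong refl) (auto simp: indicator_def)
    also have "\<dots> = 1 - r"
      using measure_pmf.prob_compl[of S "lrp_graph d \<beta> s N"] r by (simp add: S_def X_def Compl_eq_Diff_UNIV)
    finally show ?thesis by (simp add: sum_distrib_right[symmetric])
  qed
  finally show ?thesis by simp
qed

text \<open>
  A segment meeting at most \<open>2 * d\<close> boxes of its row costs at most \<open>2 * d * A\<close>; a longer one costs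
  \<open>2 * d * A\<close> if an edge joins its end boxes (a path inside a box is made of \<open>d\<close> axis segments), and at
  most \<open>M * A\<close> otherwise.
\<close>

lemma axis_hops_le_step:
  fixes d N k M :: nat and \<beta> A :: real
  assumes "\<beta> > 0" "d \<ge> 1" "k \<ge> 1" "2 * d < M" "A \<ge> 0" and IH: "axis_hops_le d N \<beta> (2 * real d) k A"
  defines "p0 \<equiv> 1 - exp (- \<beta> / real (d * M) ^ (2 * d))"
  shows "axis_hops_le d N \<beta> (2 * real d) (M * k) ((p0 * (2 * real d) + (1 - p0) * real M) * A)"
proof -
  let ?E = "measure_pmf.expectation (lrp_graph d \<beta> (2 * real d) N)"
  let ?\<rho> = "p0 * (2 * real d) + (1 - p0) * real M"
  have p0: "0 \<le> p0" "p0 \<le> 1" using assms(1) by (auto simp: p0_def)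
  have dM: "2 * real d \<le> real M" using assms(4) by simp
  have oriented: "?E (\<lambda>E. hops d N (lbox d c (M * k)) E x y) \<le> ?\<rho> * A"
    if Q: "lbox d c (M * k) \<subseteq> lrp_nodes d N" "x \<in> lbox d c (M * k)" "y \<in> lbox d c (M * k)"
      and i: "i < d" "\<And>j. j \<noteq> i \<Longrightarrow> x j = y j" "x i \<le> y i" for c x y i
  proof -
    let ?Q = "lbox d c (M * k)"
    \<comment> \<open>Across the axis the row is shifted so that it contains \<open>x\<close> and
      stays inside the large box; along the axis it starts at the face of that box, so its
      \<open>M\<close> boxes tile the full length.\<close>
    define a where "a = (\<lambda>j. min (x j) (c j + int (M * k) - int k))(i := c i)"
    let ?R = "row_box d a i k"
    define p where "p = nat ((x i - c i) div int k)"
    define q where "q = nat ((y i - c i) div int k)"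
    have k: "int k > 0" using assms(3) by simp
    have xi: "c i \<le> x i" "x i < c i + int (M * k)" using lbox_coord[OF Q(2) i(1)] by auto
    have yi: "c i \<le> y i" "y i < c i + int (M * k)" using lbox_coord[OF Q(3) i(1)] by auto
    have div_bounds: "c i + int (nat ((z - c i) div int k) * k) \<le> z" "z < c i + int (Suc (nat ((z - c i) div int k)) * k)"
      if "c i \<le> z" for z
    proof -
      have e: "int (nat ((z - c i) div int k)) = (z - c i) div int k"
        using that k by (simp add: pos_imp_zdiv_nonneg_iff)
      have "(z - c i) div int k * int k \<le> z - c i" "z - c i < (z - c i) div int k * int k + int k"
        using div_mult_mod_eq[of "z - c i" "int k"] pos_mod_sign[OF k, of "z - c i"] pos_mod_bound[OF k, of "z - c i"]
        by linarith+
      then show "c i + int (nat ((z - c i) div int k) * k) \<le> z" "z < c i + int (Suc (nat ((z - c i) div int k)) * k)"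
        unfolding of_nat_mult of_nat_Suc e distrib_right by linarith+
    qed
    have ai: "a i = c i" by (simp add: a_def)
    have p: "a i + int (p * k) \<le> x i" "x i < a i + int (Suc p * k)"
      unfolding p_def ai by (rule div_bounds[OF xi(1)])+
    have q: "a i + int (q * k) \<le> y i" "y i < a i + int (Suc q * k)"
      unfolding q_def ai by (rule div_bounds[OF yi(1)])+
    have pq: "p \<le> q" unfolding p_def q_def using i(3) k by (intro nat_mono zdiv_mono1) auto
    have qM: "q < M"
    proof -
      have "int (q * k) < int (M * k)" using q(1) yi(2) unfolding ai by linarith
      then have "q * k < M * k" by (simp only: of_nat_less_iff)
      then show ?thesis by simp
    qed
    have Mk: "int k \<le> int (M * k)" using assms(4) by (simp del: of_nat_mult)
    have sub: "?R l \<subseteq> ?Q" if "l < M" for l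
      unfolding row_box_def
    proof (rule lbox_subsetI)
      fix j assume j: "j < d"
      have "int (l * k) + int k \<le> int (M * k)"
      proof -
        have "Suc l * k \<le> M * k" using that by (intro mult_right_mono) auto
        then have "int (Suc l * k) \<le> int (M * k)" by (simp only: of_nat_le_iff)
        then show ?thesis by simp
      qed
      then show "c j \<le> (a(i := a i + int (l * k))) j \<and> (a(i := a i + int (l * k))) j + int k \<le> c j + int (M * k)"
        using lbox_coord[OF Q(2) j] Mk by (auto simp: a_def)
    qed
    have win: "a j \<le> x j \<and> x j < a j + int k" if "j < d" "j \<noteq> i" for j
      using lbox_coord[OF Q(2) that(1)] that(2) k by (auto simp: a_def)
    have nbQ: "node_box d N ?Q" by (rule node_box_lbox[OF Q(1)])
    have xy: "x(i := x i) = x" "x(i := y i) = y" using i(2) by (auto simp: fun_eq_iff)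
    define f where "f = (\<lambda>l. x(i := max (x i) (a i + int (l * k))))"
    define g where "g = (\<lambda>l. x(i := min (y i) (a i + int (Suc l * k) - 1)))"
    have row: "(\<forall>l\<in>{p..q}. f l \<in> ?R l \<and> g l \<in> ?R l) \<and> f p = x(i := x i) \<and> g q = x(i := y i) \<and>
      (\<forall>E. hops d N ?Q E (x(i := x i)) (x(i := y i)) \<le> (\<Sum>l=p..q. hops d N (?R l) E (f l) (g l)))"
      unfolding f_def g_def
      using sub qM by (intro hops_row[OF i(1) lbox_extensional[OF Q(2)] win pq p q i(3) nbQ]) auto
    then have R: "\<And>l. l \<in> {p..q} \<Longrightarrow> f l \<in> ?R l \<and> g l \<in> ?R l"
      "\<And>E. hops d N ?Q E x y \<le> (\<Sum>l=p..q. hops d N (?R l) E (f l) (g l))" "f p = x" "g q = y"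
      unfolding xy by auto
    let ?h = "\<lambda>E. \<Sum>l=p..q. hops d N (?R l) E (f l) (g l)"
    have Rsub: "?R l \<subseteq> lrp_nodes d N" if "l \<le> q" for l using sub[of l] qM that Q(1) by auto
    have Eh: "?E ?h \<le> real (Suc q - p) * A"
    proof -
      have "?E ?h = (\<Sum>l=p..q. ?E (\<lambda>E. hops d N (?R l) E (f l) (g l)))" by (rule expectation_lrp_sum)
      also have "\<dots> \<le> (\<Sum>l=p..q. A)"
      proof (rule sum_mono)
        fix l assume l: "l \<in> {p..q}"
        have "\<forall>j. j \<noteq> i \<longrightarrow> f l j = g l j" by (simp add: f_def g_def)
        then show "?E (\<lambda>E. hops d N (?R l) E (f l) (g l)) \<le> A"
          using IH R(1)[OF l] Rsub[of l] l i(1) unfolding axis_hops_le_def row_box_def by auto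
      qed
      finally show ?thesis by simp
    qed
    show ?thesis
    proof (cases "Suc q - p \<le> 2 * d")
      case True
      have "?E (\<lambda>E. hops d N ?Q E x y) \<le> ?E ?h" by (rule expectation_lrp_mono) (rule R(2))
      also have "\<dots> \<le> real (Suc q - p) * A" by (rule Eh)
      also have "\<dots> \<le> ?\<rho> * A"
      proof (rule mult_right_mono[OF _ assms(5)])
        have "real (Suc q - p) \<le> p0 * (2 * real d) + (1 - p0) * (2 * real d)"
          using True by (simp add: algebra_simps flip: of_nat_mult)
        also have "\<dots> \<le> ?\<rho>" using p0 dM by (intro add_left_mono mult_left_mono) auto
        finally show "real (Suc q - p) \<le> ?\<rho>" .
      qed
      finally show ?thesis .
    next
      case False
      then have pq': "p < q" using assms(2) by auto
      define r where "r = measure_pmf.prob (lrp_graph d \<beta> (2 * real d) N) {E. E \<inter> cross (?R p) (?R q) = {}}"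
      have "r \<le> exp (- \<beta> * real (card (?R p)) * real (card (?R q)) / real (d * (M * k)) powr (2 * real d))"
        unfolding r_def using assms(1,2) Rsub[of p] Rsub[of q] pq row_box_disjoint[OF i(1) pq'] sub[of p] sub[of q] qM
        by (intro prob_no_edge_between ldist_box_le[where c = c]) auto
      \<comment> \<open>Scale invariance at s = 2d: the side \<open>k\<close> cancels, so the chance
        of a shortcut has the same lower bound at all scales.\<close>
      also have "- \<beta> * real (card (?R p)) * real (card (?R q)) / real (d * (M * k)) powr (2 * real d) = - \<beta> / real (d * M) ^ (2 * d)"
      proof -
        have pos: "0 < d * (M * k)" using assms(2-4) by simp
        then have "0 < real (d * (M * k))" by (simp only: of_nat_0_less_iff)
        then have "real (d * (M * k)) powr real (2 * d) = real (d * (M * k)) ^ (2 * d)"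
          by (rule powr_realpow)
        moreover have "real (2 * d) = 2 * real d" by simp
        ultimately have "real (d * (M * k)) powr (2 * real d) = real (d * (M * k)) ^ (2 * d)"
          by (simp only:)
        also have "\<dots> = real (d * M) ^ (2 * d) * real k ^ (2 * d)"
          by (simp add: power_mult_distrib)
        also have "real k ^ (2 * d) = real k ^ d * real k ^ d"
          by (simp only: mult_2 power_add)
        finally show ?thesis using assms(3) by (simp add: row_box_def card_lbox)
      qed
      finally have r: "0 \<le> r" "r \<le> 1 - p0" by (auto simp: r_def p0_def)
      have "?E (\<lambda>E. hops d N ?Q E x y) \<le> r * ?E ?h + (1 - r) * (2 * (real d * A))"
      proof (rule mean_hops_shortcut[where B = "?R p" and B' = "?R q"])
        show "node_box d N (?R p)" "node_box d N (?R q)"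
          using Rsub[of p] Rsub[of q] pq unfolding row_box_def by (auto intro: node_box_lbox)
        show "?R p \<inter> ?R q = {}" by (rule row_box_disjoint[OF i(1) pq'])
        show "x \<in> ?R p" "y \<in> ?R q" using R(1)[of p] R(1)[of q] R(3,4) pq by auto
        then show "?E (\<lambda>E. hops d N (?R p) E x u) \<le> real d * A" if "u \<in> ?R p" for u
          using that Rsub[of p] pq assms(2) unfolding row_box_def by (intro mean_hops_le[OF IH])
        show "?E (\<lambda>E. hops d N (?R q) E v y) \<le> real d * A" if "v \<in> ?R q" for v
          using that \<open>y \<in> ?R q\<close> Rsub[of q] assms(2) unfolding row_box_def by (intro mean_hops_le[OF IH]) auto
        show "?h (E - cross (?R p) (?R q)) = ?h E" for E
        proof (intro sum.cong refl)
          fix l assume l: "l \<in> {p..q}"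
          have "inner_pairs (?R l) \<inter> cross (?R p) (?R q) = {}"
          proof (rule ccontr)
            assume "inner_pairs (?R l) \<inter> cross (?R p) (?R q) \<noteq> {}"
            then obtain u v where "u \<in> ?R p" "v \<in> ?R q" "u \<in> ?R l" "v \<in> ?R l"
              by (auto simp: inner_pairs_def cross_def)
            then have "p = l" "q = l"
              using row_box_disjoint[OF i(1), of p l a k] row_box_disjoint[OF i(1), of l q a k] l
              by (metis atLeastAtMost_iff disjoint_iff le_neq_implies_less)+
            then show False using pq' by simp
          qed
          then have "(E - cross (?R p) (?R q)) \<inter> inner_pairs (?R l) = E \<inter> inner_pairs (?R l)" by blast
          then show "hops d N (?R l) (E - cross (?R p) (?R q)) (f l) (g l) = hops d N (?R l) E (f l) (g l)"
            by (metis hops_inner)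
        qed
        show "measure_pmf.prob (lrp_graph d \<beta> (2 * real d) N) {E. E \<inter> cross (?R p) (?R q) = {}} = r"
          by (simp add: r_def)
      qed (use nbQ sub qM pq R(2) in auto)
      also have "\<dots> \<le> r * (real M * A) + (1 - r) * (2 * (real d * A))"
      proof (intro add_right_mono mult_left_mono)
        have "real (Suc q - p) * A \<le> real M * A" using qM assms(5) by (intro mult_right_mono) auto
        then show "?E ?h \<le> real M * A" using Eh by linarith
      qed (use r in auto)
      also have "\<dots> = (2 * real d + r * (real M - 2 * real d)) * A" by (simp add: algebra_simps)
      \<comment> \<open>The bound increases with \<open>r\<close> because \<open>2 * d < M\<close>,
        so \<open>r\<close> may be replaced by its upper bound \<open>1 - p0\<close>.\<close>
      also have "\<dots> \<le> (2 * real d + (1 - p0) * (real M - 2 * real d)) * A"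
        using r dM assms(5) by (intro mult_right_mono add_left_mono) auto
      also have "\<dots> = ?\<rho> * A" by (simp add: algebra_simps)
      finally show ?thesis .
    qed
  qed
  show ?thesis unfolding axis_hops_le_def
  proof (intro allI impI)
    fix c x y i
    assume *: "lbox d c (M * k) \<subseteq> lrp_nodes d N" "x \<in> lbox d c (M * k)" "y \<in> lbox d c (M * k)" "i < d" "\<forall>j. j \<noteq> i \<longrightarrow> x j = y j"
    show "?E (\<lambda>E. hops d N (lbox d c (M * k)) E x y) \<le> ?\<rho> * A"
    proof (cases "x i \<le> y i")
      case True
      then show ?thesis using * by (intro oriented) auto
    next
      case False
      then have "?E (\<lambda>E. hops d N (lbox d c (M * k)) E y x) \<le> ?\<rho> * A"
        using * by (intro oriented[of c y x i]) auto
      then show ?thesis by (simp add: hops_commute)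
    qed
  qed
qed

lemma axis_hops_le_power:
  fixes d N M n :: nat and \<beta> :: real
  assumes "\<beta> > 0" "d \<ge> 1" "2 * d < M"
  defines "p0 \<equiv> 1 - exp (- \<beta> / real (d * M) ^ (2 * d))"
  shows "axis_hops_le d N \<beta> (2 * real d) (M ^ n) ((p0 * (2 * real d) + (1 - p0) * real M) ^ n)"
proof (induction n)
  case 0
  show ?case unfolding axis_hops_le_def
  proof (intro allI impI)
    fix c x y i
    assume *: "lbox d c (M ^ 0) \<subseteq> lrp_nodes d N" "x \<in> lbox d c (M ^ 0)" "y \<in> lbox d c (M ^ 0)"
    have "x j = y j" if "j < d" for j
      using lbox_coord[OF *(2) that] lbox_coord[OF *(3) that] by simp
    then have "x = y" using lbox_ext[OF *(2,3)] by blast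
    then have "hops d N (lbox d c (M ^ 0)) E x y \<le> 1" for E
      using hops_le_ldist[OF node_box_lbox[OF *(1)] *(2,3), of E] by simp
    then have "measure_pmf.expectation (lrp_graph d \<beta> (2 * real d) N) (\<lambda>E. hops d N (lbox d c (M ^ 0)) E x y)
        \<le> measure_pmf.expectation (lrp_graph d \<beta> (2 * real d) N) (\<lambda>_. 1)"
      by (intro expectation_lrp_mono)
    then show "measure_pmf.expectation (lrp_graph d \<beta> (2 * real d) N) (\<lambda>E. hops d N (lbox d c (M ^ 0)) E x y)
        \<le> (p0 * (2 * real d) + (1 - p0) * real M) ^ 0" by simp
  qed
next
  case (Suc n)
  have "0 \<le> p0" "p0 \<le> 1" using assms(1) by (auto simp: p0_def)
  then have "0 \<le> (p0 * (2 * real d) + (1 - p0) * real M) ^ n"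
    by (intro zero_le_power add_nonneg_nonneg mult_nonneg_nonneg) auto
  moreover have "1 \<le> M ^ n" using assms(3) by simp
  ultimately show ?case
    unfolding power_Suc p0_def
    by (intro axis_hops_le_step assms(1-3)) (use Suc in \<open>simp_all add: p0_def\<close>)
qed

section \<open>Concentration of the hop count along an axis\<close>

text \<open>The convex function 2^z agrees with 1 + z at both ends of the interval.\<close>

lemma two_powr_le:
  fixes z :: real
  assumes "0 \<le> z" "z \<le> 1"
  shows "2 powr z \<le> 1 + z"
  using Youngs_inequality_0[of z "1 - z" 2 1] assms by simp

text \<open>Hop counts in disjoint boxes are independent. Divided by \<open>k\<close> they lie
  between 0 and 1, so each factor has mean at most 1 + A/k \<le> exp (A/k).\<close>

lemma expectation_prod_hops_le:
  fixes k A :: real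
  assumes "\<And>l. l < t \<Longrightarrow> node_box d N (B l) \<and> x l \<in> B l \<and> y l \<in> B l"
    and disj: "\<And>l m. l < m \<Longrightarrow> m < t \<Longrightarrow> B l \<inter> B m = {}"
    and k: "k > 0" "\<And>l E. l < t \<Longrightarrow> hops d N (B l) E (x l) (y l) \<le> k"
    and A: "\<And>l. l < t \<Longrightarrow> measure_pmf.expectation (lrp_graph d \<beta> s N) (\<lambda>E. hops d N (B l) E (x l) (y l)) \<le> A"
  shows "measure_pmf.expectation (lrp_graph d \<beta> s N)
    (\<lambda>E. \<Prod>l<t. 2 powr (hops d N (B l) E (x l) (y l) / k)) \<le> exp (real t * A / k)"
  using assms(1,2,4,5)
proof (induction t)
  case (Suc t)
  let ?E = "measure_pmf.expectation (lrp_graph d \<beta> s N)"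
  let ?\<phi> = "\<lambda>l E. 2 powr (hops d N (B l) E (x l) (y l) / k)"
  have "?E (\<lambda>E. \<Prod>l<Suc t. ?\<phi> l E) = ?E (\<lambda>E. (\<Prod>l<t. ?\<phi> l E) * ?\<phi> t E)"
    by simp
  also have "\<dots> = ?E (\<lambda>E. \<Prod>l<t. ?\<phi> l E) * ?E (?\<phi> t)"
  proof (rule expectation_lrp_mult)
    show "(\<Union>l<t. inner_pairs (B l)) \<inter> inner_pairs (B t) = {}"
      using Suc.prems(2) by (fastforce simp: inner_pairs_def)
    fix E
    show "(\<Prod>l<t. ?\<phi> l (E \<inter> (\<Union>l<t. inner_pairs (B l)))) = (\<Prod>l<t. ?\<phi> l E)"
    proof (intro prod.cong refl)
      fix l assume "l \<in> {..<t}"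
      then have "E \<inter> (\<Union>l<t. inner_pairs (B l)) \<inter> inner_pairs (B l) = E \<inter> inner_pairs (B l)" by blast
      then show "?\<phi> l (E \<inter> (\<Union>l<t. inner_pairs (B l))) = ?\<phi> l E" by (metis hops_inner)
    qed
    show "?\<phi> t (E \<inter> inner_pairs (B t)) = ?\<phi> t E" by (simp add: hops_inner)
  qed
  also have "\<dots> \<le> exp (real t * A / k) * exp (A / k)"
  proof (intro mult_mono)
    show "?E (\<lambda>E. \<Prod>l<t. ?\<phi> l E) \<le> exp (real t * A / k)"
      using Suc.prems by (intro Suc.IH) auto
    have "?E (?\<phi> t) \<le> ?E (\<lambda>E. 1 + hops d N (B t) E (x t) (y t) / k)"
    proof (rule expectation_lrp_mono)
      fix E
      have "0 \<le> hops d N (B t) E (x t) (y t)" using hops_ge_1[of d N "B t" E "x t" "y t"] by linarith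
      then show "?\<phi> t E \<le> 1 + hops d N (B t) E (x t) (y t) / k"
        using Suc.prems(3)[of t E] k(1) by (intro two_powr_le) auto
    qed
    also have "\<dots> = 1 + ?E (\<lambda>E. hops d N (B t) E (x t) (y t)) / k"
      by simp
    also have "\<dots> \<le> 1 + A / k"
      using Suc.prems(4)[of t] k(1) by (intro add_left_mono divide_right_mono) auto
    also have "\<dots> \<le> exp (A / k)" by (rule exp_ge_add_one_self)
    finally show "?E (?\<phi> t) \<le> exp (A / k)" .
  qed (auto intro!: Bochner_Integration.integral_nonneg)
  also have "\<dots> = exp (real (Suc t) * A / k)"
    by (simp add: exp_add[symmetric] add_divide_distrib algebra_simps)
  finally show ?case .
qed simp

text \<open>A Chernoff bound for the at most N/k full boxes of a row that starts at
  \<open>x\<close>. The remaining incomplete piece costs at most \<open>k\<close> hops, which is the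
  1 in \<open>1 + a\<close>.\<close>

lemma prob_axis_hops_gt:
  fixes d N k :: nat and \<beta> s A a :: real
  assumes "axis_hops_le d N \<beta> s k A" "A \<ge> 0" "1 \<le> k" "k \<le> Suc N" "d \<ge> 1"
    and xy: "x \<in> lrp_nodes d N" "y \<in> lrp_nodes d N" "i < d" "\<And>j. j \<noteq> i \<Longrightarrow> x j = y j" "x i \<le> y i"
  shows "measure_pmf.prob (lrp_graph d \<beta> s N) {E. real k * (1 + a) < hops d N (lrp_nodes d N) E x y}
    \<le> exp (real N * A / (real k)\<^sup>2) / 2 powr a"
proof -
  let ?M = "lrp_graph d \<beta> s N" and ?V = "lrp_nodes d N"
  define t where "t = nat ((y i - x i) div int k)"
  have k: "int k > 0" using assms(3) by simp
  have e: "int t = (y i - x i) div int k"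
    unfolding t_def using k xy(5) by (simp add: pos_imp_zdiv_nonneg_iff)
  have tk: "int t * int k \<le> y i - x i" "y i - x i < int t * int k + int k"
    unfolding e using div_mult_mod_eq[of "y i - x i" "int k"] pos_mod_sign[OF k, of "y i - x i"] pos_mod_bound[OF k, of "y i - x i"]
    by linarith+
  have xi: "0 \<le> x i" and yi: "y i \<le> int N" using lrp_nodes_coord xy by auto
  have tN: "t * k \<le> N"
  proof -
    have "int (t * k) \<le> int N" using tk(1) xi yi by simp
    then show ?thesis by (simp only: of_nat_le_iff)
  qed
  define a' where "a' = (\<lambda>j. min (x j) (int (Suc N) - int k))(i := x i)"
  let ?R = "row_box d a' i k"
  have a'i: "a' i = x i" by (simp add: a'_def)
  have ext: "x \<in> extensional {..<d}" using xy(1) by (simp add: lrp_nodes_def PiE_def)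
  have win: "a' j \<le> x j \<and> x j < a' j + int k" if "j < d" "j \<noteq> i" for j
    using lrp_nodes_coord[OF xy(1) that(1)] that(2) k by (auto simp: a'_def)
  have sub: "?R l \<subseteq> ?V" if "l < t" for l
    unfolding row_box_def lrp_nodes_eq_lbox
  proof (rule lbox_subsetI)
    fix j assume j: "j < d"
    have "Suc l * k \<le> t * k" using that by (intro mult_right_mono) auto
    then have "int (Suc l * k) \<le> int (t * k)" by (simp only: of_nat_le_iff)
    then have "x i + int (l * k) + int k \<le> y i" using tk(1) by simp
    then show "0 \<le> (a'(i := a' i + int (l * k))) j \<and> (a'(i := a' i + int (l * k))) j + int k \<le> 0 + int (Suc N)"
      using lrp_nodes_coord[OF xy(1) j] assms(4) xi yi by (auto simp: a'_def)
  qed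
  have nbV: "node_box d N ?V" by (rule node_box_nodes)
  have xyi: "x(i := x i) = x" "x(i := y i) = y" using xy(4) by (auto simp: fun_eq_iff)
  have inV: "x(i := z) \<in> ?V" if "x i \<le> z" "z \<le> y i" for z
    unfolding lrp_nodes_eq_lbox
  proof (rule lboxI)
    show "x(i := z) \<in> extensional {..<d}" using ext xy(3) by (auto simp: extensional_def)
    fix j assume j: "j < d"
    show "0 \<le> (x(i := z)) j \<and> (x(i := z)) j < 0 + int (Suc N)"
      using lrp_nodes_coord[OF xy(1) j] xi yi that by auto
  qed
  \<comment> \<open>The first point behind the \<open>t\<close> full boxes, less than
    \<open>k\<close> away from \<open>y\<close>. For \<open>t = 0\<close> it is
    \<open>x\<close>.\<close>
  define w where "w = x(i := x i + int t * int k)"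
  have wV: "w \<in> ?V" unfolding w_def using tk k by (intro inV) auto
  have tail: "hops d N ?V E w y \<le> real k" for E
  proof -
    have "int (ldist d w y) = int (ldist d x y) - \<bar>x i - y i\<bar> + \<bar>x i + int t * int k - y i\<bar>"
      unfolding w_def by (rule ldist_fun_upd[OF xy(3)])
    moreover have "int (ldist d x y) = \<bar>x i - y i\<bar>"
      using ldist_fun_upd[OF xy(3), of x "y i" y] unfolding xyi by simp
    ultimately have "int (ldist d w y) < int k" using tk by linarith
    then show ?thesis using hops_le_ldist[OF nbV wV xy(2), of E] by simp
  qed
  show ?thesis
  proof (cases "t = 0")
    case True
    then have "w = x" using xyi by (simp add: w_def)
    then have le: "hops d N ?V E x y \<le> real k" for E using tail by simp
    show ?thesis
    proof (cases "a \<ge> 0")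
      case True
      have "real k \<le> real k * (1 + a)" using True by (simp add: algebra_simps)
      then have "{E. real k * (1 + a) < hops d N ?V E x y} = {}" using le by (auto simp: not_less intro: order_trans)
      then show ?thesis by simp
    next
      case False
      \<comment> \<open>For negative \<open>a\<close> the right-hand side is at least 1 and nothing
        has to be shown.\<close>
      have "2 powr a \<le> 2 powr 0" using False by (intro powr_mono) auto
      then have "1 \<le> 1 / 2 powr a" by simp
      also have "\<dots> \<le> exp (real N * A / (real k)\<^sup>2) / 2 powr a"
        using assms(2) by (intro divide_right_mono) auto
      finally show ?thesis using measure_pmf.prob_le_1 order_trans by blast
    qed
  next
    case False
    define f where "f = (\<lambda>l. x(i := max (x i) (a' i + int (l * k))))"
    define g where "g = (\<lambda>l. x(i := min (x i + int t * int k - 1) (a' i + int (Suc l * k) - 1)))"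
    have st: "Suc (t - 1) = t" using False by simp
    have "(\<forall>l\<in>{0..t - 1}. f l \<in> ?R l \<and> g l \<in> ?R l) \<and> f 0 = x(i := x i) \<and> g (t - 1) = x(i := x i + int t * int k - 1) \<and>
      (\<forall>E. hops d N ?V E (x(i := x i)) (x(i := x i + int t * int k - 1)) \<le> (\<Sum>l=0..t - 1. hops d N (?R l) E (f l) (g l)))"
      unfolding f_def g_def
    proof (rule hops_row[OF xy(3) ext win _ _ _ _ _ _ nbV])
      show "a' i + int ((t - 1) * k) \<le> x i + int t * int k - 1"
      proof -
        have "int t * int k = int (Suc (t - 1) * k)" unfolding st by simp
        then show ?thesis using k by (simp add: a'i del: Suc_pred)
      qed
      show "x i + int t * int k - 1 < a' i + int (Suc (t - 1) * k)" unfolding st by (simp add: a'i)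
      have "1 * 1 \<le> int t * int k" using False k by (intro mult_mono) auto
      then show "x i \<le> x i + int t * int k - 1" by simp
      show "\<And>l. l \<le> t - 1 \<Longrightarrow> ?R l \<subseteq> ?V" using sub False by simp
    qed (use a'i k in auto)
    moreover have "{0..t - 1} = {..<t}" using False by auto
    ultimately have R: "\<And>l. l < t \<Longrightarrow> f l \<in> ?R l \<and> g l \<in> ?R l"
      "\<And>E. hops d N ?V E x (x(i := x i + int t * int k - 1)) \<le> (\<Sum>l<t. hops d N (?R l) E (f l) (g l))"
      unfolding xyi by auto
    have t1: "1 \<le> int t * int k"
    proof -
      have "1 * 1 \<le> int t * int k" using False k by (intro mult_mono) auto
      then show ?thesis by simp
    qed
    have prev: "x(i := x i + int t * int k - 1) \<in> ?V" using tk t1 by (intro inV) auto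
    have total: "hops d N ?V E x y \<le> (\<Sum>l<t. hops d N (?R l) E (f l) (g l)) + real k" for E
    proof -
      have "{x(i := x i + int t * int k - 1), x(i := (x i + int t * int k - 1) + 1)} \<in> unit_pairs d N"
        using prev wV by (intro unit_pair_row xy(3)) (auto simp: w_def)
      then have "{x(i := x i + int t * int k - 1), w} \<in> unit_pairs d N" by (simp add: w_def)
      then have "hops d N ?V E x y \<le> hops d N ?V E x (x(i := x i + int t * int k - 1)) + hops d N ?V E w y"
        using nbV xy prev wV by (intro hops_join) auto
      then show ?thesis using R(2)[of E] tail[of E] by linarith
    qed
    have al: "\<forall>j. j \<noteq> i \<longrightarrow> f l j = g l j" for l by (simp add: f_def g_def)
    have nb: "node_box d N (?R l)" if "l < t" for l
      using sub[OF that] unfolding row_box_def by (rule node_box_lbox)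
    have hk: "hops d N (?R l) E (f l) (g l) \<le> real k" if l: "l < t" for l E
    proof -
      have fg: "f l \<in> ?R l" "g l \<in> ?R l" using R(1)[OF l] by auto
      have "int (ldist d (f l) (g l)) = (\<Sum>j<d. \<bar>f l j - g l j\<bar>)" by (rule int_ldist)
      also have "\<dots> = \<bar>f l i - g l i\<bar>"
        using al xy(3) by (subst sum.remove[of _ i]) (auto intro!: sum.neutral)
      also have "\<dots> < int k"
        using lbox_coord[OF fg(1)[unfolded row_box_def] xy(3)] lbox_coord[OF fg(2)[unfolded row_box_def] xy(3)] by linarith
      finally have "ldist d (f l) (g l) < k" by simp
      then show ?thesis using hops_le_ldist[OF nb[OF l] fg, of E] by simp
    qed
    have hA: "measure_pmf.expectation ?M (\<lambda>E. hops d N (?R l) E (f l) (g l)) \<le> A" if "l < t" for l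
      using assms(1) R(1)[OF that] sub[OF that] al xy(3) unfolding axis_hops_le_def row_box_def by blast
    let ?\<Phi> = "\<lambda>E. \<Prod>l<t. 2 powr (hops d N (?R l) E (f l) (g l) / real k)"
    have \<Phi>: "?\<Phi> E = 2 powr ((\<Sum>l<t. hops d N (?R l) E (f l) (g l)) / real k)" for E
      by (simp add: powr_sum[symmetric] sum_divide_distrib)
    have "measure_pmf.prob ?M {E. real k * (1 + a) < hops d N ?V E x y} \<le> measure_pmf.prob ?M {E. ?\<Phi> E \<ge> 2 powr a}"
    proof (intro measure_pmf.finite_measure_mono subsetI)
      fix E assume "E \<in> {E. real k * (1 + a) < hops d N ?V E x y}"
      then have "real k * a \<le> (\<Sum>l<t. hops d N (?R l) E (f l) (g l))" using total[of E] by (simp add: algebra_simps)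
      then have "a \<le> (\<Sum>l<t. hops d N (?R l) E (f l) (g l)) / real k" using k by (simp add: pos_le_divide_eq mult.commute)
      then show "E \<in> {E. ?\<Phi> E \<ge> 2 powr a}" unfolding \<Phi> by simp
    qed simp
    also have "\<dots> \<le> measure_pmf.expectation ?M ?\<Phi> / 2 powr a"
      by (intro prob_pmf_markov) (auto intro!: prod_nonneg)
    also have "\<dots> \<le> exp (real t * A / real k) / 2 powr a"
      using nb R(1) row_box_disjoint[OF xy(3)] k hk hA
      by (intro divide_right_mono expectation_prod_hops_le) auto
    also have "\<dots> \<le> exp (real N * A / (real k)\<^sup>2) / 2 powr a"
    proof -
      have "real t * real k \<le> real N" using tN by (metis of_nat_le_iff of_nat_mult)
      then have "real t \<le> real N / real k" using k by (simp add: pos_le_divide_eq)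
      then have "real t * (A / real k) \<le> real N / real k * (A / real k)"
        using assms(2) by (intro mult_right_mono) auto
      then have "real t * A / real k \<le> real N * A / (real k)\<^sup>2" by (simp add: power2_eq_square)
      then show ?thesis by (simp add: divide_right_mono)
    qed
    finally show ?thesis .
  qed
qed

text \<open>The union bound runs only over pairs that differ in one coordinate. Any two nodes are
  connected by a chain of \<open>d\<close> such pairs, whence the factor \<open>d\<close> in the
  length.\<close>

lemma prob_diameter_gt_hops:
  fixes d N k :: nat and \<beta> s A a :: real
  assumes "axis_hops_le d N \<beta> s k A" "A \<ge> 0" "1 \<le> k" "k \<le> Suc N" "d \<ge> 1"
    and L: "real d * (real k * (1 + a)) \<le> L"
  shows "measure_pmf.prob (lrp_graph d \<beta> s N) (- {E. lrp_diameter d N E \<le> ereal L})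
    \<le> real (Suc N) ^ (2 * d) * (exp (real N * A / (real k)\<^sup>2) / 2 powr a)"
proof -
  let ?M = "lrp_graph d \<beta> s N" and ?V = "lrp_nodes d N"
  let ?p = "exp (real N * A / (real k)\<^sup>2) / 2 powr a"
  define W where "W = {z\<in>?V \<times> ?V. \<exists>i<d. \<forall>j. j \<noteq> i \<longrightarrow> fst z j = snd z j}"
  let ?B = "\<lambda>z. {E. real k * (1 + a) < hops d N ?V E (fst z) (snd z)}"
  have fin: "finite W" by (rule finite_subset[of _ "?V \<times> ?V"]) (auto simp: W_def)
  have "measure_pmf.prob ?M (- {E. lrp_diameter d N E \<le> ereal L}) \<le> measure_pmf.prob ?M (\<Union>z\<in>W. ?B z)"
  proof (rule prob_pmf_mono, rule ccontr)
    fix E assume E: "E \<in> set_pmf ?M" "E \<in> - {E. lrp_diameter d N E \<le> ereal L}" "E \<notin> (\<Union>z\<in>W. ?B z)"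
    \<comment> \<open>Graphs in the support already contain the unit edges, so the hop counts
      reflect true distances there.\<close>
    have EU: "E \<union> unit_pairs d N = E" using unit_pairs_subset[OF E(1)] by blast
    have "graph_dist ?V E x y \<le> enat (nat \<lfloor>L\<rfloor>)" if xy: "x \<in> ?V" "y \<in> ?V" for x y
    proof -
      obtain z where z: "\<forall>m\<le>d. z m \<in> ?V" "\<forall>m<d. \<forall>j. j \<noteq> m \<longrightarrow> z m j = z (Suc m) j"
        "\<forall>E. hops d N ?V E x y \<le> (\<Sum>m<d. hops d N ?V E (z m) (z (Suc m)))"
        using hops_coordinate_chain[OF node_box_nodes lrp_nodes_eq_lbox xy assms(5)] by blast
      have "hops d N ?V E (z m) (z (Suc m)) \<le> real k * (1 + a)" if "m < d" for m
      proof -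
        have "(z m, z (Suc m)) \<in> W" using z(1,2) that by (auto simp: W_def)
        then show ?thesis using E(3) by (auto simp: not_less)
      qed
      then have "(\<Sum>m<d. hops d N ?V E (z m) (z (Suc m))) \<le> (\<Sum>m<d. real k * (1 + a))"
        by (intro sum_mono) auto
      then have "hops d N ?V E x y \<le> L" using z(3)[rule_format, of E] L by simp
      moreover obtain n where "graph_dist ?V (E \<union> unit_pairs d N) x y = enat n" "hops d N ?V E x y = real n + 1"
        by (rule enat_hops[OF node_box_nodes xy])
      ultimately show ?thesis unfolding EU by (simp add: le_nat_floor)
    qed
    then have "graph_diameter ?V E \<le> enat (nat \<lfloor>L\<rfloor>)" by (simp add: graph_diameter_le_iff)
    then have "lrp_diameter d N E \<le> ereal_of_enat (enat (nat \<lfloor>L\<rfloor>))" by (simp only: ereal_of_enat_le_iff)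
    also have "\<dots> \<le> ereal L"
    proof -
      have "0 \<le> L"
      proof -
        obtain x where x: "x \<in> ?V" using lrp_nodes_corners(1) by blast
        have "0 < d" using assms(5) by simp
        then have "(x, x) \<in> W" using x by (auto simp: W_def)
        then have "hops d N ?V E x x \<le> real k * (1 + a)" using E(3) by (auto simp: not_less)
        then have "0 \<le> real k * (1 + a)" using hops_ge_1[of d N ?V E x x] by linarith
        then have "0 \<le> real d * (real k * (1 + a))" by (rule mult_nonneg_nonneg[rotated]) simp
        then show ?thesis using L by linarith
      qed
      then show ?thesis by simp
    qed
    finally show False using E(2) by simp
  qed
  also have "\<dots> \<le> (\<Sum>z\<in>W. measure_pmf.prob ?M (?B z))"
    using fin by (intro measure_pmf.finite_measure_subadditive_finite) auto
  also have "\<dots> \<le> (\<Sum>z\<in>W. ?p)"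
  proof (rule sum_mono)
    fix z assume z: "z \<in> W"
    obtain x y where xy: "z = (x, y)" by (cases z)
    have V: "x \<in> ?V" "y \<in> ?V" using z by (auto simp: W_def xy)
    obtain i where i: "i < d" "\<And>j. j \<noteq> i \<Longrightarrow> x j = y j" using z by (auto simp: W_def xy)
    show "measure_pmf.prob ?M (?B z) \<le> ?p"
    proof (cases "x i \<le> y i")
      case True
      then show ?thesis unfolding xy fst_conv snd_conv using V i by (intro prob_axis_hops_gt assms(1-5)) auto
    next
      case False
      have "measure_pmf.prob ?M {E. real k * (1 + a) < hops d N ?V E y x} \<le> ?p"
        using V i False by (intro prob_axis_hops_gt[where i = i] assms(1-5)) auto
      then show ?thesis unfolding xy fst_conv snd_conv by (simp add: hops_commute[of d N ?V _ x y])
    qed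
  qed
  also have "\<dots> = real (card W) * ?p" by simp
  also have "\<dots> \<le> real (card (?V \<times> ?V)) * ?p"
    by (intro mult_right_mono of_nat_mono card_mono) (auto simp: W_def)
  also have "real (card (?V \<times> ?V)) = real (Suc N) ^ (2 * d)"
    by (simp add: card_cartesian_product card_lrp_nodes power_add mult_2)
  finally show ?thesis .
qed

theorem diameter_le_power_critical:
  fixes d :: nat and \<beta> :: real
  assumes "\<beta> > 0" "d \<ge> 1"
  shows "\<exists>\<eta>. 0 < \<eta> \<and> \<eta> < 1 \<and> (\<lambda>N. measure_pmf.prob (lrp_graph d \<beta> (2 * real d) N)
    {E. lrp_diameter d N E \<le> ereal (real N powr \<eta>)}) \<longlonglongrightarrow> 1"
proof -
  \<comment> \<open>The least value with \<open>2 * d < M\<close>. It gives \<rho> = 2d + 1 - p0,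
    strictly below \<open>M\<close>.\<close>
  define M where "M = 2 * d + 1"
  define p0 where "p0 = 1 - exp (- \<beta> / real (d * M) ^ (2 * d))"
  define \<rho> where "\<rho> = p0 * (2 * real d) + (1 - p0) * real M"
  have "0 < d * M" using assms(2) by (simp add: M_def)
  then have "0 < real (d * M) ^ (2 * d)" by (simp only: zero_less_power of_nat_0_less_iff)
  then have p0: "0 < p0" "p0 \<le> 1" using assms(1) by (auto simp: p0_def)
  have \<rho>_eq: "\<rho> = 2 * real d + (1 - p0)" by (simp add: \<rho>_def M_def algebra_simps)
  have d1: "real d \<ge> 1" using assms(2) by simp
  have M1: "real M > 1" "real M = 2 * real d + 1" using d1 by (simp_all add: M_def)
  have \<rho>: "1 < \<rho>" "\<rho> < real M" using p0 d1 M1 unfolding \<rho>_eq by linarith+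
  \<comment> \<open>Defined by \<rho> = M^(1-\<kappa>): the mean hop count along an axis at scale k
    = M^n is then at most k^(1-\<kappa>).\<close>
  define \<kappa> where "\<kappa> = 1 - ln \<rho> / ln (real M)"
  have lM: "ln (real M) > 0" using M1 by simp
  have \<kappa>: "0 < \<kappa>" "\<kappa> < 1"
    using \<rho> M1 lM by (auto simp: \<kappa>_def pos_divide_less_eq)
  have \<rho>M: "\<rho> = real M powr (1 - \<kappa>)"
    using \<rho> M1 lM by (simp add: \<kappa>_def powr_def)
  define C where "C = real M powr \<kappa>"
  have C: "C > 0" using M1 by (simp add: C_def)
  define D where "D = real d"
  have D: "D \<ge> 1" using d1 by (simp add: D_def)
  \<comment> \<open>Has to exceed 1/2, the exponent of \<open>k\<close> up to logarithms, and 1 -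
    \<kappa>/2, the exponent of k times the mean term of the Chernoff bound.\<close>
  define \<eta> where "\<eta> = 1 - \<kappa> / 4"
  have \<eta>: "0 < \<eta>" "\<eta> < 1" "1 / 2 < \<eta>" "1 - \<kappa> / 2 < \<eta>" using \<kappa> by (auto simp: \<eta>_def)
  have "(\<lambda>N. measure_pmf.prob (lrp_graph d \<beta> (2 * real d) N)
    {E. lrp_diameter d N E \<le> ereal (real N powr \<eta>)}) \<longlonglongrightarrow> 1"
  proof (rule prob_tendsto_1I)
    show "(\<lambda>N. real (Suc N) powr (2 * D) * exp (- (ln (real N))\<^sup>2)) \<longlonglongrightarrow> 0"
      using D by real_asymp
    have "\<forall>\<^sub>F N in sequentially. D * (sqrt (real N) * (1 + 4 * (ln (real N))\<^sup>2) + 4 * C * real N powr (1 - \<kappa> / 2)) \<le> real N powr \<eta>"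
      using D C \<kappa> \<eta> by real_asymp
    then show "\<forall>\<^sub>F N in sequentially. measure_pmf.prob (lrp_graph d \<beta> (2 * real d) N)
        (- {E. lrp_diameter d N E \<le> ereal (real N powr \<eta>)}) \<le> real (Suc N) powr (2 * D) * exp (- (ln (real N))\<^sup>2)"
      using eventually_gt_at_top[of 1]
    proof eventually_elim
      case (elim N)
      \<comment> \<open>Selects the power k = M^n with sqrt N / M \<le> k \<le> sqrt N.\<close>
      define q where "q = 1 / sqrt (real N)"
      have sN: "sqrt (real N) > 1" using elim by simp
      then have q: "0 < q" "q < 1" by (simp_all add: q_def)
      obtain n where n: "(1 / real M) ^ n \<ge> q" "(1 / real M) ^ Suc n < q"
        using exists_last_power_ge[of "1 / real M" q] M1 q by auto
      define k where "k = M ^ n"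
      have kpos: "real k > 0" using M1 by (simp add: k_def)
      have k_le: "real k \<le> sqrt (real N)"
        using n(1) sN kpos by (simp add: q_def k_def power_one_over field_simps)
      have k_ge: "sqrt (real N) / real M \<le> real k"
      proof -
        have "(1 / real M) ^ Suc n = inverse (real M * real k)"
          by (simp add: k_def power_one_over inverse_eq_divide)
        then have "inverse (real M * real k) < inverse (sqrt (real N))"
          using n(2) by (simp add: q_def inverse_eq_divide)
        then have "sqrt (real N) < real M * real k"
          by (rule inverse_less_imp_less) (use M1(1) kpos in auto)
        then show ?thesis using M1(1) by (simp add: pos_divide_le_eq mult.commute)
      qed
      define A where "A = \<rho> ^ n"
      have A0: "A \<ge> 0" using \<rho> by (simp add: A_def)
      have Ak: "A = real k * real k powr - \<kappa>"
      proof -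
        have "A = (real M powr (1 - \<kappa>)) powr real n" using \<rho> by (simp add: A_def \<rho>M[symmetric] powr_realpow)
        also have "\<dots> = (real M powr real n) powr (1 - \<kappa>)" by (simp add: powr_powr mult.commute)
        also have "real M powr real n = real k" using M1 by (simp add: k_def powr_realpow)
        also have "real k powr (1 - \<kappa>) = real k * real k powr - \<kappa>"
          using kpos by (simp add: powr_diff powr_minus divide_inverse)
        finally show ?thesis .
      qed
      define \<Lambda> where "\<Lambda> = real N * A / (real k)\<^sup>2"
      \<comment> \<open>As ln 2 \<ge> 1/2, the factor 4 gives a ln 2 \<ge> 2 (\<Lambda> + (ln N)^2).
        This cancels the exponential moment exp \<Lambda> and leaves exp (-(ln N)^2), which beats
        the number of pairs of nodes.\<close>
      define a where "a = 4 * (\<Lambda> + (ln (real N))\<^sup>2)"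
      have \<Lambda>0: "\<Lambda> \<ge> 0" using A0 by (simp add: \<Lambda>_def)
      have k\<Lambda>: "real k * \<Lambda> \<le> C * real N powr (1 - \<kappa> / 2)"
      proof -
        have "real k * \<Lambda> = real N * real k powr - \<kappa>"
          using kpos by (simp add: \<Lambda>_def Ak power2_eq_square)
        also have "\<dots> \<le> real N * (sqrt (real N) / real M) powr - \<kappa>"
          using k_ge \<kappa> sN M1 by (intro mult_left_mono powr_mono2') auto
        also have "(sqrt (real N) / real M) powr - \<kappa> = C * sqrt (real N) powr - \<kappa>"
        proof -
          have "(sqrt (real N) / real M) powr - \<kappa> = sqrt (real N) powr - \<kappa> / real M powr - \<kappa>"
            by (rule powr_divide)
          moreover have "z / real M powr - \<kappa> = C * z" for z
            by (simp add: powr_minus C_def divide_inverse)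
          ultimately show ?thesis by (simp only:)
        qed
        also have "sqrt (real N) powr - \<kappa> = real N powr (- \<kappa> / 2)"
          by (simp add: powr_half_sqrt[symmetric] powr_powr)
        also have "real N * (C * real N powr (- \<kappa> / 2)) = C * (real N powr 1 * real N powr (- \<kappa> / 2))"
          using elim by simp
        also have "real N powr 1 * real N powr (- \<kappa> / 2) = real N powr (1 - \<kappa> / 2)"
          unfolding powr_add[symmetric] by simp
        finally show ?thesis .
      qed
      have "real k * (1 + a) = real k * (1 + 4 * (ln (real N))\<^sup>2) + 4 * (real k * \<Lambda>)"
        by (simp add: a_def algebra_simps)
      also have "\<dots> \<le> sqrt (real N) * (1 + 4 * (ln (real N))\<^sup>2) + 4 * (C * real N powr (1 - \<kappa> / 2))"
        using k_le k\<Lambda> by (intro add_mono mult_right_mono mult_left_mono) auto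
      finally have "real d * (real k * (1 + a)) \<le> D * (sqrt (real N) * (1 + 4 * (ln (real N))\<^sup>2) + 4 * C * real N powr (1 - \<kappa> / 2))"
        unfolding D_def by (intro mult_left_mono) (simp_all add: mult_ac)
      then have L: "real d * (real k * (1 + a)) \<le> real N powr \<eta>" using elim by linarith
      have "sqrt (real N) \<le> real N" using sN by (simp add: real_sqrt_le_iff sqrt_le_D real_le_lsqrt power2_eq_square)
      then have kN: "k \<le> Suc N" using k_le by linarith
      have "measure_pmf.prob (lrp_graph d \<beta> (2 * real d) N) (- {E. lrp_diameter d N E \<le> ereal (real N powr \<eta>)})
        \<le> real (Suc N) ^ (2 * d) * (exp (real N * A / (real k)\<^sup>2) / 2 powr a)"
      proof (rule prob_diameter_gt_hops[OF _ A0 _ kN assms(2) L])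
        show "axis_hops_le d N \<beta> (2 * real d) k A"
          unfolding k_def A_def \<rho>_def p0_def by (rule axis_hops_le_power[OF assms]) (simp add: M_def)
        show "1 \<le> k" using kpos by simp
      qed
      also have "\<dots> \<le> real (Suc N) ^ (2 * d) * exp (- (ln (real N))\<^sup>2)"
      proof (intro mult_left_mono)
        have "2 powr a = exp (a * ln 2)" by (simp add: powr_def)
        then have "exp (real N * A / (real k)\<^sup>2) / 2 powr a = exp (\<Lambda> - a * ln 2)"
          by (simp add: \<Lambda>_def exp_diff)
        also have "\<Lambda> - a * ln 2 \<le> - (ln (real N))\<^sup>2"
        proof -
          have "a \<ge> 0" using \<Lambda>0 by (simp add: a_def)
          then have "a * (1 / 2) \<le> a * ln 2" using ln2_ge_two_thirds by (intro mult_left_mono) auto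
          then have "2 * (\<Lambda> + (ln (real N))\<^sup>2) \<le> a * ln 2" by (simp add: a_def)

          moreover have "\<Lambda> + (ln (real N))\<^sup>2 \<le> 2 * (\<Lambda> + (ln (real N))\<^sup>2)"
            using \<Lambda>0 by simp
          ultimately have "\<Lambda> + (ln (real N))\<^sup>2 \<le> a * ln 2" by (rule order_trans[rotated])
          then show ?thesis by (simp add: algebra_simps)
        qed
        finally show "exp (real N * A / (real k)\<^sup>2) / 2 powr a \<le> exp (- (ln (real N))\<^sup>2)" by simp
      qed simp
      also have "real (Suc N) ^ (2 * d) = real (Suc N) powr (2 * D)"
        using powr_realpow[of "real (Suc N)" "2 * d"] by (simp add: D_def)
      finally show ?case .
    qed
  qed
  then show ?thesis using \<eta>(1,2) by blast
qed

section \<open>Exploration along edges of intermediate length\<close>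

text \<open>The left-hand side is the factor of one node in the exponential moment of the number of
  missed nodes. It comes from exp (-t) \<le> 1 - t/2 on the unit interval.\<close>

lemma one_plus_exp_minus_le:
  fixes t :: real
  assumes "0 \<le> t" "t \<le> 1"
  shows "(1 + exp (- t)) / 2 \<le> exp (- (t / 4))"
proof -
  have "(1 - t / 2) * (1 + t) = 1 + t / 2 * (1 - t)" by (simp add: field_simps)
  also have "\<dots> \<ge> 1" using assms by simp
  finally have "1 \<le> (1 - t / 2) * (1 + t)" .
  also have "\<dots> \<le> (1 - t / 2) * exp t"
    using assms exp_ge_add_one_self[of t] by (intro mult_left_mono) auto
  finally have "1 * exp (- t) \<le> (1 - t / 2) * exp t * exp (- t)"
    by (intro mult_right_mono) auto
  also have "(1 - t / 2) * exp t * exp (- t) = 1 - t / 2"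
    by (simp only: mult.assoc exp_minus_inverse mult_1_right)
  finally have "exp (- t) \<le> 1 - t / 2" by simp
  then have "(1 + exp (- t)) / 2 \<le> 1 + - (t / 4)" by simp
  also have "\<dots> \<le> exp (- (t / 4))" by (rule exp_ge_add_one_self)
  finally show ?thesis .
qed

context
  fixes d N R1 R2 :: nat
begin

definition mid_pairs :: "(nat \<Rightarrow> int) set set" where
  "mid_pairs = {e \<in> lrp_pairs d N. int R1 \<le> pair_length d e \<and> pair_length d e \<le> int R2}"

definition nbrs :: "(nat \<Rightarrow> int) set set \<Rightarrow> (nat \<Rightarrow> int) set \<Rightarrow> (nat \<Rightarrow> int) set \<Rightarrow> (nat \<Rightarrow> int) set" where
  "nbrs E S U = {y \<in> lrp_nodes d N - U. \<exists>x\<in>S. {x, y} \<in> E \<inter> mid_pairs}"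

text \<open>Breadth-first search in the graph of intermediate edges: the current layer together with
  all nodes reached so far.\<close>

fun explore :: "(nat \<Rightarrow> int) set set \<Rightarrow> (nat \<Rightarrow> int) set \<Rightarrow> nat \<Rightarrow> (nat \<Rightarrow> int) set \<times> (nat \<Rightarrow> int) set" where
  "explore E A 0 = (A, A)"
| "explore E A (Suc r) = (let (S, U) = explore E A r in (nbrs E S U, U \<union> nbrs E S U))"

definition newest :: "(nat \<Rightarrow> int) set set \<Rightarrow> (nat \<Rightarrow> int) set \<Rightarrow> nat \<Rightarrow> (nat \<Rightarrow> int) set" where
  "newest E A r = fst (explore E A r)"

definition explored :: "(nat \<Rightarrow> int) set set \<Rightarrow> (nat \<Rightarrow> int) set \<Rightarrow> nat \<Rightarrow> (nat \<Rightarrow> int) set" where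
  "explored E A r = snd (explore E A r)"

lemma newest_simps [simp]:
  "newest E A 0 = A" "newest E A (Suc r) = nbrs E (newest E A r) (explored E A r)"
  by (simp_all add: newest_def explored_def case_prod_unfold Let_def)

lemma explored_simps [simp]:
  "explored E A 0 = A" "explored E A (Suc r) = explored E A r \<union> nbrs E (newest E A r) (explored E A r)"
  by (simp_all add: newest_def explored_def case_prod_unfold Let_def)

lemma newest_subset_explored: "newest E A r \<subseteq> explored E A r"
  by (cases r) auto

lemma explored_subset_nodes: "A \<subseteq> lrp_nodes d N \<Longrightarrow> explored E A r \<subseteq> lrp_nodes d N"
  by (induction r) (auto simp: nbrs_def)

lemma explored_mono: "r \<le> r' \<Longrightarrow> explored E A r \<subseteq> explored E A r'"
  by (induction r' rule: dec_induct) auto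

text \<open>The exploration up to step \<open>r\<close> has only looked at edges meeting the explored set minus the newest.\<close>

lemma explore_cong:
  assumes "\<And>e. e \<inter> (explored E A r - newest E A r) \<noteq> {} \<Longrightarrow> e \<in> E \<longleftrightarrow> e \<in> E'"
  shows "newest E' A r = newest E A r \<and> explored E' A r = explored E A r"
  using assms
proof (induction r)
  case (Suc r)
  let ?S = "newest E A r" and ?U = "explored E A r"
  have "explored E A (Suc r) - newest E A (Suc r) = ?U" by (auto simp: nbrs_def)
  then have e: "e \<in> E \<longleftrightarrow> e \<in> E'" if "e \<inter> ?U \<noteq> {}" for e using Suc.prems that by simp
  then have "newest E' A r = ?S \<and> explored E' A r = ?U" by (intro Suc.IH) blast
  moreover have "{x, y} \<in> E \<longleftrightarrow> {x, y} \<in> E'" if "x \<in> ?S" for x y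
    using that newest_subset_explored[of E A r] by (intro e) auto
  then have "nbrs E' ?S ?U = nbrs E ?S ?U" unfolding nbrs_def by auto
  ultimately show ?case by simp
qed simp

text \<open>The search reads intermediate edges only, so it is independent of the longer edges that
  are to join two explored sets.\<close>

lemma explore_mid: "explore (E \<inter> mid_pairs) A r = explore E A r"
  by (induction r) (simp_all add: nbrs_def case_prod_unfold Let_def)

text \<open>
  If \<open>I y\<close> indicates that \<open>y\<close> is missed, then \<open>\<Prod>y. I y + 1\<close> is \<open>2\<close> to the number of missed nodes, and
  it expands into a sum over sets of missed nodes, whose probabilities are explicit.
\<close>

lemma prob_few_nbrs:
  fixes \<beta> h k :: real
  assumes "\<beta> > 0" "2 \<le> R1" "S \<subseteq> U" "U \<subseteq> lrp_nodes d N"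
    and small: "\<And>y. y \<in> lrp_nodes d N - U \<Longrightarrow> (\<Sum>x\<in>{x\<in>S. {x, y} \<in> mid_pairs}. \<beta> / real (ldist d x y) powr s) \<le> 1"
    and h: "h \<le> (\<Sum>y\<in>lrp_nodes d N - U. \<Sum>x\<in>{x\<in>S. {x, y} \<in> mid_pairs}. \<beta> / real (ldist d x y) powr s)"
  shows "measure_pmf.prob (lrp_graph d \<beta> s N) {E. real (card (nbrs E S U)) \<le> k} \<le> 2 powr k * exp (- (h / 4))"
proof -
  let ?M = "lrp_graph d \<beta> s N"
  define Y where "Y = lrp_nodes d N - U"
  define t where "t y = (\<Sum>x\<in>{x\<in>S. {x, y} \<in> mid_pairs}. \<beta> / real (ldist d x y) powr s)" for y
  define F where "F y = (\<lambda>x. {x, y}) ` {x\<in>S. {x, y} \<in> mid_pairs}" for y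
  have finY: "finite Y" by (simp add: Y_def)
  have "finite U" by (rule finite_subset[OF assms(4)]) simp
  then have finS: "finite S" by (rule finite_subset[OF assms(3)])
  have t0: "t y \<ge> 0" for y using assms(1) by (auto simp: t_def intro!: sum_nonneg)
  have avoid: "measure_pmf.prob ?M {E. E \<inter> (\<Union>y\<in>Z. F y) = {}} = (\<Prod>y\<in>Z. exp (- t y))" if Z: "Z \<subseteq> Y" for Z
  proof -
    have finZ: "finite Z" using Z finY finite_subset by auto
    \<comment> \<open>An edge common to \<open>F y\<close> and \<open>F y'\<close> would have
      \<open>y\<close> as its endpoint in \<open>S\<close>, but \<open>y\<close> is unexplored and
      \<open>S \<subseteq> U\<close>.\<close>
    have disj: "F y \<inter> F y' = {}" if "y \<in> Z" "y' \<in> Z" "y \<noteq> y'" for y y'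
    proof (rule ccontr)
      assume "F y \<inter> F y' \<noteq> {}"
      then obtain x x' where "x \<in> S" "x' \<in> S" "{x, y} = {x', y'}" by (auto simp: F_def)
      then have "y = x'" using that(3) by (auto simp: doubleton_eq_iff)
      then show False using \<open>x' \<in> S\<close> assms(3) Z that(1) by (auto simp: Y_def)
    qed
    have "(\<Union>y\<in>Z. F y) \<subseteq> lrp_pairs d N - unit_pairs d N"
      using assms(2) by (auto simp: F_def mid_pairs_def unit_pairs_def)
    then have "measure_pmf.prob ?M {E. E \<inter> (\<Union>y\<in>Z. F y) = {}} =
        exp (- (\<Sum>e\<in>(\<Union>y\<in>Z. F y). \<beta> / real_of_int (pair_length d e) powr s))"
      by (rule prob_lrp_avoid[OF assms(1)])
    also have "(\<Sum>e\<in>(\<Union>y\<in>Z. F y). \<beta> / real_of_int (pair_length d e) powr s) =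
        (\<Sum>y\<in>Z. \<Sum>e\<in>F y. \<beta> / real_of_int (pair_length d e) powr s)"
      using finZ disj finS by (intro sum.UNION_disjoint) (auto simp: F_def)
    also have "\<dots> = (\<Sum>y\<in>Z. t y)"
    proof (intro sum.cong refl)
      fix y assume y: "y \<in> Z"
      have "inj_on (\<lambda>x. {x, y}) {x\<in>S. {x, y} \<in> mid_pairs}" by (auto simp: inj_on_def doubleton_eq_iff)
      then show "(\<Sum>e\<in>F y. \<beta> / real_of_int (pair_length d e) powr s) = t y"
        unfolding F_def t_def by (subst sum.reindex) (auto simp: pair_length_eq)
    qed
    also have "exp (- (\<Sum>y\<in>Z. t y)) = (\<Prod>y\<in>Z. exp (- t y))"
      using finZ by (simp add: exp_sum[symmetric] sum_negf)
    finally show ?thesis .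
  qed
  have nbrs_iff: "y \<in> nbrs E S U \<longleftrightarrow> E \<inter> F y \<noteq> {}" if "y \<in> Y" for y E
    using that by (auto simp: nbrs_def F_def Y_def)
  define \<Phi> where "\<Phi> E = (\<Prod>y\<in>Y. indicator {E. E \<inter> F y = {}} E + 1 :: real)" for E
  have \<Phi>1: "\<Phi> E = (\<Sum>Z\<in>Pow Y. indicator {E. E \<inter> (\<Union>y\<in>Z. F y) = {}} E)" for E
  proof -
    have "\<Phi> E = (\<Sum>Z\<in>Pow Y. (\<Prod>y\<in>Z. indicator {E. E \<inter> F y = {}} E) * (\<Prod>y\<in>Y - Z. 1))"
      unfolding \<Phi>_def by (rule prod_add[OF finY])
    also have "\<dots> = (\<Sum>Z\<in>Pow Y. indicator {E. E \<inter> (\<Union>y\<in>Z. F y) = {}} E)"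
    proof (intro sum.cong refl)
      fix Z assume "Z \<in> Pow Y"
      then have "finite Z" using finY finite_subset by auto
      then have "(\<Prod>y\<in>Z. indicator {E. E \<inter> F y = {}} E :: real) = (if \<forall>y\<in>Z. E \<inter> F y = {} then 1 else 0)"
        by (induction Z rule: finite_induct) auto
      also have "\<dots> = indicator {E. E \<inter> (\<Union>y\<in>Z. F y) = {}} E" by (auto simp: indicator_def)
      finally show "(\<Prod>y\<in>Z. indicator {E. E \<inter> F y = {}} E :: real) * (\<Prod>y\<in>Y - Z. 1) = indicator {E. E \<inter> (\<Union>y\<in>Z. F y) = {}} E"
        by simp
    qed
    finally show ?thesis .
  qed
  have \<Phi>2: "\<Phi> E = 2 ^ card (Y - nbrs E S U)" for E
  proof -
    have "\<Phi> E = (\<Prod>y\<in>Y. if y \<in> nbrs E S U then 1 else 2)"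
      unfolding \<Phi>_def using nbrs_iff by (intro prod.cong) auto
    also have "\<dots> = 2 ^ card (Y - nbrs E S U)"
      using finY by (simp add: prod.If_cases Diff_eq)
    finally show ?thesis .
  qed
  have E\<Phi>: "measure_pmf.expectation ?M \<Phi> = (\<Prod>y\<in>Y. exp (- t y) + 1)"
  proof -
    have "measure_pmf.expectation ?M \<Phi> = measure_pmf.expectation ?M (\<lambda>E. \<Sum>Z\<in>Pow Y. indicator {E. E \<inter> (\<Union>y\<in>Z. F y) = {}} E)"
      using \<Phi>1 by (intro Bochner_Integration.integral_cong refl) simp
    also have "\<dots> = (\<Sum>Z\<in>Pow Y. measure_pmf.expectation ?M (indicator {E. E \<inter> (\<Union>y\<in>Z. F y) = {}}))"
      by (rule expectation_lrp_sum)
    also have "\<dots> = (\<Sum>Z\<in>Pow Y. (\<Prod>y\<in>Z. exp (- t y)) * (\<Prod>y\<in>Y - Z. 1))"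
    proof (intro sum.cong refl)
      fix Z assume "Z \<in> Pow Y"
      then show "measure_pmf.expectation ?M (indicator {E. E \<inter> (\<Union>y\<in>Z. F y) = {}}) = (\<Prod>y\<in>Z. exp (- t y)) * (\<Prod>y\<in>Y - Z. 1)"
        using avoid[of Z] by simp
    qed
    also have "\<dots> = (\<Prod>y\<in>Y. exp (- t y) + 1)" by (rule prod_add[OF finY, symmetric])
    finally show ?thesis .
  qed
  have "measure_pmf.prob ?M {E. real (card (nbrs E S U)) \<le> k} \<le> measure_pmf.prob ?M {E. \<Phi> E \<ge> 2 powr (real (card Y) - k)}"
  proof (intro measure_pmf.finite_measure_mono subsetI)
    fix E assume E: "E \<in> {E. real (card (nbrs E S U)) \<le> k}"
    have sub: "nbrs E S U \<subseteq> Y" by (auto simp: nbrs_def Y_def)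
    then have "real (card (Y - nbrs E S U)) = real (card Y) - real (card (nbrs E S U))"
      using finY by (simp add: card_Diff_subset finite_subset of_nat_diff card_mono)
    then have "\<Phi> E = 2 powr (real (card Y) - real (card (nbrs E S U)))"
      unfolding \<Phi>2 by (metis powr_realpow zero_less_numeral)
    then show "E \<in> {E. \<Phi> E \<ge> 2 powr (real (card Y) - k)}" using E by simp
  qed simp
  also have "\<dots> \<le> measure_pmf.expectation ?M \<Phi> / 2 powr (real (card Y) - k)"
    by (intro prob_pmf_markov) (auto simp: \<Phi>2)
  also have "\<dots> = 2 powr k * ((\<Prod>y\<in>Y. exp (- t y) + 1) / 2 ^ card Y)"
    unfolding E\<Phi> by (simp add: powr_diff powr_realpow)
  also have "(\<Prod>y\<in>Y. exp (- t y) + 1) / 2 ^ card Y = (\<Prod>y\<in>Y. (1 + exp (- t y)) / 2)"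
    by (simp add: prod_dividef add.commute)
  also have "2 powr k * (\<Prod>y\<in>Y. (1 + exp (- t y)) / 2) \<le> 2 powr k * (\<Prod>y\<in>Y. exp (- (t y / 4)))"
    using small t0 by (intro mult_left_mono prod_mono conjI one_plus_exp_minus_le)
      (auto simp: Y_def t_def intro!: divide_nonneg_pos add_nonneg_nonneg)
  also have "(\<Prod>y\<in>Y. exp (- (t y / 4))) = exp (- (\<Sum>y\<in>Y. t y) / 4)"
    using finY by (simp add: exp_sum[symmetric] sum_negf sum_divide_distrib)
  also have "\<dots> \<le> exp (- (h / 4))" using h by (simp add: Y_def t_def)
  finally show ?thesis by (simp add: mult_left_mono)
qed

text \<open>A node of \<open>S\<close> has total weight at least \<open>w\<close> towards
  intermediate nodes. At most 1 of it goes to explored nodes, as there are at most R1^d of them,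
  each of weight at most R1^(-d). The total is thus at least \<beta> (w - 1) |S| = 8 g |S|, and
  allowing g |S| neighbours gives 2^(g |S|) exp (-2 g |S|) \<le> exp (-g |S|). The condition on
  \<beta> K keeps the weight received by a single unexplored node below 1.\<close>

lemma prob_growth_fails:
  fixes \<beta> w K g :: real
  assumes "\<beta> > 0" "2 \<le> R1" "S \<subseteq> U" "U \<subseteq> lrp_nodes d N" "d \<ge> 1"
    and K: "real (card U) \<le> K" "K \<le> real R1 ^ d" "\<beta> * K \<le> real R1 ^ d"
    and w: "\<And>x. x \<in> lrp_nodes d N \<Longrightarrow> w \<le> (\<Sum>y\<in>{y\<in>lrp_nodes d N. {x, y} \<in> mid_pairs}. 1 / real (ldist d x y) powr real d)"
    and g: "g = \<beta> * (w - 1) / 8" "g \<ge> 0"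
  shows "measure_pmf.prob (lrp_graph d \<beta> (real d) N) {E. real (card (nbrs E S U)) \<le> g * real (card S)}
    \<le> exp (- g * real (card S))"
proof -
  let ?V = "lrp_nodes d N"
  let ?q = "\<lambda>x y. 1 / real (ldist d x y) powr real d"
  have finU: "finite U" by (rule finite_subset[OF assms(4)]) simp
  then have finS: "finite S" by (rule finite_subset[OF assms(3)])
  have R1: "real R1 ^ d > 0" using assms(2) by simp
  have q: "?q x y \<le> 1 / real R1 ^ d" if "{x, y} \<in> mid_pairs" for x y
  proof -
    have "real R1 \<le> real (ldist d x y)" using that by (simp add: mid_pairs_def pair_length_eq)
    then have "real R1 powr real d \<le> real (ldist d x y) powr real d" by (intro powr_mono2) auto
    then have "real R1 ^ d \<le> real (ldist d x y) powr real d" using assms(2) by (simp add: powr_realpow)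
    then show ?thesis using R1 by (intro frac_le) auto
  qed
  have "measure_pmf.prob (lrp_graph d \<beta> (real d) N) {E. real (card (nbrs E S U)) \<le> g * real (card S)}
    \<le> 2 powr (g * real (card S)) * exp (- (8 * g * real (card S) / 4))"
  proof (rule prob_few_nbrs[OF assms(1-4)])
    fix y assume "y \<in> ?V - U"
    have "(\<Sum>x\<in>{x\<in>S. {x, y} \<in> mid_pairs}. \<beta> / real (ldist d x y) powr real d) \<le> (\<Sum>x\<in>{x\<in>S. {x, y} \<in> mid_pairs}. \<beta> * (1 / real R1 ^ d))"
    proof (rule sum_mono)
      fix x assume "x \<in> {x\<in>S. {x, y} \<in> mid_pairs}"
      then have "\<beta> * ?q x y \<le> \<beta> * (1 / real R1 ^ d)" using q assms(1) by (intro mult_left_mono) auto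
      then show "\<beta> / real (ldist d x y) powr real d \<le> \<beta> * (1 / real R1 ^ d)" by simp
    qed
    also have "\<dots> = real (card {x\<in>S. {x, y} \<in> mid_pairs}) * (\<beta> / real R1 ^ d)" by simp
    also have "\<dots> \<le> K * (\<beta> / real R1 ^ d)"
    proof (rule mult_right_mono)
      have "card {x\<in>S. {x, y} \<in> mid_pairs} \<le> card U" using assms(3) finU by (intro card_mono) auto
      then show "real (card {x\<in>S. {x, y} \<in> mid_pairs}) \<le> K" using K(1) by linarith
    qed (use assms(1) in auto)
    also have "\<dots> \<le> 1" using K(3) R1 by (simp add: mult.commute)
    finally show "(\<Sum>x\<in>{x\<in>S. {x, y} \<in> mid_pairs}. \<beta> / real (ldist d x y) powr real d) \<le> 1" .
  next
    have "real (card S) * (w - 1) = (\<Sum>x\<in>S. w - 1)" by simp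
    also have "\<dots> \<le> (\<Sum>x\<in>S. \<Sum>y\<in>{y\<in>?V - U. {x, y} \<in> mid_pairs}. ?q x y)"
    proof (rule sum_mono)
      fix x assume x: "x \<in> S"
      have "{y\<in>?V. {x, y} \<in> mid_pairs} = {y\<in>?V - U. {x, y} \<in> mid_pairs} \<union> {y\<in>U. {x, y} \<in> mid_pairs}"
        using assms(4) by auto
      then have "(\<Sum>y\<in>{y\<in>?V. {x, y} \<in> mid_pairs}. ?q x y) = (\<Sum>y\<in>{y\<in>?V - U. {x, y} \<in> mid_pairs}. ?q x y) + (\<Sum>y\<in>{y\<in>U. {x, y} \<in> mid_pairs}. ?q x y)"
        using finU by (simp only:) (intro sum.union_disjoint, auto)
      moreover have "(\<Sum>y\<in>{y\<in>U. {x, y} \<in> mid_pairs}. ?q x y) \<le> 1"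
      proof -
        have "(\<Sum>y\<in>{y\<in>U. {x, y} \<in> mid_pairs}. ?q x y) \<le> (\<Sum>y\<in>{y\<in>U. {x, y} \<in> mid_pairs}. 1 / real R1 ^ d)"
          using q by (intro sum_mono) auto
        also have "\<dots> = real (card {y\<in>U. {x, y} \<in> mid_pairs}) * (1 / real R1 ^ d)" by simp
        also have "\<dots> \<le> real R1 ^ d * (1 / real R1 ^ d)"
        proof (rule mult_right_mono)
          have "card {y\<in>U. {x, y} \<in> mid_pairs} \<le> card U" using finU by (intro card_mono) auto
          then show "real (card {y\<in>U. {x, y} \<in> mid_pairs}) \<le> real R1 ^ d" using K(1,2) by linarith
        qed simp
        also have "\<dots> = 1" using R1 by simp
        finally show ?thesis .
      qed
      ultimately show "w - 1 \<le> (\<Sum>y\<in>{y\<in>?V - U. {x, y} \<in> mid_pairs}. ?q x y)"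
        using w[of x] x assms(3,4) by auto
    qed
    also have "\<dots> = (\<Sum>y\<in>?V - U. \<Sum>x\<in>{x\<in>S. {x, y} \<in> mid_pairs}. ?q x y)"
      using finS by (intro sum.swap_restrict) auto
    finally have "\<beta> * (real (card S) * (w - 1)) \<le> \<beta> * (\<Sum>y\<in>?V - U. \<Sum>x\<in>{x\<in>S. {x, y} \<in> mid_pairs}. ?q x y)"
      using assms(1) by (intro mult_left_mono) auto
    then show "8 * g * real (card S) \<le> (\<Sum>y\<in>?V - U. \<Sum>x\<in>{x\<in>S. {x, y} \<in> mid_pairs}. \<beta> / real (ldist d x y) powr real d)"
    proof -
      assume *: "\<beta> * (real (card S) * (w - 1)) \<le> \<beta> * (\<Sum>y\<in>?V - U. \<Sum>x\<in>{x\<in>S. {x, y} \<in> mid_pairs}. ?q x y)"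
      have "8 * g * real (card S) = \<beta> * (real (card S) * (w - 1))" by (simp add: g(1))
      also note *
      also have "\<beta> * (\<Sum>y\<in>?V - U. \<Sum>x\<in>{x\<in>S. {x, y} \<in> mid_pairs}. ?q x y) =
          (\<Sum>y\<in>?V - U. \<Sum>x\<in>{x\<in>S. {x, y} \<in> mid_pairs}. \<beta> / real (ldist d x y) powr real d)"
        by (simp add: sum_distrib_left)
      finally show ?thesis .
    qed
  qed
  also have "\<dots> = exp (g * real (card S) * ln 2 - 2 * (g * real (card S)))"
    by (simp add: powr_def exp_add[symmetric])
  also have "\<dots> \<le> exp (- g * real (card S))"
  proof -
    have "g * real (card S) * ln 2 \<le> g * real (card S) * 1"
      using g(2) ln_2_less_1 by (intro mult_left_mono) auto
    then show ?thesis by simp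
  qed
  finally show ?thesis .
qed

text \<open>
  Conditionally on the newest \<open>S\<close> and the explored set \<open>U\<close>, the edges from \<open>S\<close> to the unexplored nodes
  are still unrevealed.
\<close>

lemma prob_growth_fails_at_step:
  fixes \<beta> w K g m :: real
  assumes "\<beta> > 0" "2 \<le> R1" "d \<ge> 1" "A \<subseteq> lrp_nodes d N"
    and K: "K \<le> real R1 ^ d" "\<beta> * K \<le> real R1 ^ d"
    and w: "\<And>x. x \<in> lrp_nodes d N \<Longrightarrow> w \<le> (\<Sum>y\<in>{y\<in>lrp_nodes d N. {x, y} \<in> mid_pairs}. 1 / real (ldist d x y) powr real d)"
    and g: "g = \<beta> * (w - 1) / 8" "g \<ge> 0"
  shows "measure_pmf.prob (lrp_graph d \<beta> (real d) N)
      {E. m \<le> real (card (newest E A r)) \<and> real (card (explored E A r)) \<le> K \<and>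
        real (card (newest E A (Suc r))) \<le> g * real (card (newest E A r))}
    \<le> exp (- g * m)"
proof -
  let ?P = "measure_pmf.prob (lrp_graph d \<beta> (real d) N)" and ?V = "lrp_nodes d N"
  define W where "W = {(S, U). S \<subseteq> U \<and> U \<subseteq> ?V \<and> m \<le> real (card S) \<and> real (card U) \<le> K}"
  define X where "X z = {E. newest E A r = fst z \<and> explored E A r = snd z}" for z
  define Y where "Y z = {E. real (card (nbrs E (fst z) (snd z))) \<le> g * real (card (fst z))}" for z
  have finW: "finite W"
    by (rule finite_subset[of _ "Pow ?V \<times> Pow ?V"]) (auto simp: W_def)
  have "?P {E. m \<le> real (card (newest E A r)) \<and> real (card (explored E A r)) \<le> K \<and>
        real (card (newest E A (Suc r))) \<le> g * real (card (newest E A r))} \<le> ?P (\<Union>z\<in>W. X z \<inter> Y z)"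
  proof (intro measure_pmf.finite_measure_mono subsetI)
    fix E assume "E \<in> {E. m \<le> real (card (newest E A r)) \<and> real (card (explored E A r)) \<le> K \<and>
        real (card (newest E A (Suc r))) \<le> g * real (card (newest E A r))}"
    then have "(newest E A r, explored E A r) \<in> W" "E \<in> X (newest E A r, explored E A r) \<inter> Y (newest E A r, explored E A r)"
      using newest_subset_explored[of E A r] explored_subset_nodes[OF assms(4), of E r]
      by (auto simp: W_def X_def Y_def)
    then show "E \<in> (\<Union>z\<in>W. X z \<inter> Y z)" by blast
  qed simp
  also have "\<dots> \<le> (\<Sum>z\<in>W. ?P (X z \<inter> Y z))"
    using finW by (intro measure_pmf.finite_measure_subadditive_finite) auto
  also have "\<dots> \<le> (\<Sum>z\<in>W. ?P (X z) * exp (- g * m))"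
  proof (rule sum_mono)
    fix z assume z: "z \<in> W"
    obtain S U where SU: "z = (S, U)" by (cases z)
    have zW: "S \<subseteq> U" "U \<subseteq> ?V" "m \<le> real (card S)" "real (card U) \<le> K" using z by (auto simp: W_def SU)
    \<comment> \<open>\<open>?F\<close> holds the edges that decide whether the search has reached
      the state \<open>(S, U)\<close>; \<open>?G\<close> holds those that decide its next
      layer.\<close>
    let ?F = "{e. e \<inter> (U - S) \<noteq> {}}" and ?G = "cross S (?V - U)"
    have "?P (X z \<inter> Y z) = ?P (X z) * ?P (Y z)"
      unfolding lrp_graph_eq_rand_set
    proof (rule prob_rand_set_Int[OF finite_lrp_pairs])
      show "?F \<inter> ?G = {}" using zW(1) by (auto simp: cross_def)
      show "E \<inter> ?F \<in> X z \<longleftrightarrow> E \<in> X z" for E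
      proof
        assume "E \<inter> ?F \<in> X z"
        then have h: "newest (E \<inter> ?F) A r = S" "explored (E \<inter> ?F) A r = U" by (simp_all add: X_def SU)
        have "newest E A r = newest (E \<inter> ?F) A r \<and> explored E A r = explored (E \<inter> ?F) A r"
          by (rule explore_cong) (simp add: h)
        then show "E \<in> X z" by (simp add: h X_def SU)
      next
        assume "E \<in> X z"
        then have h: "newest E A r = S" "explored E A r = U" by (simp_all add: X_def SU)
        have "newest (E \<inter> ?F) A r = newest E A r \<and> explored (E \<inter> ?F) A r = explored E A r"
          by (rule explore_cong) (simp add: h)
        then show "E \<inter> ?F \<in> X z" by (simp add: h X_def SU)
      qed
      show "E \<inter> ?G \<in> Y z \<longleftrightarrow> E \<in> Y z" for E
      proof -
        have "nbrs (E \<inter> ?G) S U = nbrs E S U" by (fastforce simp: nbrs_def cross_def)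
        then show ?thesis by (simp add: Y_def SU)
      qed
    qed
    also have "\<dots> \<le> ?P (X z) * exp (- g * m)"
    proof (rule mult_left_mono)
      have "?P (Y z) \<le> exp (- g * real (card S))"
        unfolding Y_def SU fst_conv snd_conv using zW
        by (intro prob_growth_fails[OF assms(1,2) zW(1,2) assms(3) zW(4) K w g])
      also have "\<dots> \<le> exp (- g * m)" using zW(3) g(2) by (simp add: mult_left_mono)
      finally show "?P (Y z) \<le> exp (- g * m)" .
    qed simp
    finally show "?P (X z \<inter> Y z) \<le> ?P (X z) * exp (- g * m)" .
  qed
  also have "\<dots> = ?P (\<Union>z\<in>W. X z) * exp (- g * m)"
  proof -
    have "disjoint_family_on X W" by (auto simp: disjoint_family_on_def X_def prod_eq_iff)
    then have "?P (\<Union>z\<in>W. X z) = (\<Sum>z\<in>W. ?P (X z))"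
      using finW by (intro measure_pmf.finite_measure_finite_Union) auto
    then show ?thesis by (simp add: sum_distrib_right)
  qed
  also have "\<dots> \<le> 1 * exp (- g * m)" by (intro mult_right_mono) auto
  finally show ?thesis by simp
qed

text \<open>If every layer grew by the factor \<open>g\<close>, the last one would have at least |A|
  g^T \<ge> 2K nodes. So an explored set of size at most \<open>K\<close> needs a failing step;
  until the first failure no layer is smaller than \<open>A\<close>, which bounds each failure by
  exp (-g |A|).\<close>

lemma prob_explored_small:
  fixes \<beta> w K g :: real
  assumes "\<beta> > 0" "2 \<le> R1" "d \<ge> 1" "A \<subseteq> lrp_nodes d N" "2 \<le> card A"
    and K: "1 \<le> K" "K \<le> real R1 ^ d" "\<beta> * K \<le> real R1 ^ d"
    and w: "\<And>x. x \<in> lrp_nodes d N \<Longrightarrow> w \<le> (\<Sum>y\<in>{y\<in>lrp_nodes d N. {x, y} \<in> mid_pairs}. 1 / real (ldist d x y) powr real d)"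
    and g: "g = \<beta> * (w - 1) / 8" "g \<ge> 1" "K \<le> g ^ T"
  shows "measure_pmf.prob (lrp_graph d \<beta> (real d) N) {E. real (card (explored E A T)) \<le> K}
    \<le> real T * exp (- g * real (card A))"
proof -
  let ?P = "measure_pmf.prob (lrp_graph d \<beta> (real d) N)"
  let ?B = "\<lambda>r. {E. real (card A) \<le> real (card (newest E A r)) \<and> real (card (explored E A r)) \<le> K \<and>
        real (card (newest E A (Suc r))) \<le> g * real (card (newest E A r))}"
  have "{E. real (card (explored E A T)) \<le> K} \<subseteq> (\<Union>r<T. ?B r)"
  proof (rule subsetI, rule ccontr)
    fix E assume E: "E \<in> {E. real (card (explored E A T)) \<le> K}" "E \<notin> (\<Union>r<T. ?B r)"
    have fin: "finite (explored E A T)" by (rule finite_subset[OF explored_subset_nodes[OF assms(4)] finite_lrp_nodes])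
    have small: "real (card (explored E A r)) \<le> K" if "r \<le> T" for r
      using card_mono[OF fin explored_mono[OF that]] E(1) by simp
    have "real (card A) * g ^ r \<le> real (card (newest E A r))" if "r \<le> T" for r
      using that
    proof (induction r)
      case (Suc r)
      have IH: "real (card A) * g ^ r \<le> real (card (newest E A r))" using Suc by simp
      have "real (card A) * 1 \<le> real (card A) * g ^ r" using g(2) by (intro mult_left_mono) auto
      then have "real (card A) \<le> real (card (newest E A r))" using IH by simp
      moreover have "E \<notin> ?B r" using E(2) Suc.prems by auto
      ultimately have "g * real (card (newest E A r)) < real (card (newest E A (Suc r)))"
        using small[of r] Suc.prems by (auto simp: not_le)
      moreover have "g * (real (card A) * g ^ r) \<le> g * real (card (newest E A r))"
        using IH g(2) by (intro mult_left_mono) auto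
      ultimately have "g * (real (card A) * g ^ r) \<le> real (card (newest E A (Suc r)))" by linarith
      then show ?case by (simp add: mult_ac)
    qed simp
    then have "real (card A) * g ^ T \<le> real (card (newest E A T))" by simp
    also have "\<dots> \<le> real (card (explored E A T))"
      using card_mono[OF fin newest_subset_explored] by simp
    also have "\<dots> \<le> K" using E(1) by simp
    finally have "real (card A) * g ^ T \<le> K" .
    moreover have "2 * K \<le> real (card A) * g ^ T" using assms(5) g(3) K(1) by (intro mult_mono) auto
    ultimately show False using K(1) by linarith
  qed
  then have "?P {E. real (card (explored E A T)) \<le> K} \<le> ?P (\<Union>r<T. ?B r)"
    by (intro measure_pmf.finite_measure_mono) auto
  also have "\<dots> \<le> (\<Sum>r<T. ?P (?B r))"
    by (intro measure_pmf.finite_measure_subadditive_finite) auto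
  also have "\<dots> \<le> (\<Sum>r<T. exp (- g * real (card A)))"
    using g by (intro sum_mono prob_growth_fails_at_step[OF assms(1-4) K(2,3) w g(1)]) auto
  finally show ?thesis by simp
qed

text \<open>The graph distance is for the final path; the lattice displacement keeps searches
  started far apart away from each other.\<close>

lemma explored_near:
  assumes "y \<in> explored E A r" "A \<subseteq> lrp_nodes d N"
  shows "\<exists>a\<in>A. graph_dist (lrp_nodes d N) E a y \<le> enat r \<and> ldist d a y \<le> r * R2"
  using assms(1)
proof (induction r arbitrary: y)
  case 0
  then show ?case using assms(2) by (intro bexI[of _ y]) (auto simp: graph_dist_refl)
next
  case (Suc r)
  show ?case
  proof (cases "y \<in> explored E A r")
    case True
    then obtain a where a: "a \<in> A" "graph_dist (lrp_nodes d N) E a y \<le> enat r" "ldist d a y \<le> r * R2"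
      using Suc.IH by blast
    moreover have "enat r \<le> enat (Suc r)" by simp
    ultimately show ?thesis by (intro bexI[of _ a]) (auto intro: order_trans)
  next
    case False
    then obtain x where x: "x \<in> newest E A r" "{x, y} \<in> E" "{x, y} \<in> mid_pairs" "y \<in> lrp_nodes d N"
      using Suc.prems by (auto simp: nbrs_def)
    then have xU: "x \<in> explored E A r" using newest_subset_explored by blast
    then obtain a where a: "a \<in> A" "graph_dist (lrp_nodes d N) E a x \<le> enat r" "ldist d a x \<le> r * R2"
      using Suc.IH by blast
    have xV: "x \<in> lrp_nodes d N" using xU explored_subset_nodes[OF assms(2)] by blast
    have "graph_dist (lrp_nodes d N) E a y \<le> graph_dist (lrp_nodes d N) E a x + graph_dist (lrp_nodes d N) E x y"
      by (rule graph_dist_triangle)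
    also have "\<dots> \<le> enat r + 1"
      by (rule add_mono[OF a(2) graph_dist_edge[OF xV x(4,2)]])
    also have "\<dots> = enat (Suc r)" by (simp add: one_enat_def)
    finally have "graph_dist (lrp_nodes d N) E a y \<le> enat (Suc r)" .
    moreover have "ldist d x y \<le> R2" using x(3) by (simp add: mid_pairs_def pair_length_eq)
    then have "ldist d a y \<le> Suc r * R2" using a(3) ldist_triangle[of d a y x] by simp
    ultimately show ?thesis using a(1) by blast
  qed
qed

text \<open>The two explored sets stay more than \<open>R2\<close> apart, so fixing them says
  nothing about the edges between them. More than K^2 such pairs of length at most
  \<open>d * N\<close> are then all absent.\<close>

lemma prob_explored_not_joined:
  fixes \<beta> K :: real
  assumes "\<beta> > 0" "d \<ge> 1" "A \<subseteq> lrp_nodes d N" "B \<subseteq> lrp_nodes d N" "K \<ge> 0" "N \<ge> 1"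
    and far: "\<And>a b. a \<in> A \<Longrightarrow> b \<in> B \<Longrightarrow> 2 * (T * R2) + R2 < ldist d a b"
  shows "measure_pmf.prob (lrp_graph d \<beta> (real d) N)
      {E. K < real (card (explored E A T)) \<and> K < real (card (explored E B T)) \<and>
        E \<inter> cross (explored E A T) (explored E B T) = {}}
    \<le> exp (- \<beta> * K * K / real (d * N) ^ d)"
proof -
  let ?P = "measure_pmf.prob (lrp_graph d \<beta> (real d) N)" and ?V = "lrp_nodes d N"
  let ?q = "exp (- \<beta> * K * K / real (d * N) ^ d)"
  define W where "W = {(X, Y). X \<subseteq> ?V \<and> Y \<subseteq> ?V \<and> K < real (card X) \<and> K < real (card Y) \<and>
    (\<forall>u\<in>X. \<forall>v\<in>Y. R2 < ldist d u v)}"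
  define X where "X z = {E. explored E A T = fst z \<and> explored E B T = snd z}" for z
  define Y where "Y z = {E. E \<inter> cross (fst z) (snd z) = {}}" for z :: "(nat \<Rightarrow> int) set \<times> (nat \<Rightarrow> int) set"
  have finW: "finite W"
    by (rule finite_subset[of _ "Pow ?V \<times> Pow ?V"]) (auto simp: W_def)
  have "?P {E. K < real (card (explored E A T)) \<and> K < real (card (explored E B T)) \<and>
        E \<inter> cross (explored E A T) (explored E B T) = {}} \<le> ?P (\<Union>z\<in>W. X z \<inter> Y z)"
  proof (intro measure_pmf.finite_measure_mono subsetI)
    fix E assume E: "E \<in> {E. K < real (card (explored E A T)) \<and> K < real (card (explored E B T)) \<and>
        E \<inter> cross (explored E A T) (explored E B T) = {}}"
    have "R2 < ldist d u v" if uv: "u \<in> explored E A T" "v \<in> explored E B T" for u v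
    proof -
      obtain a where a: "a \<in> A" "ldist d a u \<le> T * R2" using explored_near[OF uv(1) assms(3)] by blast
      obtain b where b: "b \<in> B" "ldist d b v \<le> T * R2" using explored_near[OF uv(2) assms(4)] by blast
      have "ldist d a b \<le> ldist d a u + (ldist d u v + ldist d v b)"
        using ldist_triangle[of d a b u] ldist_triangle[of d u b v] by linarith
      then show ?thesis using far[OF a(1) b(1)] a(2) b(2) ldist_commute[of d b v] by linarith
    qed
    then have "(explored E A T, explored E B T) \<in> W"
      using E explored_subset_nodes assms(3,4) by (auto simp: W_def)
    moreover have "E \<in> X (explored E A T, explored E B T) \<inter> Y (explored E A T, explored E B T)"
      using E by (simp add: X_def Y_def)
    ultimately show "E \<in> (\<Union>z\<in>W. X z \<inter> Y z)" by blast
  qed simp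
  also have "\<dots> \<le> (\<Sum>z\<in>W. ?P (X z \<inter> Y z))"
    using finW by (intro measure_pmf.finite_measure_subadditive_finite) auto
  also have "\<dots> \<le> (\<Sum>z\<in>W. ?P (X z) * ?q)"
  proof (rule sum_mono)
    fix z assume z: "z \<in> W"
    have zW: "fst z \<subseteq> ?V" "snd z \<subseteq> ?V" "K < real (card (fst z))" "K < real (card (snd z))"
      "\<And>u v. u \<in> fst z \<Longrightarrow> v \<in> snd z \<Longrightarrow> R2 < ldist d u v" using z by (auto simp: W_def)
    have disj: "fst z \<inter> snd z = {}"
      using zW(5) by (metis disjoint_iff ldist_self not_less_zero)
    have "?P (X z \<inter> Y z) = ?P (X z) * ?P (Y z)"
      unfolding lrp_graph_eq_rand_set
    proof (rule prob_rand_set_Int[OF finite_lrp_pairs])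
      show "mid_pairs \<inter> cross (fst z) (snd z) = {}"
        using zW(5) by (fastforce simp: mid_pairs_def cross_def pair_length_eq)
      show "E \<inter> mid_pairs \<in> X z \<longleftrightarrow> E \<in> X z" for E by (simp add: X_def explored_def explore_mid)
      show "E \<inter> cross (fst z) (snd z) \<in> Y z \<longleftrightarrow> E \<in> Y z" for E by (simp add: Y_def)
    qed
    also have "?P (Y z) \<le> ?q"
    proof -
      have "?P (Y z) \<le> exp (- \<beta> * real (card (fst z)) * real (card (snd z)) / real (d * N) powr real d)"
        unfolding Y_def using assms(1,2) zW(1,2) disj
        by (intro prob_no_edge_between) (auto intro: ldist_nodes_le[OF subsetD[OF zW(1)] subsetD[OF zW(2)]])
      also have "real (d * N) powr real d = real (d * N) ^ d"
      proof -
        have "0 < d * N" using assms(2,6) by simp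
        then show ?thesis by (intro powr_realpow) (simp only: of_nat_0_less_iff)
      qed
      also have "exp (- \<beta> * real (card (fst z)) * real (card (snd z)) / real (d * N) ^ d) \<le> ?q"
      proof -
        have "K * K \<le> real (card (fst z)) * real (card (snd z))"
          using zW(3,4) assms(5) by (intro mult_mono) auto
        then have "\<beta> * (K * K) \<le> \<beta> * (real (card (fst z)) * real (card (snd z)))"
          using assms(1) by (intro mult_left_mono) auto
        then show ?thesis by (simp add: divide_right_mono mult.assoc)
      qed
      finally show ?thesis .
    qed
    finally show "?P (X z \<inter> Y z) \<le> ?P (X z) * ?q" by (simp add: mult_left_mono)
  qed
  also have "\<dots> = ?P (\<Union>z\<in>W. X z) * ?q"
  proof -
    have "disjoint_family_on X W" by (auto simp: disjoint_family_on_def X_def prod_eq_iff)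
    then have "?P (\<Union>z\<in>W. X z) = (\<Sum>z\<in>W. ?P (X z))"
      using finW by (intro measure_pmf.finite_measure_finite_Union) auto
    then show ?thesis by (simp add: sum_distrib_right)
  qed
  also have "\<dots> \<le> 1 * ?q" by (intro mult_right_mono) auto
  finally show ?thesis by simp
qed

end

text \<open>For each \<open>t\<close> the set \<open>Y t\<close> consists of t^(d-1) points that
  differ from \<open>x\<close> by exactly \<open>t\<close> in coordinate 0 and by less than
  \<open>t\<close> in the others. Their distance is between \<open>t\<close> and
  \<open>d * t\<close>, so together they weigh at least 1 / (d^d t), and summing over
  \<open>t\<close> gives the logarithm.\<close>

lemma mid_degree_ge:
  fixes a b :: nat
  assumes "d \<ge> 1" "x \<in> lrp_nodes d N" "1 \<le> a" "a \<le> b" "R1 \<le> a" "d * b \<le> R2" "2 * b \<le> N"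
  shows "ln (real b / real a) / real d ^ d \<le>
    (\<Sum>y\<in>{y\<in>lrp_nodes d N. {x, y} \<in> mid_pairs d N R1 R2}. 1 / real (ldist d x y) powr real d)"
proof -
  let ?T = "{y\<in>lrp_nodes d N. {x, y} \<in> mid_pairs d N R1 R2}"
  \<comment> \<open>In each coordinate the points lie on the side of \<open>x\<close> with more
    room, so that t < b \<le> N/2 keeps them inside the cube.\<close>
  define J where "J t j = (if j = 0 then (if 2 * x 0 \<le> int N then {x 0 + int t} else {x 0 - int t})
    else (if 2 * x j \<le> int N then {x j..<x j + int t} else {x j - int t<..x j}))" for t j :: nat
  define Y where "Y t = (\<Pi>\<^sub>E j\<in>{..<d}. J t j)" for t
  have finY: "finite (Y t)" for t by (auto simp: Y_def J_def intro!: finite_PiE)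
  have cardY: "card (Y t) = t ^ (d - 1)" for t
  proof -
    obtain k where k: "d = Suc k" using assms(1) by (cases d) auto
    have "card (Y t) = (\<Prod>j<d. card (J t j))" by (simp add: Y_def card_PiE)
    also have "\<dots> = (\<Prod>j<d. if j = 0 then 1 else t)"
      by (intro prod.cong refl) (simp add: J_def)
    also have "\<dots> = t ^ (d - 1)"
      by (simp add: k prod.lessThan_Suc_shift del: prod.lessThan_Suc)
    finally show ?thesis .
  qed
  have Yc: "y j \<in> J t j" if "y \<in> Y t" "j < d" for y t j
    using PiE_mem[of y "{..<d}" "J t" j] that by (simp add: Y_def)
  have Y0: "\<bar>x 0 - y 0\<bar> = int t" if "y \<in> Y t" for y t
    using Yc[OF that, of 0] assms(1) by (auto simp: J_def split: if_splits)
  have Yj: "\<bar>x j - y j\<bar> \<le> int t" if "y \<in> Y t" "j < d" for y t j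
    using Yc[OF that] by (auto simp: J_def split: if_splits)
  have ge: "t \<le> ldist d x y" if "y \<in> Y t" for y t
    using coord_le_ldist[of 0 d x y] Y0[OF that] assms(1) by simp
  have le: "ldist d x y \<le> d * t" if "y \<in> Y t" for y t
    using Yj[OF that] by (intro ldist_le)
  have YV: "y \<in> lrp_nodes d N" if "y \<in> Y t" "t < b" for y t
    unfolding lrp_nodes_def
  proof (rule PiE_I)
    fix j assume "j \<in> {..<d}"
    then show "y j \<in> {0..int N}"
      using Yc[OF that(1), of j] lrp_nodes_coord[OF assms(2), of j] that(2) assms(7)
      by (auto simp: J_def split: if_splits)
  next
    fix j assume "j \<notin> {..<d}"
    then show "y j = undefined" using PiE_arb[of y "{..<d}" "J t" j] that(1) by (simp add: Y_def)
  qed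
  have YT: "Y t \<subseteq> ?T" if t: "t \<in> {a..<b}" for t
  proof
    fix y assume y: "y \<in> Y t"
    have V: "y \<in> lrp_nodes d N" using YV[OF y] t by simp
    have "R1 \<le> ldist d x y" "1 \<le> ldist d x y" using ge[OF y] t assms by auto
    moreover have "ldist d x y \<le> R2"
    proof -
      have "d * t \<le> d * b" using t by (intro mult_left_mono) auto
      then show ?thesis using le[OF y] assms(6) by linarith
    qed
    moreover have "x \<noteq> y" using \<open>1 \<le> ldist d x y\<close> by auto
    ultimately show "y \<in> ?T" using V assms(2) by (auto simp: mid_pairs_def lrp_pairs_def pair_length_eq)
  qed
  have disj: "Y t \<inter> Y t' = {}" if "t \<noteq> t'" for t t'
    using Y0[of _ t] Y0[of _ t'] that by (metis disjoint_iff of_nat_eq_iff)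
  have "ln (real b / real a) / real d ^ d \<le> (\<Sum>t=a..<b. 1 / real t) / real d ^ d"
    using assms(3,4) by (intro divide_right_mono ln_le_sum_reciprocals) auto
  also have "\<dots> = (\<Sum>t=a..<b. real (card (Y t)) * (1 / real (d * t) powr real d))"
    unfolding sum_divide_distrib
  proof (intro sum.cong refl)
    fix t assume "t \<in> {a..<b}"
    then have t: "t > 0" using assms(3) by simp
    then have "0 < d * t" using assms(1) by simp
    then have "0 < real (d * t)" by (simp only: of_nat_0_less_iff)
    then have "real (d * t) powr real d = real (d * t) ^ d" by (rule powr_realpow)
    also have "\<dots> = real d ^ d * real t ^ d"
      by (simp add: power_mult_distrib)
    also have "real t ^ d = real t ^ (d - 1) * real t"
      using assms(1) by (intro power_minus_mult[symmetric]) simp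
    finally show "1 / real t / real d ^ d = real (card (Y t)) * (1 / real (d * t) powr real d)"
      using t by (simp add: cardY)
  qed
  also have "\<dots> \<le> (\<Sum>t=a..<b. \<Sum>y\<in>Y t. 1 / real (ldist d x y) powr real d)"
  proof (rule sum_mono)
    fix t assume t: "t \<in> {a..<b}"
    have "real (card (Y t)) * (1 / real (d * t) powr real d) = (\<Sum>y\<in>Y t. 1 / real (d * t) powr real d)" by simp
    also have "\<dots> \<le> (\<Sum>y\<in>Y t. 1 / real (ldist d x y) powr real d)"
    proof (rule sum_mono)
      fix y assume y: "y \<in> Y t"
      have "0 < ldist d x y" using ge[OF y] t assms(3) by auto
      moreover have "real (ldist d x y) \<le> real (d * t)" using le[OF y] by (simp only: of_nat_le_iff)
      ultimately show "1 / real (d * t) powr real d \<le> 1 / real (ldist d x y) powr real d"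
        by (intro frac_le powr_mono2) auto
    qed
    finally show "real (card (Y t)) * (1 / real (d * t) powr real d) \<le> (\<Sum>y\<in>Y t. 1 / real (ldist d x y) powr real d)" .
  qed
  also have "\<dots> = (\<Sum>y\<in>(\<Union>t\<in>{a..<b}. Y t). 1 / real (ldist d x y) powr real d)"
    using finY disj by (intro sum.UNION_disjoint[symmetric]) auto
  also have "\<dots> \<le> (\<Sum>y\<in>?T. 1 / real (ldist d x y) powr real d)"
    by (rule sum_mono2[OF _ UN_least[OF YT]]) auto
  finally show ?thesis .
qed

text \<open>Pigeonhole in coordinate 0: the values 0, \<open>h\<close> and \<open>N\<close> are
  pairwise at least 2F apart, so each of \<open>x 0\<close> and \<open>y 0\<close> is within less
  than \<open>F\<close> of at most one of them.\<close>

lemma far_point_exists: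
  assumes "d \<ge> 1" "x \<in> lrp_nodes d N" "y \<in> lrp_nodes d N" "4 * F \<le> N"
  shows "\<exists>z\<in>lrp_nodes d N. F \<le> ldist d x z \<and> F \<le> ldist d z y"
proof -
  define h where "h = int N div 2"
  have h: "2 * int F \<le> h" "h \<le> int N - 2 * int F" using assms(4) by (auto simp: h_def)
  have "\<exists>v\<in>{0, h, int N}. int F \<le> \<bar>x 0 - v\<bar> \<and> int F \<le> \<bar>v - y 0\<bar>"
  proof (rule ccontr)
    assume "\<not> ?thesis"
    then have "(\<bar>x 0 - 0\<bar> < int F \<or> \<bar>0 - y 0\<bar> < int F)" "(\<bar>x 0 - h\<bar> < int F \<or> \<bar>h - y 0\<bar> < int F)"
      "(\<bar>x 0 - int N\<bar> < int F \<or> \<bar>int N - y 0\<bar> < int F)" by (auto simp: not_le)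
    then show False using h by linarith
  qed
  then obtain v where v: "v \<in> {0, h, int N}" "int F \<le> \<bar>x 0 - v\<bar>" "int F \<le> \<bar>v - y 0\<bar>" by blast
  define z where "z = x(0 := v)"
  have "0 \<le> v" "v \<le> int N" using v(1) h by auto
  then have zV: "z \<in> lrp_nodes d N"
    using assms(1,2) by (auto simp: z_def lrp_nodes_def PiE_def extensional_def Pi_def)
  have "\<bar>x 0 - z 0\<bar> \<le> int (ldist d x z)" "\<bar>z 0 - y 0\<bar> \<le> int (ldist d z y)"
    using assms(1) by (auto intro!: coord_le_ldist)
  then have "F \<le> ldist d x z" "F \<le> ldist d z y" using v(2,3) by (auto simp: z_def)
  then show ?thesis using zV by blast
qed

text \<open>The searches start from boxes of side \<open>m\<close> because a single node would fail
  with probability exp (-g), with g of order ln N and a possibly small constant, too much for a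
  union bound over all nodes. Walking inside a box costs at most \<open>d * m\<close>. Nodes that
  are close to each other are connected through a third node far from both, which doubles the
  length.\<close>

lemma prob_diameter_gt_explore:
  fixes \<beta> w K g :: real and d N R1 R2 T m F :: nat
  assumes "\<beta> > 0" "2 \<le> R1" "d \<ge> 1" "N \<ge> 1"
    and K: "1 \<le> K" "K \<le> real R1 ^ d" "\<beta> * K \<le> real R1 ^ d"
    and w: "\<And>x. x \<in> lrp_nodes d N \<Longrightarrow> w \<le> (\<Sum>y\<in>{y\<in>lrp_nodes d N. {x, y} \<in> mid_pairs d N R1 R2}. 1 / real (ldist d x y) powr real d)"
    and g: "g = \<beta> * (w - 1) / 8" "g \<ge> 1" "K \<le> g ^ T"
    and m: "2 \<le> m" "m \<le> Suc N"
    and F: "2 * (T * R2) + R2 + 2 * (d * m) < F" "4 * F \<le> N"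
    and L: "real (2 * (2 * (T + d * m) + 1)) \<le> L"
  shows "measure_pmf.prob (lrp_graph d \<beta> (real d) N) (- {E. lrp_diameter d N E \<le> ereal L})
    \<le> real (Suc N) ^ d * (real T * exp (- g * real m)) + real (Suc N) ^ (2 * d) * exp (- \<beta> * K * K / real (d * N) ^ d)"
proof -
  let ?P = "measure_pmf.prob (lrp_graph d \<beta> (real d) N)" and ?V = "lrp_nodes d N"
  let ?X = "\<lambda>E a. explored d N R1 R2 E (lbox d a m) T"
  define W where "W = {a\<in>?V. lbox d a m \<subseteq> ?V}"
  define W2 where "W2 = {z\<in>W \<times> W. \<forall>u\<in>lbox d (fst z) m. \<forall>v\<in>lbox d (snd z) m. 2 * (T * R2) + R2 < ldist d u v}"
  let ?B1 = "\<lambda>a. {E. real (card (?X E a)) \<le> K}"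
  let ?B2 = "\<lambda>z. {E. K < real (card (?X E (fst z))) \<and> K < real (card (?X E (snd z))) \<and>
    E \<inter> cross (?X E (fst z)) (?X E (snd z)) = {}}"
  have fin: "finite W" "finite W2"
    by (rule finite_subset[of _ ?V], auto simp: W_def) (rule finite_subset[of _ "?V \<times> ?V"], auto simp: W_def W2_def)
  have "?P (- {E. lrp_diameter d N E \<le> ereal L}) \<le> ?P ((\<Union>a\<in>W. ?B1 a) \<union> (\<Union>z\<in>W2. ?B2 z))"
  proof (rule prob_pmf_mono, rule ccontr)
    fix E assume E: "E \<in> set_pmf (lrp_graph d \<beta> (real d) N)" "E \<in> - {E. lrp_diameter d N E \<le> ereal L}"
      "E \<notin> (\<Union>a\<in>W. ?B1 a) \<union> (\<Union>z\<in>W2. ?B2 z)"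
    let ?d = "graph_dist ?V E"
    have U: "unit_pairs d N \<subseteq> E" by (rule unit_pairs_subset[OF E(1)])
    have Vbox: "lbox d (\<lambda>_. 0) (Suc N) \<subseteq> ?V" by (simp add: lrp_nodes_eq_lbox)
    have lat: "?d u v \<le> enat (ldist d u v)" if "u \<in> ?V" "v \<in> ?V" for u v
      using graph_dist_box_le_ldist[OF Vbox U, of u v] that by (simp add: lrp_nodes_eq_lbox)
    have reach: "?d x u \<le> enat (T + d * m)" if axu: "a \<in> W" "x \<in> lbox d a m" "u \<in> ?X E a" for x a u
    proof -
      have A: "lbox d a m \<subseteq> ?V" using axu(1) by (simp add: W_def)
      obtain c where c: "c \<in> lbox d a m" "?d c u \<le> enat T"
        using explored_near[OF axu(3) A] by blast
      have "?d x u \<le> ?d x c + ?d c u" by (rule graph_dist_triangle)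
      also have "\<dots> \<le> enat (ldist d x c) + enat T" using c axu(2) A by (intro add_mono lat) auto
      also have "\<dots> \<le> enat (T + d * m)" using ldist_box_le[OF axu(2) c(1)] by simp
      finally show ?thesis .
    qed
    have far: "?d x y \<le> enat (2 * (T + d * m) + 1)" if xy: "x \<in> ?V" "y \<in> ?V" "F \<le> ldist d x y" for x y
    proof -
      obtain a where a: "a \<in> lbox d a m" "x \<in> lbox d a m" "lbox d a m \<subseteq> ?V"
        using subbox_exists[of x d "\<lambda>_. 0" "Suc N" m] xy(1) m by (auto simp: lrp_nodes_eq_lbox)
      obtain b where b: "b \<in> lbox d b m" "y \<in> lbox d b m" "lbox d b m \<subseteq> ?V"
        using subbox_exists[of y d "\<lambda>_. 0" "Suc N" m] xy(2) m by (auto simp: lrp_nodes_eq_lbox)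
      have W: "a \<in> W" "b \<in> W" using a b by (auto simp: W_def)
      have "2 * (T * R2) + R2 < ldist d u v" if "u \<in> lbox d a m" "v \<in> lbox d b m" for u v
      proof -
        have "ldist d x y \<le> ldist d x u + (ldist d u v + ldist d v y)"
          using ldist_triangle[of d x y u] ldist_triangle[of d u y v] by linarith
        moreover have "ldist d x u \<le> d * m" "ldist d v y \<le> d * m"
          using ldist_box_le a(2) b(2) that by blast+
        ultimately show ?thesis using xy(3) F(1) by linarith
      qed
      then have "(a, b) \<in> W2" using W by (simp add: W2_def)
      then have "E \<notin> ?B2 (a, b)" using E(3) by blast
      moreover have "E \<notin> ?B1 a" "E \<notin> ?B1 b" using E(3) W by auto
      ultimately have "E \<inter> cross (?X E a) (?X E b) \<noteq> {}" by (simp add: not_le)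
      then obtain u v where uv: "u \<in> ?X E a" "v \<in> ?X E b" "{u, v} \<in> E" by (auto simp: cross_def)
      have uvV: "u \<in> ?V" "v \<in> ?V"
        using explored_subset_nodes[OF a(3)] explored_subset_nodes[OF b(3)] uv by blast+
      have "?d x y \<le> ?d x u + ?d u y" by (rule graph_dist_triangle)
      also have "\<dots> \<le> ?d x u + (?d u v + ?d v y)" by (intro add_left_mono graph_dist_triangle)
      also have "\<dots> \<le> enat (T + d * m) + (1 + enat (T + d * m))"
        using reach[OF W(1) a(2) uv(1)] reach[OF W(2) b(2) uv(2)] graph_dist_edge[OF uvV uv(3)]
        by (intro add_mono) (simp_all add: graph_dist_commute[of _ _ v y])
      also have "\<dots> = enat (2 * (T + d * m) + 1)" by (simp add: one_enat_def)
      finally show ?thesis .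
    qed
    have "?d x y \<le> enat (2 * (2 * (T + d * m) + 1))" if xy: "x \<in> ?V" "y \<in> ?V" for x y
    proof -
      obtain z where z: "z \<in> ?V" "F \<le> ldist d x z" "F \<le> ldist d z y"
        using far_point_exists[OF assms(3) xy F(2)] by blast
      have "?d x y \<le> ?d x z + ?d z y" by (rule graph_dist_triangle)
      also have "\<dots> \<le> enat (2 * (T + d * m) + 1) + enat (2 * (T + d * m) + 1)"
        using xy z by (intro add_mono far) auto
      also have "\<dots> = enat (2 * (2 * (T + d * m) + 1))" by simp
      finally show ?thesis .
    qed
    then have "graph_diameter ?V E \<le> enat (2 * (2 * (T + d * m) + 1))" by (simp only: graph_diameter_le_iff) blast
    then have "lrp_diameter d N E \<le> ereal_of_enat (enat (2 * (2 * (T + d * m) + 1)))"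
      by (simp only: ereal_of_enat_le_iff)
    also have "\<dots> \<le> ereal L" using L by (simp only: ereal_of_enat_simps ereal_less_eq)
    finally show False using E(2) by simp
  qed
  also have "\<dots> \<le> ?P (\<Union>a\<in>W. ?B1 a) + ?P (\<Union>z\<in>W2. ?B2 z)"
    by (rule measure_Un_le) auto
  also have "\<dots> \<le> (\<Sum>a\<in>W. ?P (?B1 a)) + (\<Sum>z\<in>W2. ?P (?B2 z))"
    using fin by (intro add_mono measure_pmf.finite_measure_subadditive_finite) auto
  also have "\<dots> \<le> (\<Sum>a\<in>W. real T * exp (- g * real m)) + (\<Sum>z\<in>W2. exp (- \<beta> * K * K / real (d * N) ^ d))"
  proof (intro add_mono sum_mono)
    fix a assume a: "a \<in> W"
    have mc: "m \<le> card (lbox d a m)"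
      unfolding card_lbox using m(1) assms(3) by (intro self_le_power) auto
    have "?P (?B1 a) \<le> real T * exp (- g * real (card (lbox d a m)))"
      using a mc m(1) by (intro prob_explored_small[OF assms(1,2,3) _ _ K w g]) (auto simp: W_def)
    also have "\<dots> \<le> real T * exp (- g * real m)"
      using mc g(2) by (intro mult_left_mono) (auto intro!: mult_left_mono)
    finally show "?P (?B1 a) \<le> real T * exp (- g * real m)" .
  next
    fix z assume z: "z \<in> W2"
    show "?P (?B2 z) \<le> exp (- \<beta> * K * K / real (d * N) ^ d)"
      using z K(1) by (intro prob_explored_not_joined[OF assms(1,3) _ _ _ assms(4)]) (auto simp: W2_def W_def)
  qed
  also have "\<dots> = real (card W) * (real T * exp (- g * real m)) + real (card W2) * exp (- \<beta> * K * K / real (d * N) ^ d)"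
    by simp
  also have "\<dots> \<le> real (Suc N) ^ d * (real T * exp (- g * real m)) + real (Suc N) ^ (2 * d) * exp (- \<beta> * K * K / real (d * N) ^ d)"
  proof (intro add_mono mult_right_mono)
    have "card W \<le> card ?V" by (intro card_mono) (auto simp: W_def)
    then have "real (card W) \<le> real (card ?V)" by (simp only: of_nat_le_iff)
    then show "real (card W) \<le> real (Suc N) ^ d" by (simp add: card_lrp_nodes)
    have "card W2 \<le> card (?V \<times> ?V)" by (intro card_mono) (auto simp: W_def W2_def)
    then have "real (card W2) \<le> real (card (?V \<times> ?V))" by (simp only: of_nat_le_iff)
    also have "real (card (?V \<times> ?V)) = real (Suc N) ^ (2 * d)"
      by (simp add: card_cartesian_product card_lrp_nodes power_add mult_2)
    finally show "real (card W2) \<le> real (Suc N) ^ (2 * d)" .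
  qed auto
  finally show ?thesis .
qed

theorem diameter_le_ln_over_ln_ln:
  fixes d :: nat and \<beta> :: real
  assumes "\<beta> > 0" "d \<ge> 1"
  shows "\<exists>C>0. (\<lambda>N. measure_pmf.prob (lrp_graph d \<beta> (real d) N)
    {E. lrp_diameter d N E \<le> ereal (C * ln (real N) / ln (ln (real N)))}) \<longlonglongrightarrow> 1"
proof -
  define D where "D = real d"
  have D: "D \<ge> 1" using assms(2) by (simp add: D_def)
  \<comment> \<open>The ratio of the largest to the smallest intermediate length is about N^(1/5);
    half of that exponent absorbs constants and leaves 1/10. The factor d^d is the one in
    \<open>mid_degree_ge\<close>.\<close>
  define c where "c = 1 / (10 * real d ^ d)"
  have c: "c > 0" using assms(2) by (simp add: c_def)
  define g where "g N = \<beta> * (c * ln (real N) - 1) / 8" for N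
  \<comment> \<open>Since g is at least \<beta> c / 16 ln N, this constant side gives g m \<ge> (D +
    2) ln N, hence failures of probability at most N^(-D-2) per starting box.\<close>
  define m where "m = nat \<lceil>max 2 (16 * (D + 2) / (\<beta> * c))\<rceil>"
  have m: "real m \<ge> 2" "real m \<ge> 16 * (D + 2) / (\<beta> * c)" unfolding m_def by linarith+
  define M where "M = real m"
  have M: "M \<ge> 2" using m by (simp add: M_def)
  \<comment> \<open>Bounds the number of steps ln K / ln g with ln K = 6/10 D ln N and ln g \<ge>
    1/2 ln ln N; the summand 1 is for rounding up.\<close>
  define \<tau> where "\<tau> N = 12 / 10 * D * ln (real N) / ln (ln (real N)) + 1" for N
  \<comment> \<open>The length is about 4 \<open>\<tau> N\<close>, with leading coefficient 4.8 D; 5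
    D leaves room for the bounded terms.\<close>
  have "(\<lambda>N. measure_pmf.prob (lrp_graph d \<beta> (real d) N)
    {E. lrp_diameter d N E \<le> ereal ((5 * D) * ln (real N) / ln (ln (real N)))}) \<longlonglongrightarrow> 1"
  proof (rule prob_tendsto_1I)
    let ?b = "\<lambda>N. real (Suc N) powr D * (\<tau> N * real N powr - (D + 2)) +
      real (Suc N) powr (2 * D) * exp (- \<beta> * real N powr (6 / 10 * D) * real N powr (6 / 10 * D) / (D * real N) powr D)"
    show "?b \<longlonglongrightarrow> 0"
      unfolding \<tau>_def using D assms(1) by real_asymp
    have "\<forall>\<^sub>F N in sequentially. 2 \<le> real N powr (7 / 10)" by real_asymp
    moreover have "\<forall>\<^sub>F N in sequentially. real N powr (9 / 10) \<ge> 8 * D" using D by real_asymp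
    moreover have "\<forall>\<^sub>F N in sequentially. 2 * real N powr (9 / 10) \<le> real N" by real_asymp
    moreover have "\<forall>\<^sub>F N in sequentially. ln (real N powr (9 / 10) / (4 * D) / (2 * real N powr (7 / 10))) \<ge> 1 / 10 * ln (real N)"
      using D by real_asymp
    moreover have "\<forall>\<^sub>F N in sequentially. real N powr (9 / 10) / (4 * D) \<ge> 2 * real N powr (7 / 10)"
      using D by real_asymp
    moreover have "\<forall>\<^sub>F N in sequentially. \<beta> * real N powr (6 / 10 * D) \<le> real N powr (7 / 10 * D)"
      using D assms(1) by real_asymp
    moreover have "\<forall>\<^sub>F N in sequentially. g N \<ge> \<beta> * c / 16 * ln (real N)"
      unfolding g_def using c assms(1) by real_asymp
    moreover have "\<forall>\<^sub>F N in sequentially. g N \<ge> sqrt (ln (real N))"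
      unfolding g_def using c assms(1) by real_asymp
    moreover have "\<forall>\<^sub>F N in sequentially. 2 * (\<tau> N * real N powr (9 / 10)) + real N powr (9 / 10) + 2 * (D * M) < real N / 4 - 1"
      unfolding \<tau>_def using D M by real_asymp
    moreover have "\<forall>\<^sub>F N in sequentially. 4 * \<tau> N + 4 * (D * M) + 2 \<le> (5 * D) * ln (real N) / ln (ln (real N))"
      unfolding \<tau>_def using D M by real_asymp
    moreover have "\<forall>\<^sub>F N in sequentially. ln (real N) > exp 1" by real_asymp
    ultimately show "\<forall>\<^sub>F N in sequentially. measure_pmf.prob (lrp_graph d \<beta> (real d) N)
        (- {E. lrp_diameter d N E \<le> ereal ((5 * D) * ln (real N) / ln (ln (real N)))}) \<le> ?b N"
      using eventually_ge_at_top[of "max 2 m"]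
    proof eventually_elim
      case (elim N)
      have N: "N \<ge> 2" "m \<le> N" using elim(12) by auto
      define R1 where "R1 = nat \<lceil>real N powr (7 / 10)\<rceil>"
      define R2 where "R2 = nat \<lfloor>real N powr (9 / 10)\<rfloor>"
      \<comment> \<open>The largest value with \<open>d * b \<le> R2\<close>, so that moving by at
        most \<open>b\<close> in every coordinate gives an intermediate pair.\<close>
      define b where "b = R2 div d"
      \<comment> \<open>\<open>K * K\<close> is N^(1.2 D), a power larger than (D N)^D, whereas
        \<open>K\<close> stays below N^(0.7 D) \<le> R1^d.\<close>
      define K where "K = real N powr (6 / 10 * D)"
      define T where "T = nat \<lceil>ln K / ln (g N)\<rceil>"
      define F where "F = N div 4"
      have R1: "real N powr (7 / 10) \<le> real R1" "real R1 \<le> 2 * real N powr (7 / 10)"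
        using elim(1) unfolding R1_def by linarith+
      have R2: "real R2 \<le> real N powr (9 / 10)" "real N powr (9 / 10) - 1 \<le> real R2"
        using elim(2) D unfolding R2_def by linarith+
      have lnN: "ln (real N) > exp 1" by (rule elim(11))
      have lnN1: "ln (real N) > 1" using lnN exp_ge_add_one_self[of 1] by linarith
      have lnlnN: "ln (ln (real N)) > 1"
      proof -
        have "ln (exp 1) < ln (ln (real N))" using lnN lnN1 by (subst ln_less_cancel_iff) auto
        then show ?thesis by simp
      qed
      have g1: "g N > 1" using elim(8) lnN1 by (meson less_le_trans real_sqrt_gt_1_iff)
      have lng: "ln (g N) \<ge> ln (ln (real N)) / 2"
      proof -
        have "ln (sqrt (ln (real N))) \<le> ln (g N)" using elim(8) g1 lnN1 by (subst ln_le_cancel_iff) auto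
        then show ?thesis using lnN1 by (simp add: ln_sqrt)
      qed
      have lnK: "ln K = 6 / 10 * D * ln (real N)" using N by (simp add: K_def ln_powr)
      have T: "real T \<le> \<tau> N"
      proof -
        have "ln K / ln (g N) \<le> ln K / (ln (ln (real N)) / 2)"
        proof (intro divide_left_mono mult_pos_pos)
          show "0 \<le> ln K" unfolding lnK using D lnN1 by (intro mult_nonneg_nonneg) auto
        qed (use lng lnlnN g1 in auto)
        also have "\<dots> = 12 / 10 * D * ln (real N) / ln (ln (real N))" by (simp add: lnK)
        finally have "ln K / ln (g N) + 1 \<le> \<tau> N" by (simp add: \<tau>_def)
        moreover have "0 \<le> ln K / ln (g N)"
        proof (rule divide_nonneg_pos)
          show "0 \<le> ln K" unfolding lnK using D lnN1 by (intro mult_nonneg_nonneg) auto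
        qed (use g1 in simp)
        ultimately show ?thesis unfolding T_def by linarith
      qed
      have KT: "K \<le> g N ^ T"
      proof -
        have "ln K / ln (g N) \<le> real T" unfolding T_def by linarith
        then have "ln K \<le> real T * ln (g N)" using g1 by (simp add: pos_divide_le_eq)
        also have "\<dots> = ln (g N ^ T)" using g1 by (simp add: ln_realpow)
        finally have "ln K \<le> ln (g N ^ T)" .
        moreover have "0 < K" "0 < g N ^ T" using g1 N by (simp_all add: K_def)
        ultimately show ?thesis by (simp only: ln_le_cancel_iff)
      qed
      have b: "real b \<ge> real N powr (9 / 10) / (4 * D)"
      proof -
        have "R2 < d * Suc b" unfolding b_def using assms(2) by (simp add: dividend_less_times_div)
        then have "real R2 < real (d * Suc b)" by (simp only: of_nat_less_iff)
        then have "real R2 < D * (real b + 1)" by (simp add: D_def algebra_simps)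
        then have "real N powr (9 / 10) - 1 < D * (real b + 1)" using R2(2) by linarith
        then have "real N powr (9 / 10) / 4 \<le> D * real b" using elim(2) D by (simp add: algebra_simps)
        then show ?thesis using D by (simp add: field_simps)
      qed
      have R1b: "real R1 \<le> real b" using R1(2) b elim(5) by linarith
      have R1_2: "2 \<le> real R1" using R1(1) elim(1) by linarith
      have w: "c * ln (real N) \<le> (\<Sum>y\<in>{y\<in>lrp_nodes d N. {x, y} \<in> mid_pairs d N R1 R2}. 1 / real (ldist d x y) powr real d)"
        if x: "x \<in> lrp_nodes d N" for x
      proof -
        have "real N powr (9 / 10) / (4 * D) / (2 * real N powr (7 / 10)) \<le> real b / real R1"
          using b R1 R1_2 by (intro frac_le) auto
        moreover have "0 < real N powr (9 / 10) / (4 * D) / (2 * real N powr (7 / 10))"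
          using N D by simp
        ultimately have "ln (real N powr (9 / 10) / (4 * D) / (2 * real N powr (7 / 10))) \<le> ln (real b / real R1)"
          by (intro ln_mono) auto
        then have "1 / 10 * ln (real N) \<le> ln (real b / real R1)" using elim(4) by linarith
        then have "1 / 10 * ln (real N) / real d ^ d \<le> ln (real b / real R1) / real d ^ d"
          by (intro divide_right_mono) auto
        also have "\<dots> \<le> (\<Sum>y\<in>{y\<in>lrp_nodes d N. {x, y} \<in> mid_pairs d N R1 R2}. 1 / real (ldist d x y) powr real d)"
        proof (rule mid_degree_ge[OF assms(2) x])
          show "d * b \<le> R2" by (simp add: b_def)
          have "b \<le> R2" by (simp add: b_def)
          then have "2 * real b \<le> real N" using R2(1) elim(3) by linarith
          then show "2 * b \<le> N" by linarith
        qed (use R1b R1_2 in auto)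
        finally show ?thesis by (simp add: c_def)
      qed
      have R1d: "real N powr (7 / 10 * D) \<le> real R1 ^ d"
      proof -
        have "real N powr (7 / 10 * D) = (real N powr (7 / 10)) powr real d" by (simp add: powr_powr D_def)
        also have "\<dots> \<le> real R1 powr real d" using R1(1) by (intro powr_mono2) auto
        also have "\<dots> = real R1 ^ d" using R1_2 by (intro powr_realpow) simp
        finally show ?thesis .
      qed
      have gm: "exp (- g N * real m) \<le> real N powr - (D + 2)"
      proof -
        have "(D + 2) * ln (real N) = \<beta> * c / 16 * ln (real N) * (16 * (D + 2) / (\<beta> * c))"
          using assms(1) c by simp
        also have "\<dots> \<le> g N * real m" using elim(7) m(2) g1 lnN1 assms(1) c D by (intro mult_mono) auto
        finally have "exp (- g N * real m) \<le> exp (- ((D + 2) * ln (real N)))" by simp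
        also have "\<dots> = real N powr - (D + 2)" using N by (simp add: powr_def algebra_simps)
        finally show ?thesis .
      qed
      have pr: "real (Suc N) ^ k = real (Suc N) powr real k" for k by (simp add: powr_realpow)
      have dN: "real (d * N) ^ d = (D * real N) powr D"
        using N assms(2) by (simp add: D_def powr_realpow flip: of_nat_mult)
      have "measure_pmf.prob (lrp_graph d \<beta> (real d) N)
        (- {E. lrp_diameter d N E \<le> ereal ((5 * D) * ln (real N) / ln (ln (real N)))})
        \<le> real (Suc N) ^ d * (real T * exp (- g N * real m)) + real (Suc N) ^ (2 * d) * exp (- \<beta> * K * K / real (d * N) ^ d)"
      proof (rule prob_diameter_gt_explore[OF assms(1) _ assms(2), where g = "g N" and w = "c * ln (real N)"])
        show "2 \<le> R1" using R1_2 by simp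
        show "1 \<le> N" using N by simp
        show "1 \<le> K" unfolding K_def using N D by (intro ge_one_powr_ge_zero) auto
        have "K \<le> real N powr (7 / 10 * D)" unfolding K_def using N D by (intro powr_mono) auto
        then show "K \<le> real R1 ^ d" using R1d by linarith
        show "\<beta> * K \<le> real R1 ^ d" using elim(6) R1d unfolding K_def by linarith
        show "g N = \<beta> * (c * ln (real N) - 1) / 8" by (simp add: g_def)
        show "1 \<le> g N" using g1 by simp
        show "2 \<le> m" using m(1) by simp
        show "m \<le> Suc N" using N by simp
        show "4 * F \<le> N" by (simp add: F_def)
        have "real T * real R2 \<le> \<tau> N * real N powr (9 / 10)" using T R2(1) by (intro mult_mono) auto
        then have "2 * (real T * real R2) + real R2 + 2 * (D * M) < real N / 4 - 1"
          using elim(9) R2(1) by linarith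
        also have "\<dots> \<le> real F" unfolding F_def by linarith
        finally have "real (2 * (T * R2) + R2 + 2 * (d * m)) < real F" by (simp add: D_def M_def)
        then show "2 * (T * R2) + R2 + 2 * (d * m) < F" by (simp only: of_nat_less_iff)
        have "real (2 * (2 * (T + d * m) + 1)) = 4 * real T + 4 * (D * M) + 2" by (simp add: D_def M_def)
        also have "\<dots> \<le> 4 * \<tau> N + 4 * (D * M) + 2" using T by simp
        also have "\<dots> \<le> (5 * D) * ln (real N) / ln (ln (real N))" by (rule elim(10))
        finally show "real (2 * (2 * (T + d * m) + 1)) \<le> (5 * D) * ln (real N) / ln (ln (real N))" .
      qed (use w KT in auto)
      also have "\<dots> \<le> ?b N"
        unfolding pr dN unfolding K_def[symmetric]
      proof (intro add_mono mult_mono)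
        show "real (Suc N) powr real d \<le> real (Suc N) powr D" by (simp add: D_def)
        show "real (Suc N) powr real (2 * d) \<le> real (Suc N) powr (2 * D)" by (simp add: D_def)
      qed (use T gm in auto)
      finally show ?case .
    qed
  qed
  then show ?thesis using D by (intro exI[of _ "5 * D"]) simp
qed

section \<open>The diameter of long range percolation\<close>

lemma prob_tendsto_1_mono:
  assumes "(\<lambda>N. measure_pmf.prob (M N) (A N)) \<longlonglongrightarrow> 1" "\<forall>\<^sub>F N in sequentially. A N \<subseteq> B N"
  shows "(\<lambda>N. measure_pmf.prob (M N) (B N)) \<longlonglongrightarrow> 1"
proof (rule tendsto_sandwich[OF _ _ assms(1) tendsto_const])
  show "\<forall>\<^sub>F N in sequentially. measure_pmf.prob (M N) (A N) \<le> measure_pmf.prob (M N) (B N)"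
    using assms(2) by eventually_elim (intro measure_pmf.finite_measure_mono, auto)
qed auto

theorem theorem2p1:
  fixes d :: nat and \<beta> s :: real
  assumes "d \<ge> 1" and "\<beta> > 0" and "s > 0"
  shows "\<exists>C\<^sub>1 C\<^sub>2 C\<^sub>s \<delta> \<eta>\<^sub>1 \<eta>\<^sub>2 :: real.
    C\<^sub>1 > 0 \<and> C\<^sub>2 > 0 \<and> C\<^sub>s > 0 \<and> \<delta> > 1 \<and> 0 < \<eta>\<^sub>1 \<and> \<eta>\<^sub>1 < \<eta>\<^sub>2 \<and> \<eta>\<^sub>2 < 1 \<and>
    (s > 2 * real d \<longrightarrow>
      (\<forall>\<psi>::real. \<psi> < (s - 2 * real d) / (s - real d - 1) \<longrightarrow>
        (\<lambda>N. measure_pmf.prob (lrp_graph d \<beta> s N)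
           {E. lrp_diameter d N E \<ge> ereal (real N powr \<psi>)}) \<longlonglongrightarrow> 1)) \<and>
    (s = 2 * real d \<longrightarrow>
      (\<lambda>N. measure_pmf.prob (lrp_graph d \<beta> s N)
         {E. lrp_diameter d N E \<le> ereal (real N powr \<eta>\<^sub>2)}) \<longlonglongrightarrow> 1) \<and>
    (d = 1 \<and> s = 2 \<and> \<beta> < 1 \<longrightarrow>
      (\<lambda>N. measure_pmf.prob (lrp_graph d \<beta> s N)
         {E. lrp_diameter d N E \<ge> ereal (real N powr \<eta>\<^sub>1)}) \<longlonglongrightarrow> 1) \<and>
    (real d < s \<and> s < 2 * real d \<longrightarrow>
      (\<lambda>N. measure_pmf.prob (lrp_graph d \<beta> s N)
         {E. ereal (C\<^sub>s * ln (real N)) \<le> lrp_diameter d N E \<and>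
             lrp_diameter d N E \<le> ereal (ln (real N) powr \<delta>)}) \<longlonglongrightarrow> 1) \<and>
    (s = real d \<longrightarrow>
      (\<lambda>N. measure_pmf.prob (lrp_graph d \<beta> s N)
         {E. ereal (C\<^sub>1 * ln (real N) / ln (ln (real N))) \<le> lrp_diameter d N E \<and>
             lrp_diameter d N E \<le> ereal (C\<^sub>2 * ln (real N) / ln (ln (real N)))}) \<longlonglongrightarrow> 1)"
proof -
  obtain C1 where C1: "C1 > 0" "(\<lambda>N. measure_pmf.prob (lrp_graph d \<beta> (real d) N)
    {E. ereal (C1 * ln (real N) / ln (ln (real N))) \<le> lrp_diameter d N E}) \<longlonglongrightarrow> 1"
    using diameter_ge_ln_over_ln_ln[OF assms(2,1) refl] by blast
  obtain C2 where C2: "C2 > 0" "(\<lambda>N. measure_pmf.prob (lrp_graph d \<beta> (real d) N)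
    {E. lrp_diameter d N E \<le> ereal (C2 * ln (real N) / ln (ln (real N)))}) \<longlonglongrightarrow> 1"
    using diameter_le_ln_over_ln_ln[OF assms(2,1)] by blast
  \<comment> \<open>The constants are chosen after \<open>s\<close>; when \<open>s\<close> is
    outside the relevant range any admissible value will do. The same holds for
    \<open>\<delta>\<close>.\<close>
  obtain Cs where Cs: "Cs > 0" "real d < s \<Longrightarrow> (\<lambda>N. measure_pmf.prob (lrp_graph d \<beta> s N)
    {E. ereal (Cs * ln (real N)) \<le> lrp_diameter d N E}) \<longlonglongrightarrow> 1"
  proof (cases "real d < s")
    case True
    then show ?thesis using diameter_ge_ln[OF assms(2,1) True] that by blast
  next
    case False
    then show ?thesis using that[of 1] by simp
  qed
  obtain \<delta> where \<delta>: "\<delta> > 1" "s < 2 * real d \<Longrightarrow> (\<lambda>N. measure_pmf.prob (lrp_graph d \<beta> s N)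
    {E. lrp_diameter d N E \<le> ereal (ln (real N) powr \<delta>)}) \<longlonglongrightarrow> 1"
  proof (cases "s < 2 * real d")
    case True
    then show ?thesis using diameter_le_polylog[OF assms(2,1,3) True] that by blast
  next
    case False
    then show ?thesis using that[of 2] by simp
  qed
  obtain \<eta> where \<eta>: "\<eta> < 1" "(\<lambda>N. measure_pmf.prob (lrp_graph d \<beta> (2 * real d) N)
    {E. lrp_diameter d N E \<le> ereal (real N powr \<eta>)}) \<longlonglongrightarrow> 1"
    using diameter_le_power_critical[OF assms(2,1)] by blast
  \<comment> \<open>For \<beta> \<ge> 1 nothing is claimed about this exponent and 1/4 is a filler.
    In both cases it is below 1/2, and enlarging the upper exponent to at least 3/4 guarantees that
    the two are in order.\<close>
  define \<eta>1 where "\<eta>1 = (if \<beta> < 1 then (1 - \<beta>) / 2 else 1 / 4)"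
  define \<eta>2 where "\<eta>2 = max \<eta> (3 / 4)"
  have \<eta>12: "0 < \<eta>1" "\<eta>1 < \<eta>2" "\<eta>2 < 1" using assms(2) \<eta>(1) by (auto simp: \<eta>1_def \<eta>2_def)
  have upper: "(\<lambda>N. measure_pmf.prob (lrp_graph d \<beta> (2 * real d) N)
    {E. lrp_diameter d N E \<le> ereal (real N powr \<eta>2)}) \<longlonglongrightarrow> 1"
  proof (rule prob_tendsto_1_mono[OF \<eta>(2)])
    show "\<forall>\<^sub>F N in sequentially. {E. lrp_diameter d N E \<le> ereal (real N powr \<eta>)}
        \<subseteq> {E. lrp_diameter d N E \<le> ereal (real N powr \<eta>2)}"
      using eventually_ge_at_top[of 1]
    proof eventually_elim
      case (elim N)
      then have "real N powr \<eta> \<le> real N powr \<eta>2" by (intro powr_mono) (auto simp: \<eta>2_def)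
      then show ?case by (auto intro: order_trans)
    qed
  qed
  show ?thesis
  proof (rule exI[of _ C1], rule exI[of _ C2], rule exI[of _ Cs], rule exI[of _ \<delta>], rule exI[of _ \<eta>1],
      rule exI[of _ \<eta>2], intro conjI impI allI)
    fix \<psi> :: real
    assume "s > 2 * real d" "\<psi> < (s - 2 * real d) / (s - real d - 1)"
    then show "(\<lambda>N. measure_pmf.prob (lrp_graph d \<beta> s N)
        {E. lrp_diameter d N E \<ge> ereal (real N powr \<psi>)}) \<longlonglongrightarrow> 1"
      by (rule diameter_supercritical[OF assms(2,1)])
  next
    assume "s = 2 * real d"
    then show "(\<lambda>N. measure_pmf.prob (lrp_graph d \<beta> s N)
        {E. lrp_diameter d N E \<le> ereal (real N powr \<eta>2)}) \<longlonglongrightarrow> 1"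
      using upper by simp
  next
    assume *: "d = 1 \<and> s = 2 \<and> \<beta> < 1"
    then have e: "\<eta>1 = (1 - \<beta>) / 2" "d = 1" "s = 2" "\<beta> < 1" by (simp_all add: \<eta>1_def)
    show "(\<lambda>N. measure_pmf.prob (lrp_graph d \<beta> s N)
        {E. lrp_diameter d N E \<ge> ereal (real N powr \<eta>1)}) \<longlonglongrightarrow> 1"
      unfolding e(1-3) by (rule diameter_ge_power_critical[OF assms(2) e(4)])
  next
    assume "real d < s \<and> s < 2 * real d"
    then show "(\<lambda>N. measure_pmf.prob (lrp_graph d \<beta> s N)
        {E. ereal (Cs * ln (real N)) \<le> lrp_diameter d N E \<and>
            lrp_diameter d N E \<le> ereal (ln (real N) powr \<delta>)}) \<longlonglongrightarrow> 1"
      unfolding Collect_conj_eq by (intro prob_Int_tendsto_1 Cs(2) \<delta>(2)) auto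
  next
    assume "s = real d"
    then show "(\<lambda>N. measure_pmf.prob (lrp_graph d \<beta> s N)
        {E. ereal (C1 * ln (real N) / ln (ln (real N))) \<le> lrp_diameter d N E \<and>
            lrp_diameter d N E \<le> ereal (C2 * ln (real N) / ln (ln (real N)))}) \<longlonglongrightarrow> 1"
      unfolding Collect_conj_eq using C1(2) C2(2) by (intro prob_Int_tendsto_1) simp_all
  qed (use C1(1) C2(1) Cs(1) \<delta>(1) \<eta>12 in auto)
qed

end
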